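(* Let $\lambda/\mu$ be a skew shape with $n=dm$ boxes ($d,m$ positive integers), and let $(m^d)$ denote the partition of $n$ with $d$ parts equal to $m$. Then the signed sum $$\chi^{\lambda/\mu}((m^d))=\sum_{B\in\mathrm{BST}(\lambda/\mu,m)}(-1)^{\mathrm{height}(B)}$$ given by the Murnaghan--Nakayama rule is cancellation-free, i.e. $(-1)^{\mathrm{height}(B)}$ is the same for all $B\in\mathrm{BST}(\lambda/\mu,m)$. In particular, $$f^{\lambda/\mu}(\xi^d)=\chi^{\lambda/\mu}((m^d))=\varepsilon\,|\mathrm{BST}(\lambda/\mu,m)|,$$ where $\xi$ is a primitive $n$-th root of unity and $\varepsilon=(-1)^{\mathrm{height}(B)}$ for any $B\in\mathrm{BST}(\lambda/\mu,m)$.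
   Context: A border-strip is a connected non-empty skew Young diagram containing no $2\times 2$ square of boxes; its height is one less than the number of rows it spans. $\mathrm{BST}(\lambda/\mu,m)$ is the set of border-strip tableaux of shape $\lambda/\mu$ with all strips of size $m$: partitions of the diagram of $\lambda/\mu$ into border-strips $B_1,\dots,B_d$, each with $m$ boxes, where $B_j$ carries label $j$, such that labelling every box of $B_j$ by $j$ gives a filling weakly increasing along every row and down every column. The height of a border-strip tableau is the sum of the heights of its strips. The skew characters $\chi^{\lambda/\mu}(\nu)$, $\nu\vdash n$, are defined by $s_{\lambda/\mu}(\mathbf{x})=\sum_{\nu\vdash n}\chi^{\lambda/\mu}(\nu)\,p_\nu(\mathbf{x})/z_\nu$, where $s_{\lambda/\mu}$ is the skew Schur function, $p_\nu$ the power sum symmetric function, and $z_\nu=\prod_j m_j!\,j^{m_j}$ with $m_j$ the number of parts of $\nu$ equal to $j$. $f^{\lambda/\mu}(q)=\sum_{T\in\mathrm{SYT}(\lambda/\mu)}q^{\mathrm{maj}(T)}$, the sum over standard Young tableaux of shape $\lambda/\mu$ (English notation), where $\mathrm{maj}(T)$ is the sum of the descents of $T$, a descent being $j\in\{1,\dots,n-1\}$ such that $j+1$ appears in a row of strictly larger index (strictly lower) than $j$. (If $\mathrm{BST}(\lambda/\mu,m)$ is empty, the last equality just says that all quantities are $0$.) *)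

theory Defs
  imports Complex_Main "HOL-Library.Multiset" "HOL-Library.FuncSet"
begin

section \<open>Partitions and skew diagrams\<close>

definition is_partition :: "nat list \<Rightarrow> bool" where
  "is_partition nu \<longleftrightarrow> sorted_wrt (\<ge>) nu \<and> 0 \<notin> set nu"

definition partitions_of :: "nat \<Rightarrow> nat list set" where
  "partitions_of n = {nu. is_partition nu \<and> sum_list nu = n}"

text \<open>English notation: the box \<open>(i, j)\<close> is in row \<open>i\<close> (counted downwards) and column \<open>j\<close>,
  both counted from 0.\<close>

definition diagram :: "nat list \<Rightarrow> (nat \<times> nat) set" where
  "diagram nu = {(i, j). i < length nu \<and> j < nu ! i}"

definition is_skew_shape :: "nat list \<Rightarrow> nat list \<Rightarrow> bool" where
  "is_skew_shape lam mu \<longleftrightarrow>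
     is_partition lam \<and> is_partition mu \<and> diagram mu \<subseteq> diagram lam"

definition skew_diagram :: "nat list \<Rightarrow> nat list \<Rightarrow> (nat \<times> nat) set" where
  "skew_diagram lam mu = diagram lam - diagram mu"

definition rows_weakly_increasing :: "(nat \<times> nat) set \<Rightarrow> (nat \<times> nat \<Rightarrow> nat) \<Rightarrow> bool" where
  "rows_weakly_increasing D T \<longleftrightarrow>
     (\<forall>i j j'. (i, j) \<in> D \<longrightarrow> (i, j') \<in> D \<longrightarrow> j < j' \<longrightarrow> T (i, j) \<le> T (i, j'))"

definition rows_strictly_increasing :: "(nat \<times> nat) set \<Rightarrow> (nat \<times> nat \<Rightarrow> nat) \<Rightarrow> bool" where
  "rows_strictly_increasing D T \<longleftrightarrow>
     (\<forall>i j j'. (i, j) \<in> D \<longrightarrow> (i, j') \<in> D \<longrightarrow> j < j' \<longrightarrow> T (i, j) < T (i, j'))"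

definition columns_weakly_increasing :: "(nat \<times> nat) set \<Rightarrow> (nat \<times> nat \<Rightarrow> nat) \<Rightarrow> bool" where
  "columns_weakly_increasing D T \<longleftrightarrow>
     (\<forall>i i' j. (i, j) \<in> D \<longrightarrow> (i', j) \<in> D \<longrightarrow> i < i' \<longrightarrow> T (i, j) \<le> T (i', j))"

definition columns_strictly_increasing :: "(nat \<times> nat) set \<Rightarrow> (nat \<times> nat \<Rightarrow> nat) \<Rightarrow> bool" where
  "columns_strictly_increasing D T \<longleftrightarrow>
     (\<forall>i i' j. (i, j) \<in> D \<longrightarrow> (i', j) \<in> D \<longrightarrow> i < i' \<longrightarrow> T (i, j) < T (i', j))"


section \<open>Border-strip tableaux\<close>

definition adjacent_in :: "(nat \<times> nat) set \<Rightarrow> ((nat \<times> nat) \<times> (nat \<times> nat)) set" where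
  "adjacent_in S = {((i, j), (i', j')). (i, j) \<in> S \<and> (i', j') \<in> S \<and>
     (i = i' \<and> (j' = j + 1 \<or> j = j' + 1) \<or> j = j' \<and> (i' = i + 1 \<or> i = i' + 1))}"

definition connected_boxes :: "(nat \<times> nat) set \<Rightarrow> bool" where
  "connected_boxes S \<longleftrightarrow> (\<forall>a\<in>S. \<forall>b\<in>S. (a, b) \<in> (adjacent_in S)\<^sup>*)"

definition border_strip :: "(nat \<times> nat) set \<Rightarrow> bool" where
  "border_strip S \<longleftrightarrow>
     (\<exists>al be. is_skew_shape al be \<and> S = skew_diagram al be) \<and>
     S \<noteq> {} \<and> connected_boxes S \<and>
     \<not> (\<exists>i j. {(i, j), (i, j + 1), (i + 1, j), (i + 1, j + 1)} \<subseteq> S)"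

definition strip_height :: "(nat \<times> nat) set \<Rightarrow> nat" where
  "strip_height S = card (fst ` S) - 1"

definition strip :: "nat list \<Rightarrow> nat list \<Rightarrow> (nat \<times> nat \<Rightarrow> nat) \<Rightarrow> nat \<Rightarrow> (nat \<times> nat) set" where
  "strip lam mu B j = {b \<in> skew_diagram lam mu. B b = j}"

text \<open>A border-strip tableau \<open>B\<^sub>1, \<dots>, B\<^sub>d\<close> is represented by the filling that labels every box of
  \<open>B\<^sub>j\<close> by \<open>j\<close>. All fillings are extensional functions (\<open>undefined\<close> off the diagram), so that
  tableaux of a given shape are counted correctly by \<^const>\<open>card\<close>.\<close>

definition BST :: "nat list \<Rightarrow> nat list \<Rightarrow> nat \<Rightarrow> (nat \<times> nat \<Rightarrow> nat) set" where
  "BST lam mu m = {B \<in> extensional (skew_diagram lam mu).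
     (\<exists>d. B ` skew_diagram lam mu = {1..d} \<and>
          (\<forall>j\<in>{1..d}. border_strip (strip lam mu B j) \<and> card (strip lam mu B j) = m)) \<and>
     rows_weakly_increasing (skew_diagram lam mu) B \<and>
     columns_weakly_increasing (skew_diagram lam mu) B}"

definition height :: "nat list \<Rightarrow> nat list \<Rightarrow> (nat \<times> nat \<Rightarrow> nat) \<Rightarrow> nat" where
  "height lam mu B = (\<Sum>j\<in>B ` skew_diagram lam mu. strip_height (strip lam mu B j))"


section \<open>Symmetric functions and skew characters\<close>

text \<open>Formal power series over the rationals in variables \<open>x\<^sub>0, x\<^sub>1, x\<^sub>2, \<dots>\<close> are given by their
  coefficients; a monomial is the multiset of the indices of its variables.\<close>

type_synonym series = "nat multiset \<Rightarrow> rat"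

definition series_one :: series where
  "series_one M = (if M = {#} then 1 else 0)"

definition series_mult :: "series \<Rightarrow> series \<Rightarrow> series" where
  "series_mult f g M = (\<Sum>A | A \<subseteq># M. f A * g (M - A))"

definition SSYT :: "nat list \<Rightarrow> nat list \<Rightarrow> (nat \<times> nat \<Rightarrow> nat) set" where
  "SSYT lam mu = {T \<in> extensional (skew_diagram lam mu).
     rows_weakly_increasing (skew_diagram lam mu) T \<and>
     columns_strictly_increasing (skew_diagram lam mu) T}"

definition skew_schur :: "nat list \<Rightarrow> nat list \<Rightarrow> series" where
  "skew_schur lam mu M =
     of_nat (card {T \<in> SSYT lam mu. image_mset T (mset_set (skew_diagram lam mu)) = M})"

text \<open>The series \<open>\<Sum>\<^sub>i x\<^sub>i\<^sup>k\<close>, for \<open>k \<ge> 1\<close>.\<close>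

definition power_sum :: "nat \<Rightarrow> series" where
  "power_sum k M = (if \<exists>i. M = replicate_mset k i then 1 else 0)"

definition power_sum_partition :: "nat list \<Rightarrow> series" where
  "power_sum_partition nu = foldr (\<lambda>k. series_mult (power_sum k)) nu series_one"

definition z_partition :: "nat list \<Rightarrow> nat" where
  "z_partition nu = (\<Prod>j\<in>set nu. fact (count_list nu j) * j ^ count_list nu j)"

text \<open>The skew characters \<open>\<chi>(\<nu>)\<close>, for partitions \<open>\<nu>\<close> of the number of boxes, are the coefficients
  in the expansion of the skew Schur function in the linearly independent series
  \<open>p\<^sub>\<nu> / z\<^sub>\<nu>\<close>; other arguments get the value 0, which makes the function unique.\<close>

definition skew_character :: "nat list \<Rightarrow> nat list \<Rightarrow> nat list \<Rightarrow> rat" where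
  "skew_character lam mu = (THE chi.
     (\<forall>nu. nu \<notin> partitions_of (card (skew_diagram lam mu)) \<longrightarrow> chi nu = 0) \<and>
     (\<forall>M. skew_schur lam mu M =
        (\<Sum>nu\<in>partitions_of (card (skew_diagram lam mu)).
           chi nu * power_sum_partition nu M / of_nat (z_partition nu))))"


section \<open>Standard Young tableaux and the major index\<close>

definition SYT :: "nat list \<Rightarrow> nat list \<Rightarrow> (nat \<times> nat \<Rightarrow> nat) set" where
  "SYT lam mu = {T \<in> extensional (skew_diagram lam mu).
     bij_betw T (skew_diagram lam mu) {1..card (skew_diagram lam mu)} \<and>
     rows_strictly_increasing (skew_diagram lam mu) T \<and>
     columns_strictly_increasing (skew_diagram lam mu) T}"

definition descents :: "nat list \<Rightarrow> nat list \<Rightarrow> (nat \<times> nat \<Rightarrow> nat) \<Rightarrow> nat set" where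
  "descents lam mu T = {k \<in> {1..<card (skew_diagram lam mu)}.
     \<exists>a\<in>skew_diagram lam mu. \<exists>b\<in>skew_diagram lam mu.
       T a = k \<and> T b = k + 1 \<and> fst a < fst b}"

definition maj :: "nat list \<Rightarrow> nat list \<Rightarrow> (nat \<times> nat \<Rightarrow> nat) \<Rightarrow> nat" where
  "maj lam mu T = (\<Sum>k\<in>descents lam mu T. k)"

definition maj_polynomial :: "nat list \<Rightarrow> nat list \<Rightarrow> complex \<Rightarrow> complex" where
  "maj_polynomial lam mu q = (\<Sum>T\<in>SYT lam mu. q ^ maj lam mu T)"

definition primitive_root_of_unity :: "nat \<Rightarrow> complex \<Rightarrow> bool" where
  "primitive_root_of_unity n \<xi> \<longleftrightarrow> \<xi> ^ n = 1 \<and> (\<forall>k. 0 < k \<and> k < n \<longrightarrow> \<xi> ^ k \<noteq> 1)"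

end

theory Submission
  imports Defs "HOL-Combinatorics.Transposition"
begin

text \<open>
  Encode a shape with at most \<open>N\<close> rows \<open>f 0 \<ge> f 1 \<ge> \<dots>\<close> by its strictly decreasing bead positions
  \<open>f i - i\<close>. On functions of integer vectors of length \<open>N\<close> the commuting shifts \<open>l \<mapsto> l - e\<^sub>i\<close> play the
  role of variables, so that every symmetric function acts: \<open>p\<^sub>k\<close> sums over all ways to lower one
  coordinate by \<open>k\<close>, and \<open>h\<^sub>a\<close> over all ways to lower the coordinates by \<open>a\<close> in total. Let \<open>\<delta>\<close>
  be the alternating function supported on the permutations of the beads of the inner shape \<open>\<mu>\<close>.

  Take any alternating function that vanishes below the range of the beads of shapes, and evaluate
  at the beads of a shape. A sign-reversing involution shows that \<open>h\<^sub>a\<close> is then the sum over all ways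
  to remove a horizontal strip of size \<open>a\<close> (\<open>Pieri\<close>).
  Straightening the vectors in the sum for \<open>p\<^sub>m\<close> shows that it is the signed sum over all ways to
  remove a border strip of size \<open>m\<close>, because moving a bead \<open>m\<close> places past \<open>r\<close> others is
  the same as removing a border strip of height \<open>r\<close> (\<open>Murnaghan_Nakayama_step\<close>).
  So, evaluated at the beads of \<open>\<lambda>\<close>, products of the \<open>h\<^sub>a\<close> applied to \<open>\<delta>\<close> count semistandard
  tableaux, and \<open>p\<^sub>m\<^sup>d \<delta>\<close> is the signed count of border-strip tableaux.

  It remains to identify the character and the value of the major index polynomial with
  \<open>(p\<^sub>m\<^sup>d \<delta>)(\<lambda>)\<close>, and to see that all border-strip tableaux have the same sign.

  The character: Newton's identity \<open>a h\<^sub>a = p\<^sub>1 h\<^sub>a\<^sub>-\<^sub>1 + \<dots> + p\<^sub>a\<close> gives the Cauchy-type expansion of a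
  product of complete functions in the products \<open>p\<^sub>\<nu>(x) p\<^sub>\<nu>(shifts) / z\<^sub>\<nu>\<close>
  (\<open>h_product_power_sums\<close>). Hence \<open>s\<^bsub>\<lambda>/\<mu>\<^esub>\<close> is the sum of the \<open>(p\<^sub>\<nu> \<delta>)(\<lambda>) p\<^sub>\<nu> / z\<^sub>\<nu>\<close>, and
  by linear independence of the \<open>p\<^sub>\<nu>\<close> the value of the skew character at \<open>\<nu>\<close> is \<open>(p\<^sub>\<nu> \<delta>)(\<lambda>)\<close>.

  The sign: on each residue class modulo \<open>m\<close>, bead moves by \<open>m\<close> never let two beads pass each
  other. So the permutation that a border-strip tableau induces on the beads depends only on
  \<open>\<lambda>\<close> and \<open>\<mu>\<close>, and with it the sign (\<open>runner_order_tableau\<close>).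

  The major index: sorting standard tableaux by a final run without descents writes the generating
  function of the major index as \<open>(E\<^sub>n \<delta>)(\<lambda>)\<close>, where \<open>E\<^sub>n\<close> is defined by a recursion in the \<open>h\<^sub>a\<close>
  with coefficients polynomial in \<open>q\<close> (\<open>maj_operator_standard\<close>); in symmetric function terms
  \<open>E\<^sub>n = (1 - q) \<dots> (1 - q\<^sup>n) h\<^sub>n[X / (1 - q)]\<close>. At a primitive \<open>m\<close>-th root of unity this
  collapses to \<open>E\<^bsub>dm\<^esub> = p\<^sub>m\<^sup>d\<close> (\<open>maj_operator_root_of_unity\<close>).
\<close>

section \<open>Power sums and complete functions acting on alternating functions\<close>

definition alternating :: "nat \<Rightarrow> ((nat \<Rightarrow> int) \<Rightarrow> 'a::field_char_0) \<Rightarrow> bool" where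
  "alternating N F \<longleftrightarrow> (\<forall>i l. Suc i < N \<longrightarrow> F (l \<circ> transpose i (Suc i)) = - F l)"

definition compositions :: "nat \<Rightarrow> nat \<Rightarrow> (nat \<Rightarrow> nat) set" where
  "compositions N a = {c. (\<forall>i\<ge>N. c i = 0) \<and> (\<Sum>i<N. c i) = a}"

text \<open>The power sum \<open>p\<^sub>k\<close> and the complete function \<open>h\<^sub>a\<close> of the \<open>N\<close> shift operators \<open>l \<mapsto> l - e\<^sub>i\<close>.\<close>

definition p_op :: "nat \<Rightarrow> nat \<Rightarrow> ((nat \<Rightarrow> int) \<Rightarrow> 'a::field_char_0) \<Rightarrow> (nat \<Rightarrow> int) \<Rightarrow> 'a" where
  "p_op N k F l = (\<Sum>i<N. F (l(i := l i - int k)))"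

definition h_op :: "nat \<Rightarrow> nat \<Rightarrow> ((nat \<Rightarrow> int) \<Rightarrow> 'a::field_char_0) \<Rightarrow> (nat \<Rightarrow> int) \<Rightarrow> 'a" where
  "h_op N a F l = (\<Sum>c\<in>compositions N a. F (\<lambda>i. l i - int (c i)))"

lemma finite_bounded_vectors:
  fixes C :: "(nat \<Rightarrow> nat) set"
  assumes "\<And>c i. c \<in> C \<Longrightarrow> i < N \<Longrightarrow> c i \<le> a" "\<And>c i. c \<in> C \<Longrightarrow> i \<ge> N \<Longrightarrow> c i = 0"
  shows "finite C"
proof (rule finite_subset)
  show "C \<subseteq> {c. \<forall>i. (i \<in> {..<N} \<longrightarrow> c i \<in> {..a}) \<and> (i \<notin> {..<N} \<longrightarrow> c i = 0)}"
    using assms by auto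
  show "finite {c::nat\<Rightarrow>nat. \<forall>i. (i \<in> {..<N} \<longrightarrow> c i \<in> {..a}) \<and> (i \<notin> {..<N} \<longrightarrow> c i = 0)}"
    by (rule finite_set_of_finite_funs) auto
qed

lemma finite_compositions: "finite (compositions N a)"
  by (rule finite_bounded_vectors[of _ N a]) (auto simp: compositions_def intro!: member_le_sum)

lemma compositions_0: "compositions N 0 = {\<lambda>_. 0}"
  by (auto simp: compositions_def fun_eq_iff) (metis linorder_not_le lessThan_iff)

lemma h_op_0 [simp]: "h_op N 0 F = F"
  by (simp add: h_op_def compositions_0 fun_eq_iff)

lemma p_op_weighted_sum: "p_op N k (\<lambda>l. \<Sum>x\<in>A. u x * G x l) l = (\<Sum>x\<in>A. u x * p_op N k (G x) l)"
  unfolding p_op_def sum_distrib_left by (subst sum.swap) rule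

lemma h_op_weighted_sum: "h_op N k (\<lambda>l. \<Sum>x\<in>A. u x * G x l) l = (\<Sum>x\<in>A. u x * h_op N k (G x) l)"
  unfolding h_op_def sum_distrib_left by (subst sum.swap) rule

lemma h_op_sum: "h_op N k (\<lambda>l. \<Sum>x\<in>A. G x l) l = (\<Sum>x\<in>A. h_op N k (G x) l)"
  unfolding h_op_def by (rule sum.swap)

lemma p_op_scale: "p_op N k (\<lambda>l. u * G l) l = u * p_op N k G l"
  unfolding p_op_def sum_distrib_left ..

lemma h_op_scale: "h_op N k (\<lambda>l. u * G l) l = u * h_op N k G l"
  unfolding h_op_def sum_distrib_left ..

lemma h_op_p_op_commute: "h_op N a (p_op N k F) = p_op N k (h_op N a F)"
proof
  fix l :: "nat \<Rightarrow> int"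
  have "(\<lambda>j. l j - int (c j))(i := l i - int (c i) - int k)
      = (\<lambda>j. (l(i := l i - int k)) j - int (c j))" for c i by auto
  then show "h_op N a (p_op N k F) l = p_op N k (h_op N a F) l"
    unfolding h_op_def p_op_def by (subst sum.swap) simp
qed

lemma p_op_commute: "p_op N j (p_op N k F) = p_op N k (p_op N j F)"
proof
  fix l :: "nat \<Rightarrow> int"
  have "(l(i := l i - int j))(i' := (l(i := l i - int j)) i' - int k)
      = (l(i' := l i' - int k))(i := (l(i' := l i' - int k)) i - int j)" for i i'
    by (auto simp: fun_eq_iff)
  then show "p_op N j (p_op N k F) l = p_op N k (p_op N j F) l"
    unfolding p_op_def by (subst sum.swap) simp
qed

text \<open>Newton's identity \<open>a h\<^sub>a = p\<^sub>1 h\<^sub>a\<^sub>-\<^sub>1 + \<dots> + p\<^sub>a\<close>: a composition \<open>c\<close> of \<open>a\<close> with a marked unit in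
  the \<open>i\<close>-th entry, say the \<open>k\<close>-th one, is lowered by \<open>k e\<^sub>i\<close> to a composition of \<open>a - k\<close>.\<close>

lemma Newton:
  "of_nat a * h_op N a F l = (\<Sum>k=1..a. p_op N k (h_op N (a - k) F) l)"
proof -
  have *: "(\<Sum>c\<in>compositions N a. of_nat (c i) * F (\<lambda>j. l j - int (c j)))
      = (\<Sum>k=1..a. \<Sum>c\<in>compositions N (a - k). F (\<lambda>j. (l(i := l i - int k)) j - int (c j)))"
    if i: "i < N" for i
  proof -
    have sum_upd: "(\<Sum>j<N. (c(i := x)) j) + c i = (\<Sum>j<N. c j) + x" for c :: "nat \<Rightarrow> nat" and x
    proof -
      have "(\<Sum>j<N. (c(i := x)) j) = x + (\<Sum>j\<in>{..<N}-{i}. c j)"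
        using i by (subst sum.remove[of _ i]) (auto intro!: sum.cong)
      moreover have "(\<Sum>j<N. c j) = c i + (\<Sum>j\<in>{..<N}-{i}. c j)"
        using i by (subst sum.remove[of _ i]) auto
      ultimately show ?thesis by simp
    qed
    have le: "c i \<le> a" if "c \<in> compositions N a" for c
      using that i member_le_sum[of i "{..<N}" c] by (auto simp: compositions_def)
    have "(\<Sum>c\<in>compositions N a. of_nat (c i) * F (\<lambda>j. l j - int (c j)))
        = (\<Sum>c\<in>compositions N a. \<Sum>k\<in>{1..c i}. F (\<lambda>j. l j - int (c j)))" by simp
    also have "\<dots> = (\<Sum>(c, k)\<in>Sigma (compositions N a) (\<lambda>c. {1..c i}). F (\<lambda>j. l j - int (c j)))"
      by (rule sum.Sigma) (auto simp: finite_compositions)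
    also have "\<dots> = (\<Sum>(k, c)\<in>Sigma {1..a} (\<lambda>k. compositions N (a - k)).
        F (\<lambda>j. (l(i := l i - int k)) j - int (c j)))"
    proof (rule sum.reindex_bij_witness[where
          i = "\<lambda>(k, c). (c(i := c i + k), k)" and j = "\<lambda>(c, k). (k, c(i := c i - k))"])
      fix p assume p: "p \<in> Sigma (compositions N a) (\<lambda>c. {1..c i})"
      obtain c k where [simp]: "p = (c, k)" by force
      have c: "c \<in> compositions N a" "1 \<le> k" "k \<le> c i" using p by auto
      show "(case p of (c, k) \<Rightarrow> (k, c(i := c i - k))) \<in> Sigma {1..a} (\<lambda>k. compositions N (a - k))"
        using c le[OF c(1)] sum_upd[of c "c i - k"] i by (auto simp: compositions_def)
      show "(case case p of (c, k) \<Rightarrow> (k, c(i := c i - k)) of (k, c) \<Rightarrow> (c(i := c i + k), k)) = p"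
        using c by auto
      have "(\<lambda>j. (l(i := l i - int k)) j - int ((c(i := c i - k)) j)) = (\<lambda>j. l j - int (c j))"
        using c by auto
      then show "(case case p of (c, k) \<Rightarrow> (k, c(i := c i - k)) of
            (k, c) \<Rightarrow> F (\<lambda>j. (l(i := l i - int k)) j - int (c j))) =
         (case p of (c, k) \<Rightarrow> F (\<lambda>j. l j - int (c j)))" by simp
    next
      fix p assume p: "p \<in> Sigma {1..a} (\<lambda>k. compositions N (a - k))"
      obtain k c where [simp]: "p = (k, c)" by force
      have c: "c \<in> compositions N (a - k)" "1 \<le> k" "k \<le> a" using p by auto
      show "(case p of (k, c) \<Rightarrow> (c(i := c i + k), k)) \<in> Sigma (compositions N a) (\<lambda>c. {1..c i})"
        using c sum_upd[of c "c i + k"] i by (auto simp: compositions_def)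
      show "(case case p of (k, c) \<Rightarrow> (c(i := c i + k), k) of (c, k) \<Rightarrow> (k, c(i := c i - k))) = p"
        by auto
    qed
    also have "\<dots> = (\<Sum>k=1..a. \<Sum>c\<in>compositions N (a - k). F (\<lambda>j. (l(i := l i - int k)) j - int (c j)))"
      by (rule sum.Sigma[symmetric]) (auto simp: finite_compositions)
    finally show ?thesis .
  qed
  have "of_nat a * h_op N a F l
      = (\<Sum>c\<in>compositions N a. (\<Sum>i<N. of_nat (c i)) * F (\<lambda>j. l j - int (c j)))"
    unfolding h_op_def sum_distrib_left
    by (rule sum.cong) (auto simp: compositions_def simp flip: of_nat_sum)
  also have "\<dots> = (\<Sum>i<N. \<Sum>c\<in>compositions N a. of_nat (c i) * F (\<lambda>j. l j - int (c j)))"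
    unfolding sum_distrib_right by (rule sum.swap)
  also have "\<dots> = (\<Sum>i<N. \<Sum>k=1..a. \<Sum>c\<in>compositions N (a - k).
      F (\<lambda>j. (l(i := l i - int k)) j - int (c j)))"
    by (rule sum.cong) (use * in auto)
  also have "\<dots> = (\<Sum>k=1..a. p_op N k (h_op N (a - k) F) l)"
    unfolding p_op_def h_op_def by (rule sum.swap)
  finally show ?thesis .
qed

lemma transpose_below: "Suc i < N \<Longrightarrow> transpose i (Suc i) j < N \<longleftrightarrow> j < N"
  by (auto simp: transpose_def)

lemma sum_transpose:
  "Suc i < N \<Longrightarrow> (\<Sum>j<N. G (transpose i (Suc i) j)) = (\<Sum>j<N. G j)"
  by (rule sum.reindex_bij_witness[where i = "transpose i (Suc i)" and j = "transpose i (Suc i)"])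
    (auto simp: transpose_below)

lemma alternating_p_op:
  assumes "alternating N F" shows "alternating N (p_op N k F)"
  unfolding alternating_def
proof (intro allI impI)
  fix i and l :: "nat \<Rightarrow> int" assume i: "Suc i < N"
  let ?t = "transpose i (Suc i)"
  have "(l \<circ> ?t)(j := (l \<circ> ?t) j - int k) = l(?t j := l (?t j) - int k) \<circ> ?t" for j
    by (auto simp: fun_eq_iff transpose_eq_iff)
  then have "p_op N k F (l \<circ> ?t) = (\<Sum>j<N. - F (l(?t j := l (?t j) - int k)))"
    using assms i by (simp add: p_op_def alternating_def)
  also have "\<dots> = - p_op N k F l"
    using sum_transpose[OF i, of "\<lambda>j. F (l(j := l j - int k))"] by (simp add: p_op_def sum_negf)
  finally show "p_op N k F (l \<circ> ?t) = - p_op N k F l" .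
qed

lemma compositions_transpose:
  "Suc i < N \<Longrightarrow> c \<in> compositions N a \<Longrightarrow> c \<circ> transpose i (Suc i) \<in> compositions N a"
  using sum_transpose[of i N c] by (auto simp: compositions_def transpose_def)

lemma alternating_h_op:
  assumes "alternating N F" shows "alternating N (h_op N a F)"
  unfolding alternating_def
proof (intro allI impI)
  fix i and l :: "nat \<Rightarrow> int" assume i: "Suc i < N"
  let ?t = "transpose i (Suc i)"
  have "(\<lambda>j. (l \<circ> ?t) j - int (c j)) = (\<lambda>j. l j - int ((c \<circ> ?t) j)) \<circ> ?t" for c
    by (auto simp: fun_eq_iff)
  then have "h_op N a F (l \<circ> ?t) = (\<Sum>c\<in>compositions N a. - F (\<lambda>j. l j - int ((c \<circ> ?t) j)))"
    using assms i by (simp only: h_op_def alternating_def)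
  also have "\<dots> = (\<Sum>c\<in>compositions N a. - F (\<lambda>j. l j - int (c j)))"
    by (rule sum.reindex_bij_witness[where i = "\<lambda>c. c \<circ> ?t" and j = "\<lambda>c. c \<circ> ?t"])
      (auto simp: compositions_transpose i fun_eq_iff simp del: comp_apply simp add: comp_assoc)
  finally show "h_op N a F (l \<circ> ?t) = - h_op N a F l" by (simp add: h_op_def sum_negf)
qed

text \<open>A Vandermonde-like product; it is alternating whenever \<open>r\<close> is antisymmetric.\<close>

definition pair_product :: "nat \<Rightarrow> (int \<Rightarrow> int \<Rightarrow> 'a::field_char_0) \<Rightarrow> (nat \<Rightarrow> int) \<Rightarrow> 'a" where
  "pair_product N r l = (\<Prod>(a, b)\<in>{(a, b). a < b \<and> b < N}. r (l a) (l b))"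

lemma finite_pairs: "finite {(a::nat, b). a < b \<and> b < N}"
  by (rule finite_subset[of _ "{..<N} \<times> {..<N}"]) auto

lemma alternating_pair_product:
  assumes "\<And>x y. r y x = - r x y"
  shows "alternating N (pair_product N r)"
  unfolding alternating_def
proof (intro allI impI)
  fix i and l :: "nat \<Rightarrow> int" assume i: "Suc i < N"
  let ?t = "transpose i (Suc i)" and ?Q = "{(a::nat, b). a < b \<and> b < N}"
  have mem: "(i, Suc i) \<in> ?Q" using i by auto
  have split: "pair_product N r l' = r (l' i) (l' (Suc i)) *
      (\<Prod>(a, b)\<in>?Q - {(i, Suc i)}. r (l' a) (l' b))" for l' :: "nat \<Rightarrow> int"
    unfolding pair_product_def by (subst prod.remove[OF finite_pairs mem]) simp
  have "(\<Prod>(a, b)\<in>?Q - {(i, Suc i)}. r ((l \<circ> ?t) a) ((l \<circ> ?t) b))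
      = (\<Prod>(a, b)\<in>?Q - {(i, Suc i)}. r (l a) (l b))"
    by (rule prod.reindex_bij_witness[where i = "map_prod ?t ?t" and j = "map_prod ?t ?t"])
      (use i in \<open>auto simp: transpose_def split: if_splits\<close>)
  then show "pair_product N r (l \<circ> ?t) = - pair_product N r l"
    unfolding split using assms[of "l i" "l (Suc i)"] by simp
qed

section \<open>Shapes and bead positions\<close>

definition boxes :: "(nat \<Rightarrow> nat) \<Rightarrow> (nat \<times> nat) set" where
  "boxes f = {(i, j). j < f i}"

definition shape :: "nat \<Rightarrow> (nat \<Rightarrow> nat) \<Rightarrow> bool" where
  "shape N f \<longleftrightarrow> antimono f \<and> (\<forall>i\<ge>N. f i = 0)"

text \<open>The beads are strictly decreasing, and an alternating function is determined by its values on
  such vectors. The usual bead position adds the constant \<open>N - 1\<close>.\<close>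

definition beads :: "(nat \<Rightarrow> nat) \<Rightarrow> nat \<Rightarrow> int" where
  "beads f i = int (f i) - int i"

text \<open>Vectors with an entry at most \<open>- N\<close> do not come from shapes, as they would need a row of
  negative length. Vanishing there survives all operators, since they only lower entries.\<close>

definition supported :: "nat \<Rightarrow> ((nat \<Rightarrow> int) \<Rightarrow> 'a::field_char_0) \<Rightarrow> bool" where
  "supported N F \<longleftrightarrow> (\<forall>l. F l \<noteq> 0 \<longrightarrow> (\<forall>i<N. l i > - int N))"

text \<open>The signed indicator function of the permutations of \<open>beads g\<close>, written without permutations.\<close>

definition alternating_delta :: "nat \<Rightarrow> (nat \<Rightarrow> nat) \<Rightarrow> (nat \<Rightarrow> int) \<Rightarrow> 'a::field_char_0" where
  "alternating_delta N g l = (if l ` {..<N} = beads g ` {..<N}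
     then pair_product N (\<lambda>x y. of_int (sgn (x - y))) l else 0)"

definition horizontal_strips :: "nat \<Rightarrow> nat \<Rightarrow> (nat \<Rightarrow> nat) \<Rightarrow> (nat \<Rightarrow> nat) set" where
  "horizontal_strips N a f =
     {h. (\<forall>i. h i \<le> f i \<and> f (Suc i) \<le> h i) \<and> (\<Sum>i<N. f i - h i) = a}"

lemma beads_strict:
  assumes "shape N f" "i < j" shows "beads f j < beads f i"
  using antimonoD[of f i j] assms by (simp add: beads_def shape_def)

lemma supported_p_op:
  assumes "supported N F" shows "supported N (p_op N k F)"
  unfolding supported_def
proof (intro allI impI)
  fix l i assume "p_op N k F l \<noteq> 0" and i: "i < N"
  then obtain j where "j < N" "F (l(j := l j - int k)) \<noteq> 0"
    unfolding p_op_def by (meson lessThan_iff sum.neutral)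
  then have "(l(j := l j - int k)) i > - int N" using assms i unfolding supported_def by blast
  then show "l i > - int N" by (auto split: if_splits)
qed

lemma supported_h_op:
  assumes "supported N F" shows "supported N (h_op N a F)"
  unfolding supported_def
proof (intro allI impI)
  fix l i assume "h_op N a F l \<noteq> 0" and i: "i < N"
  then obtain c where "F (\<lambda>j. l j - int (c j)) \<noteq> 0"
    unfolding h_op_def by (meson sum.neutral)
  then have "l i - int (c i) > - int N" using assms i by (auto simp: supported_def)
  then show "l i > - int N" by simp
qed

lemma alternating_delta_supported:
  assumes "shape N g" shows "supported N (alternating_delta N g)"
  unfolding supported_def
proof (intro allI impI)
  fix l i assume "alternating_delta N g l \<noteq> 0" and i: "i < N"
  then have "l i \<in> beads g ` {..<N}" by (auto simp: alternating_delta_def split: if_splits)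
  then show "l i > - int N" by (auto simp: beads_def)
qed

lemma alternating_delta_alternating: "alternating N (alternating_delta N g)"
proof -
  have alt: "alternating N (pair_product N (\<lambda>x y. of_int (sgn (x - y)) :: 'a))"
    by (rule alternating_pair_product) (auto simp: sgn_if)
  have im: "(l \<circ> transpose i (Suc i)) ` {..<N} = l ` {..<N}" if "Suc i < N"
    for l :: "nat \<Rightarrow> int" and i
  proof -
    have "transpose i (Suc i) ` {..<N} = {..<N}"
      using that by (intro transpose_image_eq) auto
    then show ?thesis by (metis image_comp)
  qed
  show ?thesis
    using alt im by (simp add: alternating_def alternating_delta_def)
qed

lemma strict_decreasing_unique:
  fixes l l' :: "nat \<Rightarrow> int"
  assumes "\<And>i j. i < j \<Longrightarrow> j < N \<Longrightarrow> l j < l i" "\<And>i j. i < j \<Longrightarrow> j < N \<Longrightarrow> l' j < l' i"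
    and "l ` {..<N} = l' ` {..<N}" "i < N"
  shows "l i = l' i"
proof -
  have *: "sorted_wrt (>) (map l [0..<N])" "sorted_wrt (>) (map l' [0..<N])"
    using assms by (auto simp: sorted_wrt_iff_nth_less)
  have srt: "sorted (rev xs) \<and> distinct (rev xs)" if "sorted_wrt (>) xs" for xs :: "int list"
    using that by (metis sorted_wrt_rev strict_sorted_iff)
  have "rev (map l [0..<N]) = rev (map l' [0..<N])"
    by (rule sorted_distinct_set_unique)
      (use srt[OF *(1)] srt[OF *(2)] assms(3) in \<open>auto simp: atLeast0LessThan\<close>)
  then show ?thesis using assms(4) by (simp del: rev_map)
qed

lemma alternating_delta_beads:
  assumes f: "shape N f" and g: "shape N g"
  shows "alternating_delta N g (beads f) = (if f = g then 1 else 0)"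
proof (cases "beads f ` {..<N} = beads g ` {..<N}")
  case True
  have eq: "f i = g i" for i
  proof (cases "i < N")
    case i: True
    have "beads f i = beads g i"
      by (rule strict_decreasing_unique[of N]) (use True i beads_strict f g in auto)
    then show ?thesis by (simp add: beads_def)
  qed (use f g in \<open>auto simp: shape_def\<close>)
  have "pair_product N (\<lambda>x y. of_int (sgn (x - y)) :: 'a) (beads f) = 1"
    unfolding pair_product_def
    by (rule prod.neutral) (force simp: sgn_if dest: beads_strict[OF f])
  with eq True show ?thesis by (auto simp: alternating_delta_def)
qed (auto simp: alternating_delta_def)

section \<open>The Pieri rule\<close>

lemma alternating_eq_0:
  assumes "alternating N F" "Suc i < N" "l i = l (Suc i)" shows "F l = 0"
proof -
  have "l \<circ> transpose i (Suc i) = l" using assms(3) by (auto simp: transpose_def fun_eq_iff)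
  then have "F l = - F l" using assms(1,2) by (metis alternating_def)
  then show ?thesis by simp
qed

text \<open>Entry \<open>i\<close> moves to position \<open>k\<close>, and the entries between them move up by one.\<close>

definition cycle_entry :: "nat \<Rightarrow> nat \<Rightarrow> (nat \<Rightarrow> int) \<Rightarrow> nat \<Rightarrow> int" where
  "cycle_entry i k l r = (if i \<le> r \<and> r < k then l (Suc r) else if r = k then l i else l r)"

lemma alternating_cycle:
  assumes "alternating N F" "i \<le> k" "k < N"
  shows "F (cycle_entry i k l) = (-1) ^ (k - i) * F l"
  using assms(2,3)
proof (induction k rule: dec_induct)
  case base
  have "cycle_entry i i l = l" by (auto simp: cycle_entry_def)
  then show ?case by simp
next
  case (step k)
  have "cycle_entry i (Suc k) l = cycle_entry i k l \<circ> transpose k (Suc k)"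
    using step by (auto simp: cycle_entry_def transpose_def fun_eq_iff)
  then show ?case
    using step assms(1) by (simp add: alternating_def Suc_diff_le del: comp_apply)
qed

lemma alternating_repeated:
  assumes "alternating N F" "i < j" "j < N" "l i = l j" shows "F l = 0"
proof -
  let ?l = "cycle_entry i (j - 1) l"
  have "F ?l = 0"
    by (rule alternating_eq_0[OF assms(1), of "j - 1"])
      (use assms in \<open>auto simp: cycle_entry_def\<close>)
  then show ?thesis using alternating_cycle[OF assms(1), of i "j - 1" l] assms by auto
qed

text \<open>The terms of \<open>h\<^sub>a F\<close> that are not horizontal strips have a row \<open>i\<close> whose lowered bead is at or
  below the original bead of row \<open>i + 1\<close>. Exchanging the lowered beads \<open>i\<close> and \<open>i + 1\<close>, for the
  first such \<open>i\<close>, keeps the total amount \<open>a\<close>, keeps \<open>i\<close> the first such row, and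
  changes the sign; so these terms cancel.\<close>

theorem Pieri:
  assumes alt: "alternating N F" and sup: "supported N F" and f: "shape N f"
  shows "h_op N a F (beads f) = (\<Sum>h\<in>horizontal_strips N a f. F (beads h))"
proof -
  define l where "l = beads f"
  define bad where "bad c i \<longleftrightarrow> Suc i < N \<and> l i - int (c i) \<le> l (Suc i)" for c i
  define Bad where "Bad = {c \<in> compositions N a. \<exists>i. bad c i}"
  define first where "first c = (LEAST i. bad c i)" for c
  \<comment> \<open>The entries of the new composition are chosen so that the lowered beads are exchanged.\<close>
  define flip where "flip c = (let i = first c in
     c(i := nat (l i - (l (Suc i) - int (c (Suc i)))),
       Suc i := nat (l (Suc i) - (l i - int (c i)))))" for c
  have f0: "f i = 0" if "i \<ge> N" for i using f that by (auto simp: shape_def)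
  have dec: "l (Suc i) < l i" for i using beads_strict[OF f, of i "Suc i"] by (simp add: l_def)
  have bad_first: "bad c (first c)" if "c \<in> Bad" for c
    using that unfolding Bad_def first_def by (auto intro: LeastI)
  have flip: "flip c \<in> Bad \<and> flip (flip c) = c \<and>
      (\<lambda>i. l i - int (flip c i)) = (\<lambda>i. l i - int (c i)) \<circ> transpose (first c) (Suc (first c))"
    if c: "c \<in> Bad" for c
  proof -
    let ?i = "first c"
    have b: "Suc ?i < N" "l ?i - int (c ?i) \<le> l (Suc ?i)"
      using bad_first[OF c] by (auto simp: bad_def)
    have c1: "int (flip c ?i) = l ?i - (l (Suc ?i) - int (c (Suc ?i)))"
      and c2: "int (flip c (Suc ?i)) = l (Suc ?i) - (l ?i - int (c ?i))"
      and c3: "\<And>j. j \<noteq> ?i \<Longrightarrow> j \<noteq> Suc ?i \<Longrightarrow> flip c j = c j"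
      using b dec[of ?i] by (auto simp: flip_def Let_def)
    have comp: "(\<lambda>i. l i - int (flip c i)) = (\<lambda>i. l i - int (c i)) \<circ> transpose ?i (Suc ?i)"
      using c1 c2 c3 by (auto simp: fun_eq_iff transpose_def)
    have two: "(\<Sum>j<N. x j) = x ?i + x (Suc ?i) + (\<Sum>j\<in>{..<N} - {?i, Suc ?i}. x j)"
      for x :: "nat \<Rightarrow> nat"
    proof -
      have "{..<N} = insert ?i (insert (Suc ?i) ({..<N} - {?i, Suc ?i}))" using b by auto
      then show ?thesis
        by (metis (no_types, lifting) Diff_iff add.assoc finite_Diff finite_insert finite_lessThan
            insertCI insertE n_not_Suc_n sum.insert)
    qed
    have "(\<Sum>j\<in>{..<N} - {?i, Suc ?i}. flip c j) = (\<Sum>j\<in>{..<N} - {?i, Suc ?i}. c j)"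
      by (rule sum.cong) (use c3 in auto)
    moreover have "flip c ?i + flip c (Suc ?i) = c ?i + c (Suc ?i)"
      using c1 c2 by linarith
    ultimately have "(\<Sum>j<N. flip c j) = (\<Sum>j<N. c j)"
      using two[of c] two[of "flip c"] by simp
    moreover have "flip c j = 0" if "j \<ge> N" for j
      using that c3[of j] b c by (auto simp: Bad_def compositions_def)
    ultimately have mem: "flip c \<in> compositions N a" using c by (auto simp: Bad_def compositions_def)
    have bad': "bad (flip c) ?i" using b c1 by (auto simp: bad_def)
    have "first (flip c) = ?i"
      unfolding first_def[of "flip c"]
    proof (rule Least_equality[of "bad (flip c)", OF bad'])
      fix j assume j: "bad (flip c) j"
      show "?i \<le> j"
      proof (rule ccontr)
        assume "\<not> ?i \<le> j"
        then have "j < ?i" by simp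
        then have "bad c j" using j c3[of j] by (auto simp: bad_def)
        then show False using \<open>j < ?i\<close> not_less_Least[of j "bad c"] by (auto simp: first_def)
      qed
    qed
    then have "flip (flip c) = c"
      using c1 c2 c3 by (simp add: flip_def[of "flip c"] Let_def fun_eq_iff)
    with comp mem bad' show ?thesis by (auto simp: Bad_def)
  qed
  have "(\<Sum>c\<in>Bad. F (\<lambda>i. l i - int (c i))) = (\<Sum>c\<in>Bad. - F (\<lambda>i. l i - int (c i)))"
  proof (rule sum.reindex_bij_witness[where i = flip and j = flip])
    fix c assume c: "c \<in> Bad"
    have "Suc (first c) < N" using bad_first[OF c] by (auto simp: bad_def)
    then show "- F (\<lambda>i. l i - int (flip c i)) = F (\<lambda>i. l i - int (c i))"
      using flip[OF c] alt by (simp add: alternating_def)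
  qed (use flip in auto)
  then have bad0: "(\<Sum>c\<in>Bad. F (\<lambda>i. l i - int (c i))) = 0" by (simp add: sum_negf)
  define Good where "Good = {c \<in> compositions N a. \<forall>i<N. f (Suc i) + c i \<le> f i}"
  have "\<not> bad c i" if "c \<in> Good" for c i
  proof
    assume "bad c i"
    then have "i < N" "int (f i) < int (f (Suc i)) + int (c i)"
      by (auto simp: bad_def l_def beads_def)
    moreover have "f (Suc i) + c i \<le> f i" using that \<open>i < N\<close> by (simp add: Good_def)
    ultimately show False by linarith
  qed
  then have disj: "Good \<inter> Bad = {}" by (auto simp: Bad_def)
  \<comment> \<open>A composition in neither set overdraws the last row only, where the support condition applies.\<close>
  have zero: "F (\<lambda>i. l i - int (c i)) = 0" if c: "c \<in> compositions N a - (Good \<union> Bad)" for c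
  proof -
    obtain i where i: "i < N" "f i < f (Suc i) + c i" using c by (auto simp: Good_def)
    show ?thesis
    proof (cases "Suc i < N")
      case True
      then have "bad c i" using i by (auto simp: bad_def l_def beads_def)
      then show ?thesis using c by (auto simp: Bad_def)
    next
      case False
      then have "l i - int (c i) \<le> - int N" using i f0[of "Suc i"] by (auto simp: l_def beads_def)
      then show ?thesis using sup i(1) by (force simp: supported_def)
    qed
  qed
  have "h_op N a F l = (\<Sum>c\<in>Good \<union> Bad. F (\<lambda>i. l i - int (c i)))"
    unfolding h_op_def
    by (rule sum.mono_neutral_right) (use zero in \<open>auto simp: finite_compositions Good_def Bad_def\<close>)
  also have "\<dots> = (\<Sum>c\<in>Good. F (\<lambda>i. l i - int (c i)))"
    using bad0 disj by (subst sum.union_disjoint) (auto simp: finite_compositions Good_def Bad_def)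
  also have "\<dots> = (\<Sum>h\<in>horizontal_strips N a f. F (beads h))"
  proof (rule sum.reindex_bij_witness[where i = "\<lambda>h i. f i - h i" and j = "\<lambda>c i. f i - c i"])
    fix c assume c: "c \<in> Good"
    have le: "f (Suc i) + c i \<le> f i" for i
      using c f0[of i] f0[of "Suc i"] by (cases "i < N") (auto simp: Good_def compositions_def)
    have le': "c i \<le> f i" for i using add_leD2[OF le] .
    show "(\<lambda>i. f i - (f i - c i)) = c" using le' by simp
    have "f i - (f i - c i) = c i" "f (Suc i) \<le> f i - c i" for i
      using le[of i] by linarith+
    then show "(\<lambda>i. f i - c i) \<in> horizontal_strips N a f"
      using c by (simp add: horizontal_strips_def Good_def compositions_def)
    show "F (beads (\<lambda>i. f i - c i)) = F (\<lambda>i. l i - int (c i))"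
      by (rule arg_cong[of _ _ F]) (use le' in \<open>auto simp: l_def beads_def fun_eq_iff of_nat_diff\<close>)
  next
    fix h assume h: "h \<in> horizontal_strips N a f"
    then show "(\<lambda>i. f i - (f i - h i)) = h" by (auto simp: horizontal_strips_def)
    have "f (Suc i) + (f i - h i) \<le> f i" for i
    proof -
      have "h i \<le> f i" "f (Suc i) \<le> h i" using h by (auto simp: horizontal_strips_def)
      then show ?thesis by linarith
    qed
    with h f0 show "(\<lambda>i. f i - h i) \<in> Good"
      by (simp add: horizontal_strips_def Good_def compositions_def)
  qed
  finally show ?thesis by (simp add: l_def)
qed

section \<open>Border strips and bead moves\<close>

lemma boxes_diff_Sigma:
  "shape N f \<Longrightarrow> boxes f - boxes h = (SIGMA i:{..<N}. {h i..<f i})"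
  by (auto simp: boxes_def shape_def) (metis bot_nat_0.extremum_strict linorder_not_le)

lemma finite_boxes_diff: "shape N f \<Longrightarrow> finite (boxes f - boxes h)"
  by (simp add: boxes_diff_Sigma)

lemma card_boxes_diff: "shape N f \<Longrightarrow> card (boxes f - boxes h) = (\<Sum>i<N. f i - h i)"
  by (simp add: boxes_diff_Sigma)

lemma ex_partition_of_shape:
  assumes "shape N f" shows "\<exists>nu. is_partition nu \<and> diagram nu = boxes f"
proof -
  define M where "M = (LEAST i. f i = 0)"
  have anti: "f j \<le> f i" if "i \<le> j" for i j
    using assms that by (auto simp: shape_def antimono_def)
  have "f N = 0" using assms by (simp add: shape_def)
  then have M0: "f M = 0" unfolding M_def by (rule LeastI)
  have below: "f i \<noteq> 0" if "i < M" for i using that not_less_Least unfolding M_def by blast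
  have above: "i < M" if "j < f i" for i j using anti[of M i] M0 that by force
  have "is_partition (map f [0..<M])"
    using anti below by (auto simp: is_partition_def sorted_wrt_iff_nth_less image_iff)
  moreover have "diagram (map f [0..<M]) = boxes f"
    using above by (auto simp: diagram_def boxes_def)
  ultimately show ?thesis by blast
qed

lemma ex_skew_shape:
  assumes "shape N f" "shape N h" "\<And>i. h i \<le> f i"
  shows "\<exists>al be. is_skew_shape al be \<and> boxes f - boxes h = skew_diagram al be"
proof -
  have "boxes h \<subseteq> boxes f" using assms(3) by (auto simp: boxes_def intro: less_le_trans)
  moreover obtain al be where "is_partition al" "diagram al = boxes f"
      "is_partition be" "diagram be = boxes h"
    using ex_partition_of_shape[OF assms(1)] ex_partition_of_shape[OF assms(2)] by blast
  ultimately have "is_skew_shape al be" "boxes f - boxes h = skew_diagram al be"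
    by (auto simp: is_skew_shape_def skew_diagram_def)
  then show ?thesis by blast
qed

text \<open>The only steps between different rows are vertical.\<close>

lemma path_crosses_row:
  assumes "(a, b) \<in> (adjacent_in S)\<^sup>*" "fst a \<le> r" "r < fst b"
  shows "\<exists>j. (r, j) \<in> S \<and> (Suc r, j) \<in> S"
  using assms
proof (induction rule: rtrancl_induct)
  case (step y z)
  show ?case
  proof (cases "r < fst y")
    case False
    then have "fst y = r \<and> fst z = Suc r \<and> snd y = snd z \<and> y \<in> S \<and> z \<in> S"
      using step by (auto simp: adjacent_in_def)
    then show ?thesis by (metis prod.collapse)
  qed (use step in auto)
qed auto

text \<open>The number of boxes of a border strip in rows \<open>i\<close> to \<open>k\<close> is the distance that the bead travels.\<close>

lemma strip_telescope:
  fixes f h :: "nat \<Rightarrow> nat"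
  assumes "i \<le> k" "k < N" "\<And>r. h r \<le> f r" "\<And>r. i \<le> r \<Longrightarrow> r < k \<Longrightarrow> h r + 1 = f (Suc r)"
    and "\<And>r. r < i \<or> k < r \<Longrightarrow> h r = f r"
  shows "int (\<Sum>r<N. f r - h r) = int (f i) - int i - (int (h k) - int k)"
proof -
  have aux: "(\<Sum>r=i..<k. int (f r) - int (h r)) = int (f i) - int i - (int (f k) - int k)"
    using assms(1,4)
  proof (induction k rule: dec_induct)
    case (step k)
    then have "h k + 1 = f (Suc k)" by simp
    then have "int (h k) + 1 = int (f (Suc k))" by linarith
    then show ?case using step by simp
  qed simp
  have "int (\<Sum>r<N. f r - h r) = (\<Sum>r<N. int (f r) - int (h r))"
    using assms(3) by (simp add: of_nat_diff)
  also have "\<dots> = (\<Sum>r=i..k. int (f r) - int (h r))"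
    by (rule sum.mono_neutral_right) (use assms in auto)
  also have "\<dots> = (\<Sum>r=i..<k. int (f r) - int (h r)) + (int (f k) - int (h k))"
    using assms(1) by (simp flip: atLeastLessThanSuc_atLeastAtMost)
  finally show ?thesis using aux by simp
qed

text \<open>Connectedness forces consecutive rows of the strip to overlap, and the absence of \<open>2 \<times> 2\<close> squares
  makes the overlap a single column; so each row of \<open>h\<close> inside the strip is the next row of \<open>f\<close>
  minus one box. In terms of beads, the bead of the top row jumps over those of the lower rows.\<close>

lemma move_of_strip:
  assumes f: "shape N f" and h: "shape N h" and le: "\<And>i. h i \<le> f i"
    and bs: "border_strip (boxes f - boxes h)" and m: "card (boxes f - boxes h) = m"
  shows "\<exists>i k. i \<le> k \<and> k < N \<and>
    beads h = cycle_entry i k ((beads f)(i := beads f i - int m))"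
proof -
  let ?S = "boxes f - boxes h"
  define R where "R = {r. h r < f r}"
  have R: "R \<subseteq> {..<N}"
  proof
    fix r assume "r \<in> R"
    then have "f r \<noteq> 0" by (simp add: R_def)
    then show "r \<in> {..<N}" using f by (auto simp: shape_def not_less[symmetric])
  qed
  then have fin: "finite R" using finite_subset by blast
  obtain b where b: "b \<in> ?S" using bs by (auto simp: border_strip_def)
  have ne: "R \<noteq> {}" using b by (auto simp: R_def boxes_def not_less intro: less_le_trans)
  define i k where "i = Min R" and "k = Max R"
  have i: "i \<in> R" and k: "k \<in> R" using Min_in[OF fin ne] Max_in[OF fin ne] by (auto simp: i_def k_def)
  have ik: "i \<le> k" using fin k by (simp add: i_def)
  have kN: "k < N" using R k by auto
  have out: "h r = f r" if "r < i \<or> k < r" for r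
  proof -
    have "r \<notin> R"
    proof
      assume "r \<in> R"
      then have "i \<le> r" "r \<le> k" using fin by (auto simp: i_def k_def)
      then show False using that by simp
    qed
    then show ?thesis using le[of r] by (simp add: R_def)
  qed
  have mid: "h r + 1 = f (Suc r)" if r: "i \<le> r" "r < k" for r
  proof -
    have mono: "f (Suc r) \<le> f r" "h (Suc r) \<le> h r"
      using f h by (auto simp: shape_def antimono_def)
    have "(i, h i) \<in> ?S" "(k, h k) \<in> ?S" using i k by (auto simp: R_def boxes_def)
    then have "((i, h i), (k, h k)) \<in> (adjacent_in ?S)\<^sup>*"
      using bs by (auto simp: border_strip_def connected_boxes_def)
    then obtain j where "(r, j) \<in> ?S" "(Suc r, j) \<in> ?S"
      using path_crosses_row[of "(i, h i)" "(k, h k)" ?S r] r by auto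
    then have lt: "h r < f (Suc r)" by (auto simp: boxes_def)
    have "\<not> h r + 1 < f (Suc r)"
    proof
      assume "h r + 1 < f (Suc r)"
      then have "{(r, h r), (r, h r + 1), (r + 1, h r), (r + 1, h r + 1)} \<subseteq> ?S"
        using mono by (auto simp: boxes_def)
      then show False using bs unfolding border_strip_def by blast
    qed
    then show ?thesis using lt by simp
  qed
  have eq: "int (\<Sum>r<N. f r - h r) = beads f i - beads h k"
    unfolding beads_def by (rule strip_telescope) (use ik kN le mid out in auto)
  have "int m = beads f i - beads h k"
    unfolding m[symmetric] card_boxes_diff[OF f] eq ..
  then have bk: "beads h k = beads f i - int m" by simp
  have bmid: "beads h r = beads f (Suc r)" if "i \<le> r" "r < k" for r
  proof -
    have "int (h r) + 1 = int (f (Suc r))" using mid[OF that] by linarith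
    then show ?thesis by (simp add: beads_def)
  qed
  have bout: "beads h r = beads f r" if "r < i \<or> k < r" for r
    using out[OF that] by (simp add: beads_def)
  have "beads h r = cycle_entry i k ((beads f)(i := beads f i - int m)) r" for r
    using bk bmid[of r] bout[of r] ik by (auto simp: cycle_entry_def)
  then have "beads h = cycle_entry i k ((beads f)(i := beads f i - int m))" ..
  then show ?thesis using ik kN by blast
qed

lemma strip_of_move:
  assumes f: "shape N f" and h: "shape N h" and m: "m > 0" and ik: "i \<le> k" and kN: "k < N"
    and move: "beads h = cycle_entry i k ((beads f)(i := beads f i - int m))"
  shows "h r \<le> f r" "border_strip (boxes f - boxes h)" "card (boxes f - boxes h) = m"
    "strip_height (boxes f - boxes h) = k - i" "(LEAST r. h r < f r) = i"
proof -
  let ?S = "boxes f - boxes h"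
  have out: "h r = f r" if "r < i \<or> k < r" for r
    using fun_cong[OF move, of r] that ik by (auto simp: cycle_entry_def beads_def)
  have mid: "h r + 1 = f (Suc r)" if r: "i \<le> r" "r < k" for r
    using fun_cong[OF move, of r] that ik by (auto simp: cycle_entry_def beads_def)
  have hk: "int (h k) - int k = int (f i) - int i - int m"
    using fun_cong[OF move, of k] ik by (auto simp: cycle_entry_def beads_def)
  have mono: "f (Suc r) \<le> f r" "h (Suc r) \<le> h r" for r
    using f h by (auto simp: shape_def antimono_def)
  have lt: "h r < f r" if "i \<le> r" "r \<le> k" for r
  proof (cases "r = k")
    case True
    show ?thesis
    proof (cases "i = k")
      case False
      then have "h (k - 1) + 1 = f k" using mid[of "k - 1"] ik by auto
      then show ?thesis using mono(2)[of "k - 1"] False ik True by simp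
    qed (use hk m True in auto)
  next
    case False
    then show ?thesis using mid[of r] mono(1)[of r] that by auto
  qed
  have le: "h r \<le> f r" for r
    using lt[of r] out[of r] by (cases "i \<le> r \<and> r \<le> k") auto
  then show "h r \<le> f r" .
  have eq: "int (\<Sum>r<N. f r - h r) = int (f i) - int i - (int (h k) - int k)"
    by (rule strip_telescope) (use ik kN le mid out in auto)
  have "int (card ?S) = int m"
    unfolding card_boxes_diff[OF f] eq using hk by simp
  then show card: "card ?S = m" by simp
  have rows: "r \<in> {i..k}" if "(r, j) \<in> ?S" for r j
    using that out[of r] by (cases "r < i \<or> k < r") (auto simp: boxes_def)
  have rowS: "(r, h r) \<in> ?S" if "i \<le> r" "r \<le> k" for r
    using lt[OF that] by (auto simp: boxes_def)
  have "fst ` ?S = {i..k}"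
  proof
    show "fst ` ?S \<subseteq> {i..k}" using rows by force
    show "{i..k} \<subseteq> fst ` ?S" using rowS by force
  qed
  then show "strip_height ?S = k - i" by (simp add: strip_height_def)
  show "(LEAST r. h r < f r) = i"
  proof (rule Least_equality)
    show "h i < f i" using lt ik by simp
    show "i \<le> r" if "h r < f r" for r using that out[of r] by (metis less_irrefl not_le)
  qed
  have to_left: "((r, j), (r, h r)) \<in> (adjacent_in ?S)\<^sup>*" if "(r, j) \<in> ?S" for r j
    using that
  proof (induction j)
    case (Suc j)
    show ?case
    proof (cases "Suc j = h r")
      case False
      then have "(r, j) \<in> ?S" using Suc.prems by (auto simp: boxes_def)
      moreover from this have "((r, Suc j), (r, j)) \<in> adjacent_in ?S"
        using Suc.prems by (auto simp: adjacent_in_def)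
      ultimately show ?thesis using Suc.IH by (meson converse_rtrancl_into_rtrancl)
    qed auto
  qed (auto simp: boxes_def)
  have to_end: "((r, j), (k, h k)) \<in> (adjacent_in ?S)\<^sup>*" if "(r, j) \<in> ?S" for r j
    using that
  proof (induction "k - r" arbitrary: r j)
    case 0
    then have "r = k" using rows by fastforce
    then show ?case using to_left 0 by auto
  next
    case (Suc n)
    have r: "i \<le> r" "r < k" using rows[OF Suc.prems] Suc.hyps(2) by auto
    have "(Suc r, h r) \<in> ?S" "(r, h r) \<in> ?S"
      using mid[OF r] mono(2)[of r] rowS r by (auto simp: boxes_def)
    moreover from this have "((r, h r), (Suc r, h r)) \<in> adjacent_in ?S"
      by (auto simp: adjacent_in_def)
    moreover have "((Suc r, h r), (k, h k)) \<in> (adjacent_in ?S)\<^sup>*"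
      using Suc.hyps calculation(1) by (metis diff_Suc_1' Suc_diff_Suc r(2))
    ultimately show ?case
      using to_left[OF Suc.prems] by (meson converse_rtrancl_into_rtrancl rtrancl_trans)
  qed
  have "sym (adjacent_in ?S)" unfolding adjacent_in_def sym_def by auto
  then have "sym ((adjacent_in ?S)\<^sup>*)" by (rule sym_rtrancl)
  then have "connected_boxes ?S"
    unfolding connected_boxes_def by (metis to_end rtrancl_trans surj_pair symD)
  moreover have "\<not> {(r, j), (r, j + 1), (r + 1, j), (r + 1, j + 1)} \<subseteq> ?S" for r j
  proof
    assume a: "{(r, j), (r, j + 1), (r + 1, j), (r + 1, j + 1)} \<subseteq> ?S"
    then have "i \<le> r" "r < k" using rows[of r j] rows[of "r + 1" j] by auto
    then show False using a mid[of r] by (auto simp: boxes_def)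
  qed
  ultimately show "border_strip ?S"
    unfolding border_strip_def using ex_skew_shape[OF f h le] rowS ik by blast
qed

definition border_strip_removals :: "nat \<Rightarrow> nat \<Rightarrow> (nat \<Rightarrow> nat) \<Rightarrow> (nat \<Rightarrow> nat) set" where
  "border_strip_removals N m f = {h. shape N h \<and> (\<forall>i. h i \<le> f i) \<and>
     border_strip (boxes f - boxes h) \<and> card (boxes f - boxes h) = m}"

text \<open>Lowering the \<open>i\<close>-th bead by \<open>m\<close> gives one of three things: two equal beads or a bead below the
  admissible range, where the value is zero, or a vector that can be sorted by moving that bead past
  \<open>r\<close> others. The last case is the removal of a border strip of height \<open>r\<close>, and sorting costs
  the sign \<open>(-1)\<^sup>r\<close>.\<close>

theorem Murnaghan_Nakayama_step:
  assumes alt: "alternating N F" and sup: "supported N F" and f: "shape N f" and m: "m > 0"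
  shows "p_op N m F (beads f) = (\<Sum>h\<in>border_strip_removals N m f.
    (-1) ^ strip_height (boxes f - boxes h) * F (beads h))"
proof -
  define l where "l = beads f"
  define x where "x i = l i - int m" for i
  define Inside where "Inside = {i. i < N \<and> x i > - int N \<and> x i \<notin> l ` {..<N}}"
  \<comment> \<open>The position at which the lowered bead has to be inserted.\<close>
  define last where "last i = Max {k. k < N \<and> x i < l k}" for i
  define c where "c i = cycle_entry i (last i) (l(i := x i))" for i
  define shp where "shp i r = nat (c i r + int r)" for i r
  have dec: "l j < l i" if "i < j" for i j using beads_strict[OF f that] by (simp add: l_def)
  have beyond: "l r = - int r" if "r \<ge> N" for r using f that by (simp add: l_def beads_def shape_def)
  have inside: "i \<le> last i" "last i < N" "shape N (shp i)" "beads (shp i) = c i"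
    if i: "i \<in> Inside" for i
  proof -
    let ?K = "{k. k < N \<and> x i < l k}"
    have le_last: "r \<le> last i" if "r \<in> ?K" for r using that by (simp add: last_def)
    have iK: "i \<in> ?K" using i m by (auto simp: Inside_def x_def)
    have fin: "finite ?K" by simp
    show ik: "i \<le> last i" by (rule le_last[OF iK])
    have "last i \<in> ?K" unfolding last_def using Max_in[OF fin] iK by blast
    then have kN: "last i < N" and xk: "x i < l (last i)" by auto
    show "last i < N" by (rule kN)
    have above: "l r < x i" if "last i < r" for r
    proof (cases "r < N")
      case True
      have "r \<notin> ?K" using le_last[of r] that by linarith
      moreover have "l r \<noteq> x i" using i True by (metis (mono_tags, lifting) Inside_def imageI lessThan_iff mem_Collect_eq)
      ultimately show ?thesis using True by auto
    next
      case False
      then show ?thesis using beyond[of r] i by (auto simp: Inside_def)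
    qed
    have step: "c i (Suc r) < c i r" for r
    proof -
      consider "Suc r < i" | "Suc r = i" | "i \<le> r" "Suc r < last i" | "i \<le> r" "Suc r = last i"
        | "r = last i" | "last i < r" using ik by linarith
      then show ?thesis
      proof cases
        case 2
        then show ?thesis using ik dec[of r i] dec[of r "Suc i"] m
          by (auto simp: c_def cycle_entry_def x_def)
      next
        case 4
        then show ?thesis using xk by (auto simp: c_def cycle_entry_def)
      next
        case 5
        then show ?thesis using above[of "Suc r"] ik by (auto simp: c_def cycle_entry_def)
      qed (use ik dec in \<open>auto simp: c_def cycle_entry_def\<close>)
    qed
    have cN: "c i r = - int r" if "r \<ge> N" for r
      using that kN ik beyond[of r] by (auto simp: c_def cycle_entry_def)
    have anti: "c i s + int s \<le> c i r + int r" if "r \<le> s" for r s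
    proof (rule lift_Suc_antimono_le[of "\<lambda>r. c i r + int r", OF _ that])
      show "c i (Suc r) + int (Suc r) \<le> c i r + int r" for r using step[of r] by simp
    qed
    have nonneg: "0 \<le> c i r + int r" for r
      using anti[of r "max r N"] cN[of "max r N"] by simp
    show "shape N (shp i)"
      using anti cN by (auto simp: shape_def antimono_def shp_def intro: nat_mono)
    show "beads (shp i) = c i" using nonneg by (auto simp: beads_def shp_def fun_eq_iff)
  qed
  have outside: "F (l(i := x i)) = 0" if i: "i < N" "i \<notin> Inside" for i
  proof (cases "x i > - int N")
    case False
    then show ?thesis using sup i(1) unfolding supported_def by (metis fun_upd_same)
  next
    case True
    then obtain j where j: "j < N" "x i = l j" using i by (auto simp: Inside_def)
    have "i \<noteq> j" using j m by (auto simp: x_def)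
    moreover have "\<not> j < i" using dec[of j i] j m by (auto simp: x_def)
    ultimately show ?thesis
      using alternating_repeated[OF alt, of i j "l(i := x i)"] j by auto
  qed
  have shp_removal: "shp i \<in> border_strip_removals N m f"
      "strip_height (boxes f - boxes (shp i)) = last i - i" "(LEAST r. shp i r < f r) = i"
    if i: "i \<in> Inside" for i
    using strip_of_move[OF f inside(3)[OF i] m inside(1,2)[OF i]] inside(3,4)[OF i]
    by (auto simp: border_strip_removals_def c_def x_def l_def)
  have "p_op N m F l = (\<Sum>i\<in>Inside. F (l(i := x i)))"
    unfolding p_op_def x_def[symmetric]
    by (rule sum.mono_neutral_right) (use outside in \<open>auto simp: Inside_def\<close>)
  also have "\<dots> = (\<Sum>h\<in>border_strip_removals N m f.
      (-1) ^ strip_height (boxes f - boxes h) * F (beads h))"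
  proof (rule sum.reindex_bij_witness[where i = "\<lambda>h. LEAST r. h r < f r" and j = shp])
    fix i assume i: "i \<in> Inside"
    show "(LEAST r. shp i r < f r) = i" "shp i \<in> border_strip_removals N m f"
      using shp_removal[OF i] by auto
    have "F (c i) = (-1) ^ (last i - i) * F (l(i := x i))"
      unfolding c_def using alternating_cycle[OF alt inside(1,2)[OF i]] .
    then show "(-1) ^ strip_height (boxes f - boxes (shp i)) * F (beads (shp i)) = F (l(i := x i))"
      using inside(4)[OF i] shp_removal(2)[OF i] by (simp flip: power_add mult.assoc mult_2)
  next
    fix h assume h: "h \<in> border_strip_removals N m f"
    then have h': "shape N h" "\<And>r. h r \<le> f r" "border_strip (boxes f - boxes h)"
      "card (boxes f - boxes h) = m" by (auto simp: border_strip_removals_def)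
    then obtain i k where ik: "i \<le> k" "k < N" and move: "beads h = cycle_entry i k (l(i := x i))"
      using move_of_strip[OF f h'(1), of m] by (auto simp: l_def x_def)
    have least: "(LEAST r. h r < f r) = i"
      using strip_of_move(5)[OF f h'(1) m ik] move by (auto simp: l_def x_def)
    have bk: "beads h k = x i" using move ik by (simp add: cycle_entry_def)
    have above: "l j < x i" if "k < j" for j
      using beads_strict[OF h'(1) that] fun_cong[OF move, of j] that ik bk by (simp add: cycle_entry_def)
    have below: "x i < l j" if "j \<le> k" for j
    proof (cases "j \<le> i")
      case True
      then show ?thesis using dec[of j i] m by (cases "j = i") (auto simp: x_def)
    next
      case False
      then have "beads h (j - 1) = l j" "j - 1 < k"
        using fun_cong[OF move, of "j - 1"] that by (auto simp: cycle_entry_def)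
      then show ?thesis using beads_strict[OF h'(1), of "j - 1" k] bk by simp
    qed
    have "x i \<noteq> l j" for j using above[of j] below[of j] by (cases "j \<le> k") auto
    moreover have "x i > - int N" using bk ik by (auto simp: beads_def)
    ultimately have i: "i \<in> Inside" using ik by (auto simp: Inside_def)
    have "last i = k"
      unfolding last_def by (rule Max_eqI) (use above below ik in \<open>auto simp: not_less[symmetric] dest: less_asym\<close>)
    then have "beads (shp i) = beads h" using inside(4)[OF i] move by (simp add: c_def)
    then have "shp i = h" by (auto simp: beads_def fun_eq_iff)
    with least i show "shp (LEAST r. h r < f r) = h" "(LEAST r. h r < f r) \<in> Inside" by auto
  qed
  finally show ?thesis by (simp add: l_def)
qed

section \<open>Cutting a tableau at a label\<close>

lemma boxes_subset_iff: "boxes h \<subseteq> boxes f \<longleftrightarrow> h \<le> f"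
proof
  assume sub: "boxes h \<subseteq> boxes f"
  have "h i \<le> f i" for i
  proof (rule ccontr)
    assume "\<not> h i \<le> f i"
    then have "(i, f i) \<in> boxes h" by (simp add: boxes_def)
    then show False using sub by (auto simp: boxes_def)
  qed
  then show "h \<le> f" by (simp add: le_fun_def)
qed (auto simp: boxes_def le_fun_def intro: less_le_trans)

lemma boxes_inject: "boxes h = boxes f \<longleftrightarrow> h = f"
  by (metis boxes_subset_iff order_antisym order_refl)

lemma boxes_down_closed:
  "shape N f \<Longrightarrow> (i, j) \<in> boxes f \<Longrightarrow> i' \<le> i \<Longrightarrow> j' \<le> j \<Longrightarrow> (i', j') \<in> boxes f"
  using antimonoD[of f i' i] by (auto simp: boxes_def shape_def)

lemma ex_shape_of_down_closed:
  assumes f: "shape N f" and S: "S \<subseteq> boxes f"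
    and down: "\<And>i j i' j'. (i, j) \<in> S \<Longrightarrow> i' \<le> i \<Longrightarrow> j' \<le> j \<Longrightarrow> (i', j') \<in> S"
  shows "\<exists>h. shape N h \<and> boxes h = S"
proof -
  define h where "h i = (LEAST j. (i, j) \<notin> S)" for i
  have "(i, f i) \<notin> S" for i using S by (auto simp: boxes_def)
  then have hS: "(i, h i) \<notin> S" for i unfolding h_def by (rule LeastI)
  have iff: "(i, j) \<in> S \<longleftrightarrow> j < h i" for i j
  proof
    assume "(i, j) \<in> S"
    then show "j < h i" using down[of i j i "h i"] hS[of i] by (auto simp: not_less[symmetric])
  qed (use not_less_Least in \<open>auto simp: h_def\<close>)
  have "h i' \<le> h i" if "i \<le> i'" for i i'
  proof (rule ccontr)
    assume "\<not> h i' \<le> h i"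
    then have "(i', h i) \<in> S" by (simp add: iff)
    then show False using down[of i' "h i" i "h i"] hS that by auto
  qed
  moreover have "h i = 0" if "i \<ge> N" for i
  proof -
    have "f i = 0" using f that by (simp add: shape_def)
    then have "(i, 0) \<notin> S" using S by (auto simp: boxes_def)
    then show ?thesis using iff by blast
  qed
  ultimately have "shape N h" by (auto simp: shape_def antimono_def)
  moreover have "boxes h = S" using iff by (auto simp: boxes_def)
  ultimately show ?thesis by blast
qed

text \<open>The boxes of the inner shape together with those of label less than \<open>x\<close> are closed under going
  left and up, so they form a shape.\<close>

lemma ex_shape_below:
  assumes f: "shape N f" and g: "shape N g" and gf: "g \<le> f"
    and rows: "rows_weakly_increasing (boxes f - boxes g) T"
    and cols: "columns_weakly_increasing (boxes f - boxes g) T"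
  shows "\<exists>h. shape N h \<and> g \<le> h \<and> h \<le> f \<and> (\<forall>b\<in>boxes f - boxes g. b \<in> boxes h \<longleftrightarrow> T b < x)"
proof -
  let ?D = "boxes f - boxes g"
  let ?S = "boxes g \<union> {b \<in> ?D. T b < x}"
  have "(i', j') \<in> ?S" if ij: "(i, j) \<in> ?S" and le: "i' \<le> i" "j' \<le> j" for i j i' j'
  proof (cases "(i', j') \<in> boxes g")
    case False
    then have ng: "(i, j) \<notin> boxes g" "(i', j) \<notin> boxes g"
      using boxes_down_closed[OF g] le by blast+
    then have T: "(i, j) \<in> ?D" "T (i, j) < x" using ij by auto
    then have D: "(i', j') \<in> ?D" "(i', j) \<in> ?D"
      using boxes_down_closed[OF f] le False ng by blast+
    have "T (i', j') \<le> T (i', j)"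
      using rows D le by (cases "j' = j") (auto simp: rows_weakly_increasing_def)
    moreover have "T (i', j) \<le> T (i, j)"
      using cols D(2) T(1) le unfolding columns_weakly_increasing_def
      by (metis le_neq_implies_less order_refl)
    ultimately show ?thesis using D T by auto
  qed auto
  moreover have "?S \<subseteq> boxes f" using boxes_subset_iff gf by blast
  ultimately obtain h where h: "shape N h" "boxes h = ?S"
    using ex_shape_of_down_closed[OF f, of ?S] by blast
  have "g \<le> h" "h \<le> f" using h(2) gf by (auto simp flip: boxes_subset_iff)
  with h show ?thesis by auto
qed

lemma finite_shapes_below:
  assumes "shape N f" shows "finite {h. shape N h \<and> h \<le> f}"
proof (rule finite_bounded_vectors)
  fix h i assume "h \<in> {h. shape N h \<and> h \<le> f}"
  then have h: "shape N h" "h i \<le> f i" by (auto simp: le_fun_def)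
  have "f i \<le> f 0" using assms by (auto simp: shape_def antimono_def)
  with h(2) show "h i \<le> f 0" by simp
  show "h i = 0" if "i \<ge> N" using h(1) that by (simp add: shape_def)
qed

text \<open>The tableau that is \<open>T\<close> on the inner part and \<open>u\<close> on the outer strip.\<close>

definition glue where
  "glue f h T u b = (if b \<in> boxes h then T b else if b \<in> boxes f then u b else undefined)"

lemma glue_extensional:
  assumes "T \<in> extensional (boxes h - boxes g)" "g \<le> h" "h \<le> f"
  shows "glue f h T u \<in> extensional (boxes f - boxes g)"
proof -
  have "boxes g \<subseteq> boxes h" "boxes h \<subseteq> boxes f" using assms by (simp_all add: boxes_subset_iff)
  then show ?thesis using assms(1) unfolding extensional_def glue_def by auto
qed

lemma boxes_with_top_label:
  assumes "g \<le> h" "h \<le> f" "\<And>b. b \<in> boxes f - boxes g \<Longrightarrow> b \<in> boxes h \<longleftrightarrow> T b < x"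
    and "\<And>b. b \<in> boxes f - boxes g \<Longrightarrow> T b \<le> x"
  shows "boxes f - boxes h = {b \<in> boxes f - boxes g. T b = (x::nat)}"
proof (rule set_eqI)
  fix b
  have "boxes g \<subseteq> boxes h" "boxes h \<subseteq> boxes f" using assms by (simp_all add: boxes_subset_iff)
  then show "b \<in> boxes f - boxes h \<longleftrightarrow> b \<in> {b \<in> boxes f - boxes g. T b = x}"
    using assms(3,4)[of b] by (cases "b \<in> boxes f - boxes g") auto
qed

text \<open>The common pattern of the three recursions below. The boxes with label less than \<open>x\<close> fill a shape
  \<open>h\<close>, and what lies outside \<open>h\<close> carries a filling \<open>u h\<close> that is determined by \<open>h\<close>. So summing
  over tableaux means summing over \<open>h\<close> and the tableaux on \<open>h\<close>.\<close>

lemma sum_over_tableaux: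
  assumes f: "shape N f" and g: "shape N g" and gf: "g \<le> f"
    and A: "\<And>T. T \<in> A \<Longrightarrow> T \<in> extensional (boxes f - boxes g) \<and>
      rows_weakly_increasing (boxes f - boxes g) T \<and> columns_weakly_increasing (boxes f - boxes g) T"
    and X: "\<And>h. h \<in> X \<Longrightarrow> shape N h \<and> g \<le> h \<and> h \<le> f"
    and B: "\<And>h. h \<in> X \<Longrightarrow> finite (B h) \<and> B h \<subseteq> extensional (boxes h - boxes g)"
    and cut: "\<And>T h. T \<in> A \<Longrightarrow> shape N h \<Longrightarrow> g \<le> h \<Longrightarrow> h \<le> f \<Longrightarrow>
      (\<And>b. b \<in> boxes f - boxes g \<Longrightarrow> b \<in> boxes h \<longleftrightarrow> T b < x) \<Longrightarrow>
      h \<in> X \<and> restrict T (boxes h - boxes g) \<in> B h \<and> (\<forall>b\<in>boxes f - boxes h. T b = u h b)"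
    and paste: "\<And>T h. h \<in> X \<Longrightarrow> T \<in> B h \<Longrightarrow> glue f h T (u h) \<in> A \<and>
      (\<forall>b\<in>boxes h - boxes g. T b < x) \<and> (\<forall>b\<in>boxes f - boxes h. x \<le> u h b)"
  shows "(\<Sum>T\<in>A. w T) = (\<Sum>h\<in>X. \<Sum>T\<in>B h. w (glue f h T (u h)))"
proof -
  have "\<forall>T\<in>A. \<exists>h. shape N h \<and> g \<le> h \<and> h \<le> f \<and> (\<forall>b\<in>boxes f - boxes g. b \<in> boxes h \<longleftrightarrow> T b < x)"
    using ex_shape_below[OF f g gf] A by blast
  then obtain c where c: "\<And>T. T \<in> A \<Longrightarrow> shape N (c T) \<and> g \<le> c T \<and> c T \<le> f \<and>
      (\<forall>b\<in>boxes f - boxes g. b \<in> boxes (c T) \<longleftrightarrow> T b < x)"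
    by metis
  have finX: "finite X"
    by (rule finite_subset[OF _ finite_shapes_below[OF f]]) (use X in auto)
  have "(\<Sum>T\<in>A. w T) = (\<Sum>(h, T)\<in>Sigma X B. w (glue f h T (u h)))"
  proof (rule sum.reindex_bij_witness[where
        i = "\<lambda>(h, T). glue f h T (u h)" and j = "\<lambda>T. (c T, restrict T (boxes (c T) - boxes g))"])
    fix T assume T: "T \<in> A"
    have cT: "c T \<in> X" "restrict T (boxes (c T) - boxes g) \<in> B (c T)"
      "\<forall>b\<in>boxes f - boxes (c T). T b = u (c T) b"
      using cut[OF T, of "c T"] c[OF T] by auto
    then show "(c T, restrict T (boxes (c T) - boxes g)) \<in> Sigma X B" by simp
    have sub: "boxes g \<subseteq> boxes (c T)" "boxes (c T) \<subseteq> boxes f"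
      using c[OF T] by (simp_all add: boxes_subset_iff)
    have ext: "T b = undefined" if "b \<notin> boxes f - boxes g" for b
      using A[OF T] that extensional_arb[of T "boxes f - boxes g" b] by blast
    have "glue f (c T) (restrict T (boxes (c T) - boxes g)) (u (c T)) = T"
      using cT(3) ext sub by (auto simp: glue_def fun_eq_iff)
    then show "(case (c T, restrict T (boxes (c T) - boxes g)) of (h, T) \<Rightarrow> glue f h T (u h)) = T"
      "(case (c T, restrict T (boxes (c T) - boxes g)) of (h, T) \<Rightarrow> w (glue f h T (u h))) = w T"
      by auto
  next
    fix p assume p: "p \<in> Sigma X B"
    obtain h T where [simp]: "p = (h, T)" by force
    have h: "h \<in> X" "T \<in> B h" using p by auto
    let ?G = "glue f h T (u h)"
    have G: "?G \<in> A" "\<And>b. b \<in> boxes h - boxes g \<Longrightarrow> T b < x"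
      "\<And>b. b \<in> boxes f - boxes h \<Longrightarrow> x \<le> u h b" using paste[OF h] by auto
    then show "(case p of (h, T) \<Rightarrow> glue f h T (u h)) \<in> A" by simp
    have sub: "boxes g \<subseteq> boxes h" "boxes h \<subseteq> boxes f" using X[OF h(1)] by (simp_all add: boxes_subset_iff)
    have sub': "boxes g \<subseteq> boxes (c ?G)" "boxes (c ?G) \<subseteq> boxes f"
      using c[OF G(1)] by (simp_all add: boxes_subset_iff)
    have iff: "b \<in> boxes (c ?G) \<longleftrightarrow> ?G b < x" if "b \<in> boxes f - boxes g" for b
      using c[OF G(1)] that by auto
    have "b \<in> boxes (c ?G) \<longleftrightarrow> b \<in> boxes h" for b
    proof (cases "b \<in> boxes f - boxes g")
      case True
      then show ?thesis using iff[OF True] G(2)[of b] G(3)[of b] by (auto simp: glue_def)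
    qed (use sub sub' in auto)
    then have ch: "c ?G = h" by (auto simp flip: boxes_inject)
    have "restrict ?G (boxes h - boxes g) = T"
      using B[OF h(1)] h(2) by (auto simp: glue_def fun_eq_iff restrict_def extensional_def)
    with ch show "(\<lambda>T. (c T, restrict T (boxes (c T) - boxes g))) (case p of (h, T) \<Rightarrow> glue f h T (u h)) = p"
      by simp
  qed
  also have "\<dots> = (\<Sum>h\<in>X. \<Sum>T\<in>B h. w (glue f h T (u h)))"
    by (rule sum.Sigma[symmetric]) (use finX B in auto)
  finally show ?thesis .
qed

text \<open>Since \<open>h\<close> is a shape, a box outside \<open>h\<close> is never followed by one inside. So monotonicity of a glued
  tableau has to be checked only on the inner part and on the outer strip.\<close>

lemma glue_cases:
  assumes h: "shape N h" "g \<le> h" "h \<le> f" and T: "\<forall>b\<in>boxes h - boxes g. T b < x"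
    and u: "\<forall>b\<in>boxes f - boxes h. x \<le> u b"
    and b: "(i, j) \<in> boxes f - boxes g" "(i', j') \<in> boxes f - boxes g" "i \<le> i'" "j \<le> j'"
  shows "((i, j) \<in> boxes h - boxes g \<and> (i', j') \<in> boxes h - boxes g \<and>
      glue f h T u (i, j) = T (i, j) \<and> glue f h T u (i', j') = T (i', j')) \<or>
    ((i, j) \<in> boxes f - boxes h \<and> (i', j') \<in> boxes f - boxes h \<and>
      glue f h T u (i, j) = u (i, j) \<and> glue f h T u (i', j') = u (i', j')) \<or>
    glue f h T u (i, j) < (glue f h T u (i', j') :: nat)"
proof -
  consider "(i, j) \<in> boxes h" "(i', j') \<in> boxes h" | "(i, j) \<notin> boxes h" "(i', j') \<notin> boxes h"
    | "(i, j) \<in> boxes h" "(i', j') \<notin> boxes h"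
    using boxes_down_closed[OF h(1) _ b(3,4)] by blast
  then show ?thesis
  proof cases
    case 3
    then have "T (i, j) < x" "x \<le> u (i', j')" using T u b by auto
    then show ?thesis using 3 b by (auto simp: glue_def)
  qed (use b in \<open>auto simp: glue_def\<close>)
qed

section \<open>Border-strip tableaux\<close>

definition border_strip_tableaux ::
    "(nat \<Rightarrow> nat) \<Rightarrow> (nat \<Rightarrow> nat) \<Rightarrow> nat \<Rightarrow> nat \<Rightarrow> (nat \<times> nat \<Rightarrow> nat) set" where
  "border_strip_tableaux f g m d = {B \<in> extensional (boxes f - boxes g).
     B ` (boxes f - boxes g) = {1..d} \<and>
     (\<forall>j\<in>{1..d}. border_strip {b \<in> boxes f - boxes g. B b = j} \<and>
        card {b \<in> boxes f - boxes g. B b = j} = m) \<and>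
     rows_weakly_increasing (boxes f - boxes g) B \<and>
     columns_weakly_increasing (boxes f - boxes g) B}"

definition tableau_height :: "(nat \<Rightarrow> nat) \<Rightarrow> (nat \<Rightarrow> nat) \<Rightarrow> (nat \<times> nat \<Rightarrow> nat) \<Rightarrow> nat" where
  "tableau_height f g B = (\<Sum>j\<in>B ` (boxes f - boxes g). strip_height {b \<in> boxes f - boxes g. B b = j})"

lemma finite_fillings:
  assumes "finite D" "finite V" shows "finite {T \<in> extensional D. T ` D \<subseteq> V}"
proof -
  have "{T \<in> extensional D. T ` D \<subseteq> V} = (\<Pi>\<^sub>E b\<in>D. V)" by (auto simp: PiE_def Pi_def)
  then show ?thesis using assms by (simp add: finite_PiE)
qed

lemma finite_border_strip_tableaux: "shape N f \<Longrightarrow> finite (border_strip_tableaux f g m d)"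
  by (rule finite_subset[OF _ finite_fillings[of "boxes f - boxes g" "{1..d}"]])
    (auto simp: border_strip_tableaux_def finite_boxes_diff)

lemma rows_weakly_subset:
  "rows_weakly_increasing D T \<Longrightarrow> E \<subseteq> D \<Longrightarrow> rows_weakly_increasing E (restrict T E)"
  by (auto simp: rows_weakly_increasing_def subset_eq)

lemma columns_weakly_subset:
  "columns_weakly_increasing D T \<Longrightarrow> E \<subseteq> D \<Longrightarrow> columns_weakly_increasing E (restrict T E)"
  by (auto simp: columns_weakly_increasing_def subset_eq)

lemma border_strip_tableaux_cut:
  assumes gh: "g \<le> h" and hf: "h \<le> f" and h: "shape N h"
    and T: "T \<in> border_strip_tableaux f g m (Suc d)"
    and iff: "\<And>b. b \<in> boxes f - boxes g \<Longrightarrow> b \<in> boxes h \<longleftrightarrow> T b < Suc d"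
  shows "h \<in> border_strip_removals N m f" "restrict T (boxes h - boxes g) \<in> border_strip_tableaux h g m d"
    "\<And>b. b \<in> boxes f - boxes h \<Longrightarrow> T b = Suc d"
proof -
  let ?D = "boxes f - boxes g" and ?E = "boxes h - boxes g"
  have sub: "boxes g \<subseteq> boxes h" "boxes h \<subseteq> boxes f" using gh hf by (simp_all add: boxes_subset_iff)
  have im: "T ` ?D = {1..Suc d}" and strips: "\<And>j. j \<in> {1..Suc d} \<Longrightarrow>
      border_strip {b \<in> ?D. T b = j} \<and> card {b \<in> ?D. T b = j} = m"
    using T by (auto simp: border_strip_tableaux_def)
  have le: "T b \<le> Suc d" if "b \<in> ?D" for b using im that by auto
  have E: "?E = {b \<in> ?D. T b \<le> d}" using iff sub by (auto simp: less_Suc_eq_le)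
  have top: "boxes f - boxes h = {b \<in> ?D. T b = Suc d}"
    by (rule boxes_with_top_label[OF gh hf iff le])
  then show "\<And>b. b \<in> boxes f - boxes h \<Longrightarrow> T b = Suc d" by auto
  show "h \<in> border_strip_removals N m f"
    unfolding border_strip_removals_def using h hf strips[of "Suc d"] by (simp add: top le_fun_def)
  have imE: "restrict T ?E ` ?E = {1..d}"
  proof
    show "restrict T ?E ` ?E \<subseteq> {1..d}" using im unfolding E by auto
    show "{1..d} \<subseteq> restrict T ?E ` ?E"
    proof
      fix j assume j: "j \<in> {1..d}"
      then have "j \<in> T ` ?D" using im by auto
      then obtain b where "b \<in> ?D" "T b = j" by auto
      then have "b \<in> ?E" "restrict T ?E b = j" using j unfolding E by auto
      then show "j \<in> restrict T ?E ` ?E" by blast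
    qed
  qed
  have "{b \<in> ?E. restrict T ?E b = j} = {b \<in> ?D. T b = j}" if "j \<in> {1..d}" for j
    using that unfolding E by auto
  then have "border_strip {b \<in> ?E. restrict T ?E b = j} \<and> card {b \<in> ?E. restrict T ?E b = j} = m"
    if "j \<in> {1..d}" for j using that strips[of j] by simp
  moreover have "?E \<subseteq> ?D" using sub by auto
  ultimately show "restrict T ?E \<in> border_strip_tableaux h g m d"
    using T imE rows_weakly_subset[of ?D T ?E] columns_weakly_subset[of ?D T ?E]
    by (simp add: border_strip_tableaux_def)
qed

lemma border_strip_tableaux_paste:
  assumes gh: "g \<le> h" and h: "h \<in> border_strip_removals N m f"
    and T: "T \<in> border_strip_tableaux h g m d"
  defines "G \<equiv> glue f h T (\<lambda>_. Suc d)"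
  shows "G \<in> border_strip_tableaux f g m (Suc d)" "\<And>b. b \<in> boxes h - boxes g \<Longrightarrow> T b < Suc d"
    "tableau_height f g G = strip_height (boxes f - boxes h) + tableau_height h g T"
proof -
  let ?D = "boxes f - boxes g" and ?E = "boxes h - boxes g"
  have h': "shape N h" "h \<le> f" "border_strip (boxes f - boxes h)" "card (boxes f - boxes h) = m"
    using h by (auto simp: border_strip_removals_def le_fun_def)
  have sub: "boxes g \<subseteq> boxes h" "boxes h \<subseteq> boxes f" using gh h' by (simp_all add: boxes_subset_iff)
  have im: "T ` ?E = {1..d}" and strips: "\<And>j. j \<in> {1..d} \<Longrightarrow>
      border_strip {b \<in> ?E. T b = j} \<and> card {b \<in> ?E. T b = j} = m"
    using T by (auto simp: border_strip_tableaux_def)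
  have rng: "1 \<le> T b \<and> T b \<le> d" if "b \<in> ?E" for b using im that by auto
  then show lt: "\<And>b. b \<in> ?E \<Longrightarrow> T b < Suc d" by (simp add: less_Suc_eq_le)
  have GE: "G b = T b" if "b \<in> ?E" for b using that by (simp add: G_def glue_def)
  have Gf: "G b = Suc d" if "b \<in> boxes f - boxes h" for b using that by (simp add: G_def glue_def)
  have D: "?D = ?E \<union> (boxes f - boxes h)" using sub by auto
  have ne: "boxes f - boxes h \<noteq> {}" using h' by (auto simp: border_strip_def)
  have top: "{b \<in> ?D. G b = Suc d} = boxes f - boxes h"
    unfolding D using GE Gf rng by fastforce
  have low: "{b \<in> ?D. G b = j} = {b \<in> ?E. T b = j}" if "j \<in> {1..d}" for j
    unfolding D using GE Gf that by auto
  have "G ` ?D = G ` ?E \<union> G ` (boxes f - boxes h)" unfolding D by (rule image_Un)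
  also have "G ` ?E = {1..d}" unfolding im[symmetric] by (rule image_cong) (use GE in auto)
  also have "G ` (boxes f - boxes h) = {Suc d}" using Gf ne by (auto simp: image_iff)
  also have "{1..d} \<union> {Suc d} = {1..Suc d}" by auto
  finally have imG: "G ` ?D = {1..Suc d}" .
  have str: "border_strip {b \<in> ?D. G b = j} \<and> card {b \<in> ?D. G b = j} = m" if "j \<in> {1..Suc d}" for j
    using that strips[of j] low[of j] top h' by (cases "j = Suc d") auto
  have "G \<in> extensional ?D"
    unfolding G_def by (rule glue_extensional[OF _ gh h'(2)])
      (use T in \<open>simp add: border_strip_tableaux_def\<close>)
  moreover have lt': "\<forall>b\<in>?E. T b < Suc d" "\<forall>b\<in>boxes f - boxes h. Suc d \<le> Suc d"
    using lt by auto
  note cases = glue_cases[OF h'(1) gh h'(2) lt']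
  have "rows_weakly_increasing ?D G"
    unfolding rows_weakly_increasing_def
  proof (intro allI impI)
    fix i j j' assume "(i, j) \<in> ?D" "(i, j') \<in> ?D" "j < j'"
    then show "G (i, j) \<le> G (i, j')"
      using cases[of i j i j'] T
      by (auto simp: border_strip_tableaux_def rows_weakly_increasing_def G_def)
  qed
  moreover have "columns_weakly_increasing ?D G"
    unfolding columns_weakly_increasing_def
  proof (intro allI impI)
    fix i i' j assume "(i, j) \<in> ?D" "(i', j) \<in> ?D" "i < i'"
    then show "G (i, j) \<le> G (i', j)"
      using cases[of i j i' j] T
      by (auto simp: border_strip_tableaux_def columns_weakly_increasing_def G_def)
  qed
  ultimately show "G \<in> border_strip_tableaux f g m (Suc d)"
    using imG str by (simp add: border_strip_tableaux_def)
  have "tableau_height f g G = (\<Sum>j\<in>insert (Suc d) {1..d}. strip_height {b \<in> ?D. G b = j})"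
    unfolding tableau_height_def imG by (rule sum.cong) auto
  also have "\<dots> = strip_height (boxes f - boxes h) + (\<Sum>j\<in>{1..d}. strip_height {b \<in> ?E. T b = j})"
    using low top by simp
  finally show "tableau_height f g G = strip_height (boxes f - boxes h) + tableau_height h g T"
    by (simp add: tableau_height_def im)
qed

text \<open>Removing the strip with the largest label \<open>d\<close> is one factor \<open>p\<^sub>m\<close>.\<close>

theorem p_op_power_border_strip_tableaux:
  assumes g: "shape N g" and m: "m > 0" and f: "shape N f"
  shows "(p_op N m ^^ d) (alternating_delta N g) (beads f) =
    (if g \<le> f then \<Sum>B\<in>border_strip_tableaux f g m d. (-1) ^ tableau_height f g B else 0)"
  using f
proof (induction d arbitrary: f)
  case 0
  show ?case
  proof (cases "f = g")
    case True
    then have "border_strip_tableaux f g m 0 = {\<lambda>_. undefined}"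
      by (auto simp: border_strip_tableaux_def rows_weakly_increasing_def columns_weakly_increasing_def)
    then show ?thesis using True by (simp add: alternating_delta_beads[OF g g] tableau_height_def)
  next
    case False
    have "border_strip_tableaux f g m 0 = {}" if "g \<le> f"
    proof -
      have "\<not> boxes f \<subseteq> boxes g" using that False by (simp add: boxes_subset_iff)
      then have "boxes f - boxes g \<noteq> {}" by blast
      then show ?thesis by (auto simp: border_strip_tableaux_def)
    qed
    then show ?thesis using False by (auto simp: alternating_delta_beads[OF 0 g])
  qed
next
  case (Suc d)
  let ?F = "(p_op N m ^^ d) (alternating_delta N g) :: (nat \<Rightarrow> int) \<Rightarrow> 'a"
  let ?R = "border_strip_removals N m f" and ?h = "\<lambda>h. strip_height (boxes f - boxes h)"
  have alt: "alternating N ?F" by (induction d) (auto intro: alternating_delta_alternating alternating_p_op)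
  have sup: "supported N ?F" by (induction d) (auto intro: alternating_delta_supported[OF g] supported_p_op)
  have finR: "finite ?R"
    by (rule finite_subset[OF _ finite_shapes_below[OF Suc.prems]])
      (auto simp: border_strip_removals_def le_fun_def)
  have "(p_op N m ^^ Suc d) (alternating_delta N g) (beads f) = (\<Sum>h\<in>?R. (-1) ^ ?h h * ?F (beads h))"
    using Murnaghan_Nakayama_step[OF alt sup Suc.prems m] by simp
  also have "\<dots> = (\<Sum>h\<in>?R. if g \<le> h
      then \<Sum>B\<in>border_strip_tableaux h g m d. (-1) ^ (?h h + tableau_height h g B) else 0)"
    by (rule sum.cong)
      (auto simp: border_strip_removals_def Suc.IH sum_distrib_left power_add)
  also have "\<dots> = (\<Sum>h\<in>{h \<in> ?R. g \<le> h}.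
      \<Sum>B\<in>border_strip_tableaux h g m d. (-1) ^ (?h h + tableau_height h g B))"
    using finR by (simp add: sum.inter_filter)
  also have "\<dots> = (if g \<le> f then \<Sum>B\<in>border_strip_tableaux f g m (Suc d).
      (-1) ^ tableau_height f g B else 0)"
  proof (cases "g \<le> f")
    case True
    have "(\<Sum>B\<in>border_strip_tableaux f g m (Suc d). (-1) ^ tableau_height f g B :: 'a)
      = (\<Sum>h\<in>{h \<in> ?R. g \<le> h}. \<Sum>B\<in>border_strip_tableaux h g m d.
          (-1) ^ tableau_height f g (glue f h B (\<lambda>_. Suc d)))"
    proof (rule sum_over_tableaux[OF Suc.prems g True, where x = "Suc d"])
      fix T h assume "h \<in> {h \<in> ?R. g \<le> h}" "T \<in> border_strip_tableaux h g m d"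
      then show "glue f h T (\<lambda>_. Suc d) \<in> border_strip_tableaux f g m (Suc d) \<and>
          (\<forall>b\<in>boxes h - boxes g. T b < Suc d) \<and> (\<forall>b\<in>boxes f - boxes h. Suc d \<le> Suc d)"
        using border_strip_tableaux_paste[of g h N m f T d] by auto
    next
      fix T h assume "T \<in> border_strip_tableaux f g m (Suc d)" "shape N h" "g \<le> h" "h \<le> f"
        "\<And>b. b \<in> boxes f - boxes g \<Longrightarrow> b \<in> boxes h \<longleftrightarrow> T b < Suc d"
      then show "h \<in> {h \<in> ?R. g \<le> h} \<and> restrict T (boxes h - boxes g) \<in> border_strip_tableaux h g m d
          \<and> (\<forall>b\<in>boxes f - boxes h. T b = Suc d)"
        using border_strip_tableaux_cut[of g h f N T m d] by blast
    next
      fix h assume "h \<in> {h \<in> ?R. g \<le> h}"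
      then show "finite (border_strip_tableaux h g m d) \<and>
          border_strip_tableaux h g m d \<subseteq> extensional (boxes h - boxes g)"
        using finite_border_strip_tableaux[of N h g m d]
        by (auto simp: border_strip_removals_def border_strip_tableaux_def)
    qed (auto simp: border_strip_removals_def border_strip_tableaux_def le_fun_def)
    also have "\<dots> = (\<Sum>h\<in>{h \<in> ?R. g \<le> h}.
        \<Sum>B\<in>border_strip_tableaux h g m d. (-1) ^ (?h h + tableau_height h g B))"
      by (intro sum.cong refl) (use border_strip_tableaux_paste(3)[of g _ N m f _ d] in auto)
    finally show ?thesis using True by simp
  next
    case False
    then have none: "{h \<in> ?R. g \<le> h} = {}"
      by (auto simp: border_strip_removals_def le_fun_def) (meson order_trans)
    show ?thesis unfolding none using False by simp
  qed
  finally show ?case .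
qed

section \<open>The common sign of all border-strip tableaux\<close>

text \<open>Compares positions by residue modulo \<open>m\<close> first and by size within a residue class. For distinct
  beads the product over all pairs is the sign of the permutation that sorts them in this order.\<close>

definition runner_order :: "nat \<Rightarrow> int \<Rightarrow> int \<Rightarrow> rat" where
  "runner_order m x y = of_int (if x mod int m = y mod int m then sgn (x - y)
     else sgn (x mod int m - y mod int m))"

text \<open>Moving a bead by \<open>m\<close> keeps its residue, and it cannot pass another bead of the same
  residue class without landing on one; so no comparison changes.\<close>

lemma runner_order_slide:
  assumes f: "shape N f" and m: "m > 0" and new: "beads f i - int m \<notin> beads f ` {..<N}"
  shows "pair_product N (runner_order m) ((beads f)(i := beads f i - int m))
    = pair_product N (runner_order m) (beads f)"
proof -
  let ?l = "beads f" and ?x = "beads f i - int m"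
  have res: "?x mod int m = ?l i mod int m" by (simp add: mod_diff_right_eq[symmetric])
  have "runner_order m ((?l(i := ?x)) a) ((?l(i := ?x)) b) = runner_order m (?l a) (?l b)"
    if ab: "a < b" "b < N" for a b
  proof -
    consider "a = i" | "b = i" "a \<noteq> i" | "a \<noteq> i" "b \<noteq> i" by blast
    then show ?thesis
    proof cases
      case 1
      have ord: "?l b < ?l i" using beads_strict[OF f] ab 1 by simp
      show ?thesis
      proof (cases "?l i mod int m = ?l b mod int m")
        case True
        then have "int m dvd ?l i - ?l b" by (simp add: mod_eq_dvd_iff)
        then have "int m \<le> ?l i - ?l b" using ord by (simp add: zdvd_imp_le)
        moreover have "?x \<noteq> ?l b" using new ab by (metis imageI lessThan_iff)
        ultimately show ?thesis using 1 ab True res ord by (simp add: runner_order_def)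
      qed (use 1 ab res in \<open>simp add: runner_order_def\<close>)
    next
      case 2
      then have "?l i < ?l a" using beads_strict[OF f] ab by simp
      then show ?thesis using 2 res m by (simp add: runner_order_def)
    qed auto
  qed
  then show ?thesis unfolding pair_product_def by (auto intro!: prod.cong)
qed

lemma runner_order_removal:
  assumes f: "shape N f" and m: "m > 0" and h: "h \<in> border_strip_removals N m f"
  shows "pair_product N (runner_order m) (beads h)
    = (-1) ^ strip_height (boxes f - boxes h) * pair_product N (runner_order m) (beads f)"
proof -
  have h': "shape N h" "\<And>r. h r \<le> f r" "border_strip (boxes f - boxes h)"
      "card (boxes f - boxes h) = m" using h by (auto simp: border_strip_removals_def)
  obtain i k where ik: "i \<le> k" "k < N"
    and move: "beads h = cycle_entry i k ((beads f)(i := beads f i - int m))"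
    using move_of_strip[OF f h'] by blast
  have bk: "beads h k = beads f i - int m" using move ik by (simp add: cycle_entry_def)
  have "beads f i - int m \<noteq> beads f j" if "j < N" for j
  proof
    assume eq: "beads f i - int m = beads f j"
    then have ij: "i \<noteq> j" using m by auto
    show False
    proof (cases "i < j \<and> j \<le> k")
      case True
      then have "beads h (j - 1) = beads f j" using move by (auto simp: cycle_entry_def)
      moreover have "j - 1 < k" using True by linarith
      ultimately show False using beads_strict[OF h'(1), of "j - 1" k] bk eq by simp
    next
      case False
      then have jk: "j \<noteq> k" "beads h j = beads f j" using move ij ik by (auto simp: cycle_entry_def)
      then show False using beads_strict[OF h'(1), of j k] beads_strict[OF h'(1), of k j] bk eq
        by (cases "j < k") auto
    qed
  qed
  then have new: "beads f i - int m \<notin> beads f ` {..<N}" by auto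
  have alt: "alternating N (pair_product N (runner_order m))"
    by (rule alternating_pair_product) (auto simp: runner_order_def sgn_if)
  have "pair_product N (runner_order m) (beads h)
      = (-1) ^ (k - i) * pair_product N (runner_order m) ((beads f)(i := beads f i - int m))"
    unfolding move by (rule alternating_cycle[OF alt ik])
  then show ?thesis
    using runner_order_slide[OF f m new] strip_of_move(4)[OF f h'(1) m ik move] by simp
qed

lemma runner_order_nonzero:
  assumes "shape N f" shows "pair_product N (runner_order m) (beads f) \<noteq> 0"
  unfolding pair_product_def
proof (subst prod_zero_iff[OF finite_pairs], clarify)
  fix a b assume "a < b" "b < N"
  then have "beads f b < beads f a" using beads_strict[OF assms] by blast
  moreover assume "runner_order m (beads f a) (beads f b) = 0"
  ultimately show False by (auto simp: runner_order_def sgn_if split: if_splits)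
qed

text \<open>Each strip contributes its height as the sign of sorting the beads afterwards. The
  product of these signs therefore depends on the two shapes only, not on the tableau.\<close>

theorem runner_order_tableau:
  assumes g: "shape N g" and m: "m > 0" and f: "shape N f" and gf: "g \<le> f"
    and B: "B \<in> border_strip_tableaux f g m d"
  shows "pair_product N (runner_order m) (beads g)
    = (-1) ^ tableau_height f g B * pair_product N (runner_order m) (beads f)"
  using f gf B
proof (induction d arbitrary: f B)
  case 0
  then have "boxes f - boxes g = {}" by (auto simp: border_strip_tableaux_def)
  then have "f = g" using 0 by (metis Diff_eq_empty_iff boxes_subset_iff order_antisym)
  then show ?case by (simp add: tableau_height_def)
next
  case (Suc d)
  have "rows_weakly_increasing (boxes f - boxes g) B" "columns_weakly_increasing (boxes f - boxes g) B"
    using Suc.prems by (auto simp: border_strip_tableaux_def)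
  then obtain h where h: "shape N h" "g \<le> h" "h \<le> f"
    and iff: "\<And>b. b \<in> boxes f - boxes g \<Longrightarrow> b \<in> boxes h \<longleftrightarrow> B b < Suc d"
    using ex_shape_below[OF Suc.prems(1) g Suc.prems(2)] by blast
  let ?T = "restrict B (boxes h - boxes g)"
  note cut = border_strip_tableaux_cut[OF h(2,3,1) Suc.prems(3) iff]
  have "glue f h ?T (\<lambda>_. Suc d) = B"
  proof
    fix b
    have "B \<in> extensional (boxes f - boxes g)"
      using Suc.prems(3) by (simp add: border_strip_tableaux_def)
    then have "B b = undefined" if "b \<notin> boxes f - boxes g"
      using that by (rule extensional_arb)
    moreover have "boxes g \<subseteq> boxes h" "boxes h \<subseteq> boxes f" using h by (simp_all add: boxes_subset_iff)
    ultimately show "glue f h ?T (\<lambda>_. Suc d) b = B b" using cut(3) by (auto simp: glue_def)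
  qed
  then have ht: "tableau_height f g B = strip_height (boxes f - boxes h) + tableau_height h g ?T"
    using border_strip_tableaux_paste(3)[OF h(2) cut(1,2)] by simp
  have "pair_product N (runner_order m) (beads g)
      = (-1) ^ tableau_height h g ?T * pair_product N (runner_order m) (beads h)"
    by (rule Suc.IH[OF h(1,2) cut(2)])
  also note runner_order_removal[OF Suc.prems(1) m cut(1)]
  finally show ?case by (simp only: ht power_add ac_simps)
qed

section \<open>Semistandard tableaux\<close>

lemma horizontal_strip_shape:
  assumes f: "shape N f" and h: "h \<in> horizontal_strips N a f"
  shows "shape N h" "h \<le> f" "card (boxes f - boxes h) = a"
proof -
  have le: "h i \<le> f i" "f (Suc i) \<le> h i" for i using h by (auto simp: horizontal_strips_def)
  then show "h \<le> f" by (simp add: le_fun_def)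
  have "antimono h"
    unfolding antimono_iff_le_Suc using le by (meson order_trans)
  moreover have "h i = 0" if "i \<ge> N" for i using f le(1)[of i] that by (simp add: shape_def)
  ultimately show "shape N h" by (simp add: shape_def)
  show "card (boxes f - boxes h) = a"
    using h unfolding card_boxes_diff[OF f] by (simp add: horizontal_strips_def)
qed

lemma horizontal_strip_columns:
  assumes f: "shape N f" and h: "h \<in> horizontal_strips N a f"
    and b: "(i, j) \<in> boxes f - boxes h" "(i', j') \<in> boxes f - boxes h" "i < i'"
  shows "j' < j"
proof -
  have "j' < f i'" using b by (simp add: boxes_def)
  also have "f i' \<le> f (Suc i)" using f b by (auto simp: shape_def antimono_def)
  also have "f (Suc i) \<le> h i" using h by (simp add: horizontal_strips_def)
  also have "h i \<le> j" using b by (simp add: boxes_def)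
  finally show ?thesis .
qed

lemma horizontal_stripI:
  assumes f: "shape N f" and h: "shape N h" "h \<le> f" and card: "card (boxes f - boxes h) = a"
    and cols: "\<And>i j. (i, j) \<in> boxes f - boxes h \<Longrightarrow> (Suc i, j) \<in> boxes f - boxes h \<Longrightarrow> False"
  shows "h \<in> horizontal_strips N a f"
proof -
  have "f (Suc i) \<le> h i" for i
  proof (rule ccontr)
    assume "\<not> f (Suc i) \<le> h i"
    moreover have "h (Suc i) \<le> h i" "f (Suc i) \<le> f i"
      using f h by (auto simp: shape_def antimono_def)
    ultimately show False using cols[of i "h i"] by (auto simp: boxes_def)
  qed
  then show ?thesis
    using h card unfolding card_boxes_diff[OF f] by (auto simp: horizontal_strips_def le_fun_def)
qed

text \<open>The product \<open>h\<^bsub>c 0\<^esub> h\<^bsub>c 1\<^esub> \<dots> h\<^bsub>c (L - 1)\<^esub>\<close>, which will count the tableaux with \<open>c x\<close> entries equal to \<open>x\<close>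
  for each \<open>x < L\<close>.\<close>

primrec h_product :: "nat \<Rightarrow> ((nat \<Rightarrow> int) \<Rightarrow> 'a::field_char_0) \<Rightarrow> nat \<Rightarrow> (nat \<Rightarrow> nat) \<Rightarrow>
    (nat \<Rightarrow> int) \<Rightarrow> 'a" where
  "h_product N F 0 c = F"
| "h_product N F (Suc L) c = h_op N (c L) (h_product N F L c)"

definition semistandard ::
    "(nat \<Rightarrow> nat) \<Rightarrow> (nat \<Rightarrow> nat) \<Rightarrow> nat \<Rightarrow> (nat \<Rightarrow> nat) \<Rightarrow> (nat \<times> nat \<Rightarrow> nat) set" where
  "semistandard f g L c = {T \<in> extensional (boxes f - boxes g).
     T ` (boxes f - boxes g) \<subseteq> {..<L} \<and> (\<forall>x<L. card {b \<in> boxes f - boxes g. T b = x} = c x) \<and>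
     rows_weakly_increasing (boxes f - boxes g) T \<and>
     columns_strictly_increasing (boxes f - boxes g) T}"

lemma finite_semistandard: "shape N f \<Longrightarrow> finite (semistandard f g L c)"
  by (rule finite_subset[OF _ finite_fillings[of "boxes f - boxes g" "{..<L}"]])
    (auto simp: semistandard_def finite_boxes_diff)

lemma columns_strictly_subset:
  "columns_strictly_increasing D T \<Longrightarrow> E \<subseteq> D \<Longrightarrow> columns_strictly_increasing E (restrict T E)"
  by (auto simp: columns_strictly_increasing_def subset_eq)

lemma columns_strictly_imp_weakly:
  "columns_strictly_increasing D T \<Longrightarrow> columns_weakly_increasing D T"
  unfolding columns_strictly_increasing_def columns_weakly_increasing_def by (meson less_imp_le)

lemma semistandard_cut:
  assumes f: "shape N f" and gh: "g \<le> h" and hf: "h \<le> f" and h: "shape N h"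
    and T: "T \<in> semistandard f g (Suc L) c"
    and iff: "\<And>b. b \<in> boxes f - boxes g \<Longrightarrow> b \<in> boxes h \<longleftrightarrow> T b < L"
  shows "h \<in> horizontal_strips N (c L) f" "restrict T (boxes h - boxes g) \<in> semistandard h g L c"
    "\<And>b. b \<in> boxes f - boxes h \<Longrightarrow> T b = L"
proof -
  let ?D = "boxes f - boxes g" and ?E = "boxes h - boxes g"
  have sub: "boxes g \<subseteq> boxes h" "boxes h \<subseteq> boxes f" using gh hf by (simp_all add: boxes_subset_iff)
  have le: "T b \<le> L" if "b \<in> ?D" for b
    using T that by (auto simp: semistandard_def less_Suc_eq_le)
  have E: "?E = {b \<in> ?D. T b < L}" using iff sub by auto
  have top: "boxes f - boxes h = {b \<in> ?D. T b = L}"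
    by (rule boxes_with_top_label[OF gh hf iff le])
  then show "\<And>b. b \<in> boxes f - boxes h \<Longrightarrow> T b = L" by auto
  show "h \<in> horizontal_strips N (c L) f"
  proof (rule horizontal_stripI[OF f h hf])
    show "card (boxes f - boxes h) = c L" unfolding top using T by (simp add: semistandard_def)
    fix i j assume "(i, j) \<in> boxes f - boxes h" "(Suc i, j) \<in> boxes f - boxes h"
    then have "(i, j) \<in> ?D" "(Suc i, j) \<in> ?D" "T (i, j) = T (Suc i, j)" unfolding top by auto
    moreover have "columns_strictly_increasing ?D T" using T by (simp add: semistandard_def)
    ultimately show False unfolding columns_strictly_increasing_def
      by (metis lessI less_irrefl)
  qed
  have "{b \<in> ?E. restrict T ?E b = x} = {b \<in> ?D. T b = x}" if "x < L" for x
    using that unfolding E by auto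
  then have "card {b \<in> ?E. restrict T ?E b = x} = c x" if "x < L" for x
    using T that by (simp add: semistandard_def)
  moreover have "restrict T ?E ` ?E \<subseteq> {..<L}" unfolding E by auto
  moreover have "?E \<subseteq> ?D" using sub by auto
  ultimately show "restrict T ?E \<in> semistandard h g L c"
    using T rows_weakly_subset[of ?D T ?E] columns_strictly_subset[of ?D T ?E]
    by (simp add: semistandard_def)
qed

lemma semistandard_paste:
  assumes f: "shape N f" and gh: "g \<le> h" and hs: "h \<in> horizontal_strips N (c L) f"
    and T: "T \<in> semistandard h g L c"
  defines "G \<equiv> glue f h T (\<lambda>_. L)"
  shows "G \<in> semistandard f g (Suc L) c" "\<And>b. b \<in> boxes h - boxes g \<Longrightarrow> T b < L"
proof -
  let ?D = "boxes f - boxes g" and ?E = "boxes h - boxes g"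
  note h' = horizontal_strip_shape[OF f hs]
  have sub: "boxes g \<subseteq> boxes h" "boxes h \<subseteq> boxes f" using gh h' by (simp_all add: boxes_subset_iff)
  show lt: "\<And>b. b \<in> ?E \<Longrightarrow> T b < L" using T by (auto simp: semistandard_def)
  have GE: "G b = T b" if "b \<in> ?E" for b using that by (simp add: G_def glue_def)
  have Gf: "G b = L" if "b \<in> boxes f - boxes h" for b using that by (simp add: G_def glue_def)
  have D: "?D = ?E \<union> (boxes f - boxes h)" using sub by auto
  have "{b \<in> ?D. G b = L} = boxes f - boxes h"
    unfolding D using GE Gf lt by fastforce
  moreover have "{b \<in> ?D. G b = x} = {b \<in> ?E. T b = x}" if "x < L" for x
    unfolding D using GE Gf that by auto
  ultimately have card: "card {b \<in> ?D. G b = x} = c x" if "x < Suc L" for x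
    using that T h'(3) by (cases "x = L") (auto simp: semistandard_def)
  have im: "G ` ?D \<subseteq> {..<Suc L}"
    unfolding D using GE Gf lt by (fastforce simp: less_Suc_eq)
  have ext: "G \<in> extensional ?D"
    unfolding G_def by (rule glue_extensional[OF _ gh h'(2)]) (use T in \<open>simp add: semistandard_def\<close>)
  have lt': "\<forall>b\<in>?E. T b < L" "\<forall>b\<in>boxes f - boxes h. L \<le> L" using lt by auto
  note cases = glue_cases[OF h'(1) gh h'(2) lt']
  have rows: "rows_weakly_increasing ?D G"
    unfolding rows_weakly_increasing_def
  proof (intro allI impI)
    fix i j j' assume "(i, j) \<in> ?D" "(i, j') \<in> ?D" "j < j'"
    then show "G (i, j) \<le> G (i, j')"
      using cases[of i j i j'] T
      by (auto simp: semistandard_def rows_weakly_increasing_def G_def)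
  qed
  have cols: "columns_strictly_increasing ?D G"
    unfolding columns_strictly_increasing_def
  proof (intro allI impI)
    fix i i' j assume ij: "(i, j) \<in> ?D" "(i', j) \<in> ?D" "i < i'"
    have "\<not> ((i, j) \<in> boxes f - boxes h \<and> (i', j) \<in> boxes f - boxes h)"
      using horizontal_strip_columns[OF f hs, of i j i' j] ij by auto
    then show "G (i, j) < G (i', j)"
      using cases[of i j i' j] T ij
      by (auto simp: semistandard_def columns_strictly_increasing_def G_def)
  qed
  show "G \<in> semistandard f g (Suc L) c"
    using ext im card rows cols by (simp add: semistandard_def)
qed

lemma alternating_h_product:
  "alternating N F \<Longrightarrow> alternating N (h_product N F L c)"
  by (induction L) (auto intro: alternating_h_op)

lemma supported_h_product:
  "supported N F \<Longrightarrow> supported N (h_product N F L c)"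
  by (induction L) (auto intro: supported_h_op)

text \<open>The boxes with the largest entry form a horizontal strip, to which the Pieri rule applies.\<close>

theorem h_product_semistandard:
  assumes g: "shape N g" and f: "shape N f"
  shows "h_product N (alternating_delta N g) L c (beads f) =
    (if g \<le> f then of_nat (card (semistandard f g L c)) else 0)"
  using f
proof (induction L arbitrary: f)
  case 0
  show ?case
  proof (cases "f = g")
    case True
    then have "semistandard f g 0 c = {\<lambda>_. undefined}"
      by (auto simp: semistandard_def rows_weakly_increasing_def columns_strictly_increasing_def)
    then show ?thesis using True by (simp add: alternating_delta_beads[OF g g])
  next
    case False
    have "semistandard f g 0 c = {}" if "g \<le> f"
    proof -
      have "\<not> boxes f \<subseteq> boxes g" using that False by (simp add: boxes_subset_iff)
      then have "boxes f - boxes g \<noteq> {}" by blast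
      then show ?thesis by (auto simp: semistandard_def)
    qed
    then show ?thesis using False by (auto simp: alternating_delta_beads[OF 0 g])
  qed
next
  case (Suc L)
  let ?F = "h_product N (alternating_delta N g) L c :: (nat \<Rightarrow> int) \<Rightarrow> 'a"
  let ?H = "horizontal_strips N (c L) f"
  note shapes = horizontal_strip_shape[OF Suc.prems]
  have alt: "alternating N ?F" by (rule alternating_h_product[OF alternating_delta_alternating])
  have sup: "supported N ?F" by (rule supported_h_product[OF alternating_delta_supported[OF g]])
  have finH: "finite ?H"
    by (rule finite_subset[OF _ finite_shapes_below[OF Suc.prems]]) (use shapes in auto)
  have "h_product N (alternating_delta N g) (Suc L) c (beads f) = (\<Sum>h\<in>?H. ?F (beads h))"
    using Pieri[OF alt sup Suc.prems] by simp
  also have "\<dots> = (\<Sum>h\<in>?H. if g \<le> h then \<Sum>T\<in>semistandard h g L c. 1 else 0)"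
  proof (rule sum.cong)
    fix h assume "h \<in> ?H"
    then have "shape N h" by (rule shapes(1))
    then show "?F (beads h) = (if g \<le> h then \<Sum>T\<in>semistandard h g L c. 1 else 0)"
      by (simp add: Suc.IH)
  qed simp
  also have "\<dots> = (\<Sum>h\<in>{h \<in> ?H. g \<le> h}. \<Sum>T\<in>semistandard h g L c. 1)"
    using sum.inter_filter[OF finH, of "\<lambda>h. \<Sum>T\<in>semistandard h g L c. 1" "\<lambda>h. g \<le> h"] by (rule sym)
  also have "\<dots> = (if g \<le> f then \<Sum>T\<in>semistandard f g (Suc L) c. 1 else 0)"
  proof (cases "g \<le> f")
    case True
    have "(\<Sum>T\<in>semistandard f g (Suc L) c. 1 :: 'a)
      = (\<Sum>h\<in>{h \<in> ?H. g \<le> h}. \<Sum>T\<in>semistandard h g L c. 1)"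
    proof (rule sum_over_tableaux[OF Suc.prems g True, where x = L and u = "\<lambda>_ _. L" and w = "\<lambda>_. 1"
            and B = "\<lambda>h. semistandard h g L c"])
      fix T h assume "h \<in> {h \<in> ?H. g \<le> h}" "T \<in> semistandard h g L c"
      then show "glue f h T (\<lambda>_. L) \<in> semistandard f g (Suc L) c \<and>
          (\<forall>b\<in>boxes h - boxes g. T b < L) \<and> (\<forall>b\<in>boxes f - boxes h. L \<le> L)"
        using semistandard_paste[OF Suc.prems, of g h c L T] by auto
    next
      fix T h assume "T \<in> semistandard f g (Suc L) c" "shape N h" "g \<le> h" "h \<le> f"
        "\<And>b. b \<in> boxes f - boxes g \<Longrightarrow> b \<in> boxes h \<longleftrightarrow> T b < L"
      then show "h \<in> {h \<in> ?H. g \<le> h} \<and> restrict T (boxes h - boxes g) \<in> semistandard h g L c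
          \<and> (\<forall>b\<in>boxes f - boxes h. T b = L)"
        using semistandard_cut[OF Suc.prems, of g h T L c] by blast
    next
      fix T assume "T \<in> semistandard f g (Suc L) c"
      then show "T \<in> extensional (boxes f - boxes g) \<and>
          rows_weakly_increasing (boxes f - boxes g) T \<and>
          columns_weakly_increasing (boxes f - boxes g) T"
        by (simp add: semistandard_def columns_strictly_imp_weakly)
    next
      fix h assume h: "h \<in> {h \<in> ?H. g \<le> h}"
      then show "shape N h \<and> g \<le> h \<and> h \<le> f" using shapes by auto
      from h show "finite (semistandard h g L c) \<and>
          semistandard h g L c \<subseteq> extensional (boxes h - boxes g)"
        using finite_semistandard[of N h g L c] shapes(1)[of h "c L"] by (simp add: semistandard_def Collect_mono_iff)
    qed
    then show ?thesis by (simp only: True if_True)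
  next
    case False
    have "\<not> g \<le> h" if "h \<in> ?H" for h using shapes(2)[OF that] False order_trans by blast
    then have none: "{h \<in> ?H. g \<le> h} = {}" by blast
    show ?thesis unfolding none using False by simp
  qed
  finally show ?case by simp
qed

lemma h_product_cong:
  "(\<And>x. x < L \<Longrightarrow> c x = c' x) \<Longrightarrow> h_product N F L c = h_product N F L c'"
  by (induction L) auto

text \<open>Newton's identity for a product of complete functions, by the product rule: this is the
  Euler operator applied to the generating function of these products.\<close>

theorem h_product_Newton:
  "of_nat (\<Sum>x<L. c x) * h_product N F L c l
    = (\<Sum>x<L. \<Sum>k=1..c x. p_op N k (h_product N F L (c(x := c x - k))) l)"
proof (induction L arbitrary: l)
  case (Suc L)
  let ?K = "\<lambda>L c. h_product N F L c"
  have upd: "?K L (c(L := y)) = ?K L c" for y by (rule h_product_cong) simp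
  have "of_nat (\<Sum>x<L. c x) * h_op N (c L) (?K L c) l
      = h_op N (c L) (\<lambda>l. of_nat (\<Sum>x<L. c x) * ?K L c l) l"
    by (rule h_op_scale[symmetric])
  also have "\<dots> = h_op N (c L) (\<lambda>l. \<Sum>x<L. \<Sum>k=1..c x. p_op N k (?K L (c(x := c x - k))) l) l"
    unfolding Suc.IH ..
  also have "\<dots> = (\<Sum>x<L. \<Sum>k=1..c x. h_op N (c L) (p_op N k (?K L (c(x := c x - k)))) l)"
    by (simp add: h_op_sum)
  also have "\<dots> = (\<Sum>x<L. \<Sum>k=1..c x. p_op N k (?K (Suc L) (c(x := c x - k))) l)"
    by (intro sum.cong refl) (auto simp: h_op_p_op_commute)
  finally have low: "of_nat (\<Sum>x<L. c x) * h_op N (c L) (?K L c) l = \<dots>" .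
  have "of_nat (\<Sum>x<Suc L. c x) * ?K (Suc L) c l = of_nat (\<Sum>x<L. c x) * h_op N (c L) (?K L c) l
      + of_nat (c L) * h_op N (c L) (?K L c) l" by (simp add: algebra_simps)
  also have "of_nat (c L) * h_op N (c L) (?K L c) l
      = (\<Sum>k=1..c L. p_op N k (?K (Suc L) (c(L := c L - k))) l)"
    by (simp add: Newton upd)
  finally show ?case unfolding low by (simp only: sum.lessThan_Suc)
qed simp

section \<open>Expansion in power sums\<close>

lemma finite_submultisets: "finite {A. A \<subseteq># (M :: 'b multiset)}"
proof (induction M)
  case (add x M)
  have "{A. A \<subseteq># add_mset x M} \<subseteq> {A. A \<subseteq># M} \<union> add_mset x ` {A. A \<subseteq># M}"
  proof
    fix A assume A: "A \<in> {A. A \<subseteq># add_mset x M}"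
    show "A \<in> {A. A \<subseteq># M} \<union> add_mset x ` {A. A \<subseteq># M}"
    proof (cases "x \<in># A")
      case True
      then obtain A' where "A = add_mset x A'" by (metis mset_add)
      then show ?thesis using A by auto
    next
      case False
      have "count A a \<le> count M a" for a
        using mset_subset_eq_count[of A "add_mset x M" a] A False by (cases "a = x") (auto simp: not_in_iff)
      then have "A \<subseteq># M" by (rule mset_subset_eqI)
      then show ?thesis by simp
    qed
  qed
  then show ?case using add by (meson finite_Un finite_imageI finite_subset)
qed simp

lemma finite_count_ge: "k > 0 \<Longrightarrow> finite {x. k \<le> count M x}"
  by (rule finite_subset[of _ "set_mset M"]) (auto simp flip: count_greater_zero_iff)

text \<open>For \<open>k = 0\<close> the right-hand side would range over all variables, hence the hypothesis.\<close>

lemma power_sum_mult: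
  assumes k: "k > 0"
  shows "series_mult (power_sum k) F M = (\<Sum>x | k \<le> count M x. F (M - replicate_mset k x))"
proof -
  have "series_mult (power_sum k) F M
      = (\<Sum>A\<in>(\<lambda>x. replicate_mset k x) ` {x. k \<le> count M x}. power_sum k A * F (M - A))"
    unfolding series_mult_def
    by (rule sum.mono_neutral_right)
      (auto simp: finite_submultisets power_sum_def count_le_replicate_mset_subset_eq)
  also have "\<dots> = (\<Sum>x | k \<le> count M x. F (M - replicate_mset k x))"
    by (subst sum.reindex) (use k in \<open>auto simp: inj_on_def power_sum_def replicate_mset_eq_iff\<close>)
  finally show ?thesis .
qed

lemma power_sum_mult_commute:
  assumes "j > 0" "k > 0"
  shows "series_mult (power_sum j) (series_mult (power_sum k) F)
    = series_mult (power_sum k) (series_mult (power_sum j) F)"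
proof
  fix M :: "nat multiset"
  let ?S = "\<lambda>j k. {(x, y). replicate_mset j x + replicate_mset k y \<subseteq># M}"
  have *: "series_mult (power_sum j) (series_mult (power_sum k) F) M
      = (\<Sum>(x, y)\<in>?S j k. F (M - (replicate_mset j x + replicate_mset k y)))"
    if "j > 0" "k > 0" for j k
  proof -
    have iff: "replicate_mset j x + replicate_mset k y \<subseteq># M \<longleftrightarrow>
        j \<le> count M x \<and> k \<le> count (M - replicate_mset j x) y" for x y
      by (metis add.commute count_le_replicate_mset_subset_eq le_add1 mset_subset_eq_add_left
          subset_mset.add_le_imp_le_left subset_mset.le_diff_conv2 subset_mset.order_trans)
    have "series_mult (power_sum j) (series_mult (power_sum k) F) M
        = (\<Sum>x | j \<le> count M x. \<Sum>y | k \<le> count (M - replicate_mset j x) y.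
            F (M - (replicate_mset j x + replicate_mset k y)))"
      using that by (simp add: power_sum_mult)
    also have "\<dots> = (\<Sum>(x, y)\<in>(SIGMA x:{x. j \<le> count M x}. {y. k \<le> count (M - replicate_mset j x) y}).
            F (M - (replicate_mset j x + replicate_mset k y)))"
      by (rule sum.Sigma) (use that finite_count_ge in blast)+
    also have "(SIGMA x:{x. j \<le> count M x}. {y. k \<le> count (M - replicate_mset j x) y}) = ?S j k"
      by (auto simp: iff)
    finally show ?thesis .
  qed
  have "(\<Sum>(x, y)\<in>?S j k. F (M - (replicate_mset j x + replicate_mset k y)))
      = (\<Sum>(x, y)\<in>?S k j. F (M - (replicate_mset k x + replicate_mset j y)))"
    by (rule sum.reindex_bij_witness[where i = prod.swap and j = prod.swap]) (auto simp: add.commute)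
  then show "series_mult (power_sum j) (series_mult (power_sum k) F) M
      = series_mult (power_sum k) (series_mult (power_sum j) F) M"
    using * assms by simp
qed

text \<open>A partition is a sorted list, but its power sum does not depend on the order of the parts.\<close>

lemma foldr_remove1:
  assumes "\<And>x y. x \<in> set xs \<Longrightarrow> y \<in> set xs \<Longrightarrow> f x \<circ> f y = f y \<circ> f x" "k \<in> set xs"
  shows "foldr f xs a = f k (foldr f (remove1 k xs) a)"
  using assms
proof (induction xs)
  case (Cons x xs)
  show ?case
  proof (cases "x = k")
    case False
    then have k: "k \<in> set xs" using Cons.prems by auto
    have "foldr f (x # xs) a = f x (f k (foldr f (remove1 k xs) a))"
      using Cons.IH[OF Cons.prems(1)] k by simp
    also have "\<dots> = f k (f x (foldr f (remove1 k xs) a))"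
      using Cons.prems(1)[of x k] k by (auto simp: fun_eq_iff)
    finally show ?thesis using False by simp
  qed simp
qed simp

lemma power_sum_partition_remove1:
  assumes "k \<in> set nu" "0 \<notin> set nu"
  shows "power_sum_partition nu = series_mult (power_sum k) (power_sum_partition (remove1 k nu))"
  unfolding power_sum_partition_def
proof (rule foldr_remove1[OF ext])
  fix x y F assume "x \<in> set nu" "y \<in> set nu"
  then have "x > 0" "y > 0" using assms(2) by (metis gr0I)+
  then show "(series_mult (power_sum x) \<circ> series_mult (power_sum y)) F
      = (series_mult (power_sum y) \<circ> series_mult (power_sum x)) F"
    unfolding comp_apply by (rule power_sum_mult_commute)
qed (rule assms(1))

lemma z_partition_remove1:
  assumes "k \<in> set nu"
  shows "z_partition nu = k * count_list nu k * z_partition (remove1 k nu)"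
proof -
  let ?t = "\<lambda>nu j. fact (count_list nu j) * j ^ count_list nu j :: nat"
  have ext: "z_partition xs = (\<Prod>j\<in>set nu. ?t xs j)" if "set xs \<subseteq> set nu" for xs
    unfolding z_partition_def using that
    by (intro prod.mono_neutral_left) (auto simp: count_list_0_iff)
  have "count_list nu k \<noteq> 0" using assms count_list_0_iff by metis
  then obtain c where c: "count_list nu k = Suc c" using not0_implies_Suc by blast
  have "?t nu k = k * count_list nu k * ?t (remove1 k nu) k"
    by (simp add: c algebra_simps)
  moreover have "(\<Prod>j\<in>set nu - {k}. ?t nu j) = (\<Prod>j\<in>set nu - {k}. ?t (remove1 k nu) j)"
    by (rule prod.cong) auto
  moreover have "z_partition nu = ?t nu k * (\<Prod>j\<in>set nu - {k}. ?t nu j)"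
    unfolding ext[OF order_refl] using assms by (intro prod.remove) auto
  moreover have "z_partition (remove1 k nu)
      = ?t (remove1 k nu) k * (\<Prod>j\<in>set nu - {k}. ?t (remove1 k nu) j)"
    unfolding ext[OF set_remove1_subset] using assms by (intro prod.remove) auto
  ultimately show ?thesis by (simp add: mult.assoc)
qed

lemma z_partition_pos: "0 \<notin> set nu \<Longrightarrow> z_partition nu > 0"
  unfolding z_partition_def by (intro prod_pos) (auto intro: gr0I)

lemma finite_partitions_of: "finite (partitions_of n)"
proof (rule finite_subset)
  show "partitions_of n \<subseteq> {xs. set xs \<subseteq> {..n} \<and> length xs \<le> n}"
  proof
    fix nu assume nu: "nu \<in> partitions_of n"
    have "length xs \<le> sum_list xs" if "0 \<notin> set xs" for xs :: "nat list"
      using that by (induction xs) auto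
    then show "nu \<in> {xs. set xs \<subseteq> {..n} \<and> length xs \<le> n}"
      using nu member_le_sum_list by (fastforce simp: partitions_of_def is_partition_def)
  qed
  show "finite {xs. set xs \<subseteq> {..n} \<and> length xs \<le> n}" by (rule finite_lists_length_le) simp
qed

lemma partition_eq_of_mset:
  assumes "is_partition nu" "is_partition nu'" "mset nu = mset nu'"
  shows "nu = nu'"
proof -
  have "sorted (rev nu)" "sorted (rev nu')"
    using assms(1,2) by (simp_all add: is_partition_def sorted_wrt_rev)
  then have "rev nu = rev nu'"
    by (metis assms(3) mset_rev properties_for_sort sort_key_id_if_sorted sorted_sort_id)
  then show ?thesis by simp
qed

lemma is_partition_remove1: "is_partition nu \<Longrightarrow> is_partition (remove1 k nu)"
proof -
  assume nu: "is_partition nu"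
  have "sorted_wrt (\<ge>) (remove1 k xs)" if "sorted_wrt (\<ge>) xs" for xs :: "nat list"
    using that by (induction xs) (auto dest: in_set_remove1[THEN iffD1, rotated] set_remove1_subset[THEN subsetD])
  then show ?thesis using nu set_remove1_subset[of k nu] by (auto simp: is_partition_def)
qed

lemma sum_list_remove1: "k \<in> set nu \<Longrightarrow> sum_list nu = k + sum_list (remove1 k nu)" for k :: nat
  by (induction nu) auto

text \<open>Writing \<open>n\<close> as the sum of \<open>k\<close> times the multiplicity of \<open>k\<close> in \<open>\<nu>\<close> and removing one part \<open>k\<close> turns
  \<open>1 / z\<^sub>\<nu>\<close> into \<open>1 / z\<close> of the smaller partition, because the two differ by exactly the factor
  \<open>k\<close> times that multiplicity.\<close>

lemma sum_partitions_by_part: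
  assumes W: "\<And>nu k. k \<in> set nu \<Longrightarrow> 0 \<notin> set nu \<Longrightarrow> W nu = W (k # remove1 k nu)"
  shows "of_nat n * (\<Sum>nu\<in>partitions_of n. W nu / of_nat (z_partition nu))
    = (\<Sum>k=1..n. \<Sum>nu\<in>partitions_of (n - k). W (k # nu) / of_nat (z_partition nu) :: 'a::field_char_0)"
proof -
  have "of_nat n * (\<Sum>nu\<in>partitions_of n. W nu / of_nat (z_partition nu))
      = (\<Sum>nu\<in>partitions_of n. \<Sum>k\<in>set nu. of_nat (k * count_list nu k) * (W nu / of_nat (z_partition nu)))"
    unfolding sum_distrib_left
  proof (rule sum.cong)
    fix nu assume "nu \<in> partitions_of n"
    then have n: "n = (\<Sum>k\<in>set nu. k * count_list nu k)"
      using sum_list_map_eq_sum_count[of "\<lambda>x. x" nu] by (simp add: partitions_of_def mult.commute)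
    show "of_nat n * (W nu / of_nat (z_partition nu))
        = (\<Sum>k\<in>set nu. of_nat (k * count_list nu k) * (W nu / of_nat (z_partition nu)))"
      by (simp only: sum_distrib_right[symmetric] of_nat_sum[symmetric] n[symmetric])
  qed simp
  also have "\<dots> = (\<Sum>(nu, k)\<in>Sigma (partitions_of n) set.
      of_nat (k * count_list nu k) * (W nu / of_nat (z_partition nu)))"
    by (rule sum.Sigma) (auto simp: finite_partitions_of)
  also have "\<dots> = (\<Sum>(k, nu)\<in>Sigma {1..n} (\<lambda>k. partitions_of (n - k)). W (k # nu) / of_nat (z_partition nu))"
  proof (rule sum.reindex_bij_witness[where
        i = "\<lambda>(k, nu). (rev (sort (k # nu)), k)" and j = "\<lambda>(nu, k). (k, remove1 k nu)"])
    fix p assume p: "p \<in> Sigma (partitions_of n) set"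
    obtain nu k where [simp]: "p = (nu, k)" by force
    have nu: "nu \<in> partitions_of n" "k \<in> set nu" using p by auto
    then have part: "is_partition nu" "sum_list nu = n" "0 \<notin> set nu"
      by (auto simp: partitions_of_def is_partition_def)
    have k: "k \<noteq> 0" using nu part by metis
    show "(case p of (nu, k) \<Rightarrow> (k, remove1 k nu)) \<in> Sigma {1..n} (\<lambda>k. partitions_of (n - k))"
      using sum_list_remove1[OF nu(2)] part is_partition_remove1[OF part(1), of k] k
      by (auto simp: partitions_of_def)
    have "rev (sort (k # remove1 k nu)) = nu"
      by (rule partition_eq_of_mset)
        (use part nu k set_remove1_subset[of k nu] in
          \<open>auto simp: is_partition_def sorted_wrt_rev simp del: sort_key_simps\<close>)
    then show "(case case p of (nu, k) \<Rightarrow> (k, remove1 k nu) of (k, nu) \<Rightarrow> (rev (sort (k # nu)), k)) = p"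
      by simp
    have "count_list nu k \<noteq> 0" using nu(2) by (simp add: count_list_0_iff)
    then show "(case case p of (nu, k) \<Rightarrow> (k, remove1 k nu) of
          (k, nu) \<Rightarrow> W (k # nu) / of_nat (z_partition nu)) =
        (case p of (nu, k) \<Rightarrow> of_nat (k * count_list nu k) * (W nu / of_nat (z_partition nu)))"
      using W[OF nu(2) part(3)] k by (simp add: z_partition_remove1[OF nu(2)])
  next
    fix p assume p: "p \<in> Sigma {1..n} (\<lambda>k. partitions_of (n - k))"
    obtain k nu where [simp]: "p = (k, nu)" by force
    have k: "1 \<le> k" "k \<le> n" and nu: "is_partition nu" "sum_list nu = n - k"
      using p by (auto simp: partitions_of_def)
    let ?x = "rev (sort (k # nu))"
    have "sum_list ?x = sum_mset (mset ?x)" by (simp only: sum_mset_sum_list)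
    also have "\<dots> = n" using k nu by (simp add: sum_mset_sum_list)
    finally have sum: "sum_list ?x = n" .
    have part: "is_partition ?x"
      using k nu by (auto simp: is_partition_def sorted_wrt_rev simp del: sort_key_simps)
    with sum show "(case p of (k, nu) \<Rightarrow> (rev (sort (k # nu)), k)) \<in> Sigma (partitions_of n) set"
      by (auto simp: partitions_of_def simp del: sort_key_simps)
    have "remove1 k ?x = nu"
      by (rule partition_eq_of_mset) (use is_partition_remove1[OF part] nu in auto)
    then show "(case case p of (k, nu) \<Rightarrow> (rev (sort (k # nu)), k) of (nu, k) \<Rightarrow> (k, remove1 k nu)) = p"
      by simp
  qed
  also have "\<dots> = (\<Sum>k=1..n. \<Sum>nu\<in>partitions_of (n - k). W (k # nu) / of_nat (z_partition nu))"
    by (rule sum.Sigma[symmetric]) (auto simp: finite_partitions_of)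
  finally show ?thesis .
qed

text \<open>The coefficient of the monomial \<open>M\<close> in the sum of the \<open>p\<^sub>\<nu>(x) p\<^sub>\<nu>(shifts) / z\<^sub>\<nu>\<close>, applied to \<open>F\<close>.\<close>

definition power_sum_expansion :: "nat \<Rightarrow> ((nat \<Rightarrow> int) \<Rightarrow> rat) \<Rightarrow> nat multiset \<Rightarrow> (nat \<Rightarrow> int) \<Rightarrow> rat" where
  "power_sum_expansion N F M l = (\<Sum>nu\<in>partitions_of (size M).
     power_sum_partition nu M / of_nat (z_partition nu) * foldr (p_op N) nu F l)"

lemma power_sum_expansion_Newton:
  "of_nat (size M) * power_sum_expansion N F M l
    = (\<Sum>x\<in>set_mset M. \<Sum>k=1..count M x. p_op N k (power_sum_expansion N F (M - replicate_mset k x)) l)"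
proof -
  let ?n = "size M"
  define W where "W nu = power_sum_partition nu M * foldr (p_op N) nu F l" for nu
  have W: "W nu = W (k # remove1 k nu)" if "k \<in> set nu" "0 \<notin> set nu" for nu k
  proof -
    have "foldr (p_op N) nu F = p_op N k (foldr (p_op N) (remove1 k nu) F)"
    proof (rule foldr_remove1[OF ext])
      show "(p_op N x \<circ> p_op N y) G = (p_op N y \<circ> p_op N x) G" for x y and G :: "(nat \<Rightarrow> int) \<Rightarrow> rat"
        unfolding comp_apply by (rule p_op_commute)
    qed (rule that(1))
    then show ?thesis
      using power_sum_partition_remove1[OF that] by (simp add: W_def power_sum_partition_def)
  qed
  have cnt: "count M x \<le> ?n" for x by (metis count_le_size)
  have "of_nat ?n * power_sum_expansion N F M l
      = of_nat ?n * (\<Sum>nu\<in>partitions_of ?n. W nu / of_nat (z_partition nu))"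
    by (simp add: power_sum_expansion_def W_def)
  also have "\<dots> = (\<Sum>k=1..?n. \<Sum>nu\<in>partitions_of (?n - k). W (k # nu) / of_nat (z_partition nu))"
    by (rule sum_partitions_by_part[OF W])
  also have "\<dots> = (\<Sum>k=1..?n. \<Sum>x | k \<le> count M x.
      p_op N k (power_sum_expansion N F (M - replicate_mset k x)) l)"
  proof (rule sum.cong)
    fix k assume k: "k \<in> {1..?n}"
    have sz: "size (M - replicate_mset k x) = ?n - k" if "k \<le> count M x" for x
      using that by (simp add: count_le_replicate_mset_subset_eq size_Diff_submset)
    have "(\<Sum>x | k \<le> count M x. p_op N k (power_sum_expansion N F (M - replicate_mset k x)) l)
        = (\<Sum>x | k \<le> count M x. \<Sum>nu\<in>partitions_of (?n - k).
            power_sum_partition nu (M - replicate_mset k x) / of_nat (z_partition nu) *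
              p_op N k (foldr (p_op N) nu F) l)"
      unfolding power_sum_expansion_def[abs_def] by (intro sum.cong refl) (simp only: sz mem_Collect_eq p_op_weighted_sum)
    also have "\<dots> = (\<Sum>nu\<in>partitions_of (?n - k). \<Sum>x | k \<le> count M x.
            power_sum_partition nu (M - replicate_mset k x) / of_nat (z_partition nu) *
              p_op N k (foldr (p_op N) nu F) l)"
      by (rule sum.swap)
    also have "\<dots> = (\<Sum>nu\<in>partitions_of (?n - k). W (k # nu) / of_nat (z_partition nu))"
    proof (rule sum.cong)
      fix nu
      have "power_sum_partition (k # nu) M = (\<Sum>x | k \<le> count M x. power_sum_partition nu (M - replicate_mset k x))"
        using power_sum_mult[of k "power_sum_partition nu" M] k by (simp add: power_sum_partition_def)
      then show "(\<Sum>x | k \<le> count M x.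
            power_sum_partition nu (M - replicate_mset k x) / of_nat (z_partition nu) *
              p_op N k (foldr (p_op N) nu F) l) = W (k # nu) / of_nat (z_partition nu)"
        by (simp add: W_def sum_distrib_right sum_divide_distrib)
    qed simp
    finally show "(\<Sum>nu\<in>partitions_of (?n - k). W (k # nu) / of_nat (z_partition nu))
        = (\<Sum>x | k \<le> count M x. p_op N k (power_sum_expansion N F (M - replicate_mset k x)) l)" ..
  qed simp
  also have "\<dots> = (\<Sum>(k, x)\<in>Sigma {1..?n} (\<lambda>k. {x. k \<le> count M x}).
      p_op N k (power_sum_expansion N F (M - replicate_mset k x)) l)"
    by (rule sum.Sigma) (auto simp: finite_count_ge)
  also have "\<dots> = (\<Sum>(x, k)\<in>Sigma (set_mset M) (\<lambda>x. {1..count M x}).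
      p_op N k (power_sum_expansion N F (M - replicate_mset k x)) l)"
    by (rule sum.reindex_bij_witness[where i = prod.swap and j = prod.swap])
      (auto intro: order_trans[OF _ cnt] simp flip: count_greater_zero_iff)
  also have "\<dots> = (\<Sum>x\<in>set_mset M. \<Sum>k=1..count M x.
      p_op N k (power_sum_expansion N F (M - replicate_mset k x)) l)"
    by (rule sum.Sigma[symmetric]) auto
  finally show ?thesis .
qed

lemma partitions_of_0: "partitions_of 0 = {[]}"
proof -
  have "nu = []" if "0 \<notin> set nu" "sum_list nu = 0" for nu :: "nat list"
    using that by (cases nu) auto
  then show ?thesis by (auto simp: partitions_of_def is_partition_def)
qed

text \<open>Both sides satisfy the same recursion in the degree of \<open>M\<close>, which determines them as the degree
  is invertible in characteristic zero.\<close>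

theorem h_product_power_sums:
  assumes "set_mset M \<subseteq> {..<L}"
  shows "h_product N F L (count M) l = power_sum_expansion N F M l"
  using assms
proof (induction "size M" arbitrary: M l rule: less_induct)
  case less
  show ?case
  proof (cases "M = {#}")
    case True
    have "h_product N F L (\<lambda>_. 0) = F" by (induction L) auto
    then show ?thesis using True
      by (simp add: power_sum_expansion_def partitions_of_0 z_partition_def power_sum_partition_def
          series_one_def zero_multiset.rep_eq)
  next
    case False
    have "size M = (\<Sum>x<L. count M x)"
      unfolding size_multiset_overloaded_eq using less.prems
      by (intro sum.mono_neutral_left) (auto simp: not_in_iff)
    then have "of_nat (size M) * h_product N F L (count M) l
        = (\<Sum>x<L. \<Sum>k=1..count M x. p_op N k (h_product N F L ((count M)(x := count M x - k))) l)"
      using h_product_Newton[where L = L and c = "count M" and N = N and F = F and l = l] by simp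
    also have "\<dots> = (\<Sum>x<L. \<Sum>k=1..count M x. p_op N k (power_sum_expansion N F (M - replicate_mset k x)) l)"
    proof (intro sum.cong refl)
      fix x k assume k: "k \<in> {1..count M x}"
      let ?M = "M - replicate_mset k x"
      have upd: "(count M)(x := count M x - k) = count ?M" by auto
      have "size ?M < size M"
      proof -
        have "replicate_mset k x \<subseteq># M" using k by (simp flip: count_le_replicate_mset_subset_eq)
        then show ?thesis using k False by (simp add: size_Diff_submset nonempty_has_size)
      qed
      moreover have "set_mset ?M \<subseteq> {..<L}" using less.prems by (meson in_diffD subset_iff)
      ultimately have "h_product N F L ((count M)(x := count M x - k)) = power_sum_expansion N F ?M"
        unfolding upd by (intro ext less.hyps)
      then show "p_op N k (h_product N F L ((count M)(x := count M x - k))) l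
          = p_op N k (power_sum_expansion N F ?M) l" by simp
    qed
    also have "\<dots> = (\<Sum>x\<in>set_mset M. \<Sum>k=1..count M x.
        p_op N k (power_sum_expansion N F (M - replicate_mset k x)) l)"
      using less.prems by (intro sum.mono_neutral_right) (auto simp: not_in_iff)
    also have "\<dots> = of_nat (size M) * power_sum_expansion N F M l"
      by (rule power_sum_expansion_Newton[symmetric])
    finally show ?thesis using False by simp
  qed
qed

section \<open>Linear independence of the power sums\<close>

text \<open>A monomial of \<open>p\<^sub>\<nu>\<close> arises by assigning a variable to each part of \<open>\<nu>\<close>. It has at most as many
  variables as \<open>\<nu>\<close> has parts, and if it has as many, its exponents are the parts.\<close>

lemma power_sum_partition_support:
  assumes "power_sum_partition nu M \<noteq> 0" "0 \<notin> set nu"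
  shows "size M = sum_list nu \<and> card (set_mset M) \<le> length nu \<and>
    (card (set_mset M) = length nu \<longrightarrow> image_mset (count M) (mset_set (set_mset M)) = mset nu)"
  using assms
proof (induction nu arbitrary: M)
  case Nil
  then show ?case by (auto simp: power_sum_partition_def series_one_def split: if_splits)
next
  case (Cons k nu)
  have k: "k > 0" using Cons.prems by simp
  have "power_sum_partition (k # nu) M = (\<Sum>x | k \<le> count M x. power_sum_partition nu (M - replicate_mset k x))"
    using power_sum_mult[OF k, of "power_sum_partition nu" M] by (simp add: power_sum_partition_def)
  then obtain x where x: "k \<le> count M x" "power_sum_partition nu (M - replicate_mset k x) \<noteq> 0"
    using Cons.prems(1) by (metis (mono_tags, lifting) mem_Collect_eq sum.neutral)
  define M' where "M' = M - replicate_mset k x"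
  have M: "M = replicate_mset k x + M'"
    using x(1) by (simp add: M'_def count_le_replicate_mset_subset_eq subset_mset.add_diff_inverse)
  have IH: "size M' = sum_list nu" "card (set_mset M') \<le> length nu"
    "card (set_mset M') = length nu \<Longrightarrow> image_mset (count M') (mset_set (set_mset M')) = mset nu"
    using Cons.IH[OF x(2)[folded M'_def]] Cons.prems(2) by auto
  have set: "set_mset M = insert x (set_mset M')" using k by (simp add: M)
  have "image_mset (count M) (mset_set (set_mset M)) = mset (k # nu)"
    if "card (set_mset M) = length (k # nu)"
  proof -
    have x': "x \<notin># M'" using that IH(2) unfolding set by (auto simp: card_insert_if split: if_splits)
    then have "image_mset (count M') (mset_set (set_mset M')) = mset nu"
      using that IH(3) unfolding set by simp
    moreover have "image_mset (count M) (mset_set (set_mset M')) = image_mset (count M') (mset_set (set_mset M'))"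
      by (rule image_mset_cong) (use x' in \<open>auto simp: M\<close>)
    moreover have "count M x = k" using x' by (simp add: M not_in_iff)
    ultimately show ?thesis unfolding set using x' by simp
  qed
  moreover have "card (set_mset M) \<le> length (k # nu)"
    unfolding set using IH(2) by (simp add: card_insert_if)
  moreover have "size M = sum_list (k # nu)" using IH(1) by (simp add: M)
  ultimately show ?case by blast
qed

lemma power_sum_partition_nonneg: "0 \<notin> set nu \<Longrightarrow> power_sum_partition nu M \<ge> 0"
proof (induction nu arbitrary: M)
  case (Cons k nu)
  then have k: "k > 0" by simp
  show ?case
    using power_sum_mult[OF k, of "power_sum_partition nu" M] Cons
    by (auto simp: power_sum_partition_def intro!: sum_nonneg)
qed (simp add: power_sum_partition_def series_one_def)

text \<open>Different variables for different parts, starting with variable \<open>x\<close>.\<close>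

primrec distinct_monomial :: "nat \<Rightarrow> nat list \<Rightarrow> nat multiset" where
  "distinct_monomial x [] = {#}"
| "distinct_monomial x (k # nu) = replicate_mset k x + distinct_monomial (Suc x) nu"

lemma distinct_monomial_bound: "y \<in># distinct_monomial x nu \<Longrightarrow> x \<le> y"
  by (induction nu arbitrary: x) (auto split: if_splits dest: Suc_leD)

lemma card_distinct_monomial: "0 \<notin> set nu \<Longrightarrow> card (set_mset (distinct_monomial x nu)) = length nu"
proof (induction nu arbitrary: x)
  case (Cons k nu)
  have "x \<notin># distinct_monomial (Suc x) nu" using distinct_monomial_bound[of x "Suc x" nu] by auto
  then show ?case using Cons by simp
qed simp

lemma power_sum_partition_distinct_monomial:
  "0 \<notin> set nu \<Longrightarrow> power_sum_partition nu (distinct_monomial x nu) > 0"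
proof (induction nu arbitrary: x)
  case (Cons k nu)
  then have k: "k > 0" by simp
  let ?M = "distinct_monomial x (k # nu)"
  have "0 < power_sum_partition nu (?M - replicate_mset k x)" using Cons by simp
  also have "\<dots> \<le> (\<Sum>y | k \<le> count ?M y. power_sum_partition nu (?M - replicate_mset k y))"
  proof (rule member_le_sum[where f = "\<lambda>y. power_sum_partition nu (?M - replicate_mset k y)"])
    show "finite {y. k \<le> count ?M y}" by (rule finite_count_ge[OF k])
  qed (use Cons.prems in \<open>auto simp: power_sum_partition_nonneg\<close>)
  also have "\<dots> = power_sum_partition (k # nu) ?M"
    using power_sum_mult[OF k, of "power_sum_partition nu" ?M] by (simp add: power_sum_partition_def)
  finally show ?case .
qed (simp add: power_sum_partition_def series_one_def)

text \<open>Among the partitions with nonzero coefficient take one, \<open>\<nu>\<close>, with as many parts as possible. The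
  monomial with exponents \<open>\<nu>\<close> in distinct variables occurs in \<open>p\<^sub>\<nu>\<close> but in no other \<open>p\<close> involved.\<close>

theorem power_sums_independent:
  fixes e :: "nat list \<Rightarrow> rat"
  assumes zero: "\<And>M. (\<Sum>nu\<in>partitions_of n. e nu * power_sum_partition nu M) = 0"
    and nu: "nu \<in> partitions_of n"
  shows "e nu = 0"
proof (rule ccontr)
  assume "e nu \<noteq> 0"
  define X where "X = {nu \<in> partitions_of n. e nu \<noteq> 0}"
  have X: "finite X" "nu \<in> X" using nu \<open>e nu \<noteq> 0\<close> by (auto simp: X_def finite_partitions_of)
  define k where "k = Max (length ` X)"
  have "k \<in> length ` X" unfolding k_def using X by (intro Max_in) auto
  then obtain nu0 where nu0: "nu0 \<in> X" "length nu0 = k" by auto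
  have max: "length nu \<le> length nu0" if "nu \<in> X" for nu
    using that X(1) nu0(2) by (simp add: k_def)
  have pos: "0 \<notin> set nu0" using nu0 by (auto simp: X_def partitions_of_def is_partition_def)
  let ?M = "distinct_monomial 0 nu0"
  have "power_sum_partition nu ?M = 0" if "nu \<in> X - {nu0}" for nu
  proof (rule ccontr)
    assume ne: "power_sum_partition nu ?M \<noteq> 0"
    have parts: "is_partition nu" "is_partition nu0" "0 \<notin> set nu"
      using that nu0 by (auto simp: X_def partitions_of_def is_partition_def)
    have "length nu0 \<le> length nu"
      using power_sum_partition_support[OF ne parts(3)] card_distinct_monomial[OF pos] by simp
    then have "length nu = length nu0" using max that by (simp add: le_antisym)
    then have "mset nu = image_mset (count ?M) (mset_set (set_mset ?M))"
      using power_sum_partition_support[OF ne parts(3)] card_distinct_monomial[OF pos] by simp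
    moreover have "mset nu0 = image_mset (count ?M) (mset_set (set_mset ?M))"
      using power_sum_partition_support[of nu0 ?M] power_sum_partition_distinct_monomial[OF pos, of 0]
        card_distinct_monomial[OF pos, of 0] pos by simp
    ultimately have "nu = nu0" using partition_eq_of_mset parts by simp
    then show False using that by simp
  qed
  then have "(\<Sum>nu\<in>partitions_of n. e nu * power_sum_partition nu ?M) = (\<Sum>nu\<in>{nu0}. e nu * power_sum_partition nu ?M)"
    by (intro sum.mono_neutral_right) (use nu0 in \<open>auto simp: X_def finite_partitions_of\<close>)
  then have "e nu0 * power_sum_partition nu0 ?M = 0" using zero[of ?M] by simp
  then show False using nu0 power_sum_partition_distinct_monomial[OF pos, of 0] by (simp add: X_def)
qed

section \<open>Operators for the major index\<close>

text \<open>The weights of inclusion-exclusion over descent sets: a tableau of size \<open>n\<close> is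
  counted once for each \<open>p\<close> such that its entries above \<open>p\<close> form a run without descents,
  and these weights correct for the repetition.\<close>

definition maj_weight :: "'a::field_char_0 \<Rightarrow> nat \<Rightarrow> nat \<Rightarrow> 'a" where
  "maj_weight q n p = q ^ p * (\<Prod>s\<in>{p<..<n}. 1 - q ^ s)"

text \<open>Here \<open>S\<close> is the descent set of a tableau of size \<open>n\<close>. The admissible \<open>p\<close> are those from the last
  descent on, and the sum telescopes.\<close>

lemma maj_weight_sum:
  assumes "S \<subseteq> {1..<n}" "n > 0"
  shows "(\<Sum>p | p < n \<and> S \<inter> {p<..<n} = {}. maj_weight q n p * q ^ \<Sum>(S \<inter> {..<p})) = q ^ \<Sum>S"
  using assms(2,1)
proof (induction n arbitrary: S rule: nat_induct_non_zero)
  case 1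
  have "{p. p < 1 \<and> S \<inter> {p<..<1} = {}} = {0}" using 1 by auto
  then show ?case using 1 by (simp add: maj_weight_def)
next
  case (Suc n)
  have fin: "finite S" using Suc.prems finite_subset by blast
  show ?case
  proof (cases "n \<in> S")
    case True
    then have "{p. p < Suc n \<and> S \<inter> {p<..<Suc n} = {}} = {n}"
      by (auto simp: less_Suc_eq)
    moreover have "S - {n} = S \<inter> {..<n}" using Suc.prems True by auto
    then have "\<Sum>S = n + \<Sum>(S \<inter> {..<n})"
      using sum.remove[OF fin True, of "\<lambda>x. x"] by simp
    moreover have "{n<..<Suc n} = {}" by auto
    ultimately show ?thesis by (simp add: maj_weight_def power_add)
  next
    case False
    then have S: "S \<subseteq> {1..<n}" using Suc.prems by (auto simp: less_Suc_eq)
    let ?P = "{p. p < n \<and> S \<inter> {p<..<n} = {}}"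
    have "{p. p < Suc n \<and> S \<inter> {p<..<Suc n} = {}} = insert n ?P"
      using False by (auto simp: less_Suc_eq)
    moreover have "maj_weight q (Suc n) p = (1 - q ^ n) * maj_weight q n p" if "p < n" for p
    proof -
      have "{p<..<Suc n} = insert n {p<..<n}" using that by auto
      then show ?thesis by (simp add: maj_weight_def)
    qed
    moreover have "S \<inter> {..<n} = S" using S by auto
    moreover have "{n<..<Suc n} = {}" by auto
    then have "maj_weight q (Suc n) n = q ^ n" by (simp add: maj_weight_def)
    ultimately have "(\<Sum>p | p < Suc n \<and> S \<inter> {p<..<Suc n} = {}. maj_weight q (Suc n) p * q ^ \<Sum>(S \<inter> {..<p}))
        = q ^ n * q ^ \<Sum>S + (\<Sum>p\<in>?P. (1 - q ^ n) * (maj_weight q n p * q ^ \<Sum>(S \<inter> {..<p})))"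
      by (simp add: mult.assoc)
    also have "\<dots> = q ^ \<Sum>S"
      unfolding sum_distrib_left[symmetric] Suc.IH[OF S] by (simp add: algebra_simps)
    finally show ?thesis .
  qed
qed

lemma maj_weight_sum_1: "n > 0 \<Longrightarrow> (\<Sum>p<n. maj_weight q n p) = 1"
  using maj_weight_sum[of "{}" n q] by (simp add: lessThan_def)

text \<open>The operator \<open>(1 - q) \<dots> (1 - q\<^sup>n) h\<^sub>n[X / (1 - q)]\<close> applied to \<open>F\<close>, without denominators and hence
  meaningful at roots of unity.\<close>

function maj_operator ::
    "nat \<Rightarrow> 'a::field_char_0 \<Rightarrow> ((nat \<Rightarrow> int) \<Rightarrow> 'a) \<Rightarrow> nat \<Rightarrow> (nat \<Rightarrow> int) \<Rightarrow> 'a" where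
  "maj_operator N q F n = (if n = 0 then F
     else (\<lambda>l. \<Sum>p\<in>{..<n}. maj_weight q n p * h_op N (n - p) (maj_operator N q F p) l))"
  by pat_completeness auto
termination by (relation "measure (\<lambda>(N, q, F, n). n)") auto

declare maj_operator.simps [simp del]

lemma alternating_sum:
  "(\<And>x. x \<in> A \<Longrightarrow> alternating N (G x)) \<Longrightarrow> alternating N (\<lambda>l. \<Sum>x\<in>A. u x * G x l)"
  by (simp add: alternating_def sum_negf)

lemma supported_sum:
  assumes "\<And>x. x \<in> A \<Longrightarrow> supported N (G x)" shows "supported N (\<lambda>l. \<Sum>x\<in>A. u x * G x l)"
  unfolding supported_def
proof (intro allI impI)
  fix l i assume "(\<Sum>x\<in>A. u x * G x l) \<noteq> 0" "i < N"
  then obtain x where x: "x \<in> A" "u x * G x l \<noteq> 0"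
    using sum.not_neutral_contains_not_neutral by blast
  then have "G x l \<noteq> 0" by simp
  with assms[OF x(1)] \<open>i < N\<close> show "- int N < l i" by (simp add: supported_def)
qed

lemma alternating_maj_operator: "alternating N F \<Longrightarrow> alternating N (maj_operator N q F n)"
proof (induction n rule: less_induct)
  case (less n)
  show ?case
  proof (cases "n = 0")
    case False
    then have eq: "maj_operator N q F n
        = (\<lambda>l. \<Sum>p<n. maj_weight q n p * h_op N (n - p) (maj_operator N q F p) l)"
      by (subst maj_operator.simps) simp
    show ?thesis unfolding eq by (rule alternating_sum, rule alternating_h_op) (use less in simp)
  qed (use less.prems in \<open>simp add: maj_operator.simps\<close>)
qed

lemma supported_maj_operator: "supported N F \<Longrightarrow> supported N (maj_operator N q F n)"
proof (induction n rule: less_induct)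
  case (less n)
  show ?case
  proof (cases "n = 0")
    case False
    then have eq: "maj_operator N q F n
        = (\<lambda>l. \<Sum>p<n. maj_weight q n p * h_op N (n - p) (maj_operator N q F p) l)"
      by (subst maj_operator.simps) simp
    show ?thesis unfolding eq by (rule supported_sum, rule supported_h_op) (use less in simp)
  qed (use less.prems in \<open>simp add: maj_operator.simps\<close>)
qed

section \<open>Standard tableaux\<close>

definition standard :: "(nat \<Rightarrow> nat) \<Rightarrow> (nat \<Rightarrow> nat) \<Rightarrow> (nat \<times> nat \<Rightarrow> nat) set" where
  "standard f g = {T \<in> extensional (boxes f - boxes g).
     bij_betw T (boxes f - boxes g) {1..card (boxes f - boxes g)} \<and>
     rows_strictly_increasing (boxes f - boxes g) T \<and>
     columns_strictly_increasing (boxes f - boxes g) T}"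

definition tableau_descents :: "(nat \<times> nat) set \<Rightarrow> (nat \<times> nat \<Rightarrow> nat) \<Rightarrow> nat set" where
  "tableau_descents D T = {k \<in> {1..<card D}. \<exists>a\<in>D. \<exists>b\<in>D. T a = k \<and> T b = k + 1 \<and> fst a < fst b}"

text \<open>In a horizontal strip every column has at most one box. The filling without descents numbers its
  boxes from left to right.\<close>

definition column_rank :: "(nat \<times> nat) set \<Rightarrow> nat \<times> nat \<Rightarrow> nat" where
  "column_rank S b = card {b' \<in> S. snd b' \<le> snd b}"

lemma rows_strictly_imp_weakly:
  "rows_strictly_increasing D T \<Longrightarrow> rows_weakly_increasing D T"
  unfolding rows_strictly_increasing_def rows_weakly_increasing_def by (meson less_imp_le)

lemma rows_strictly_subset:
  "rows_strictly_increasing D T \<Longrightarrow> E \<subseteq> D \<Longrightarrow> rows_strictly_increasing E (restrict T E)"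
  by (auto simp: rows_strictly_increasing_def subset_eq)

lemma finite_standard: "shape N f \<Longrightarrow> finite (standard f g)"
  by (rule finite_subset[OF _ finite_fillings[of "boxes f - boxes g" "{1..card (boxes f - boxes g)}"]])
    (auto simp: standard_def finite_boxes_diff bij_betw_def)

lemma card_boxes_split:
  assumes f: "shape N f" and h: "shape N h" "g \<le> h" "h \<le> f"
  shows "card (boxes f - boxes g) = card (boxes f - boxes h) + card (boxes h - boxes g)"
proof -
  have "boxes g \<subseteq> boxes h" "boxes h \<subseteq> boxes f" using h by (simp_all add: boxes_subset_iff)
  then have split: "boxes f - boxes g = (boxes f - boxes h) \<union> (boxes h - boxes g)" by auto
  show ?thesis unfolding split
    by (rule card_Un_disjoint) (use finite_boxes_diff[OF f] finite_boxes_diff[OF h(1)] in auto)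
qed

text \<open>Without descents the entries above \<open>p\<close> move weakly upwards row by row. This rules out two of them
  in one column and makes them increase from left to right, so that they are determined
  by the strip that they fill.\<close>

lemma standard_cut:
  assumes f: "shape N f" and gh: "g \<le> h" and hf: "h \<le> f" and h: "shape N h"
    and T: "T \<in> standard f g" and n: "n = card (boxes f - boxes g)" and p: "p < n"
    and run: "tableau_descents (boxes f - boxes g) T \<inter> {p<..<n} = {}"
    and iff: "\<And>b. b \<in> boxes f - boxes g \<Longrightarrow> b \<in> boxes h \<longleftrightarrow> T b < Suc p"
  shows "h \<in> horizontal_strips N (n - p) f" "restrict T (boxes h - boxes g) \<in> standard h g"
    "\<And>b. b \<in> boxes f - boxes h \<Longrightarrow> T b = p + column_rank (boxes f - boxes h) b"
proof -
  let ?D = "boxes f - boxes g" and ?E = "boxes h - boxes g" and ?S = "boxes f - boxes h"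
  have sub: "boxes g \<subseteq> boxes h" "boxes h \<subseteq> boxes f" using gh hf by (simp_all add: boxes_subset_iff)
  have bij: "bij_betw T ?D {1..n}" and rows: "rows_strictly_increasing ?D T"
    and cols: "columns_strictly_increasing ?D T" using T n by (auto simp: standard_def)
  have E: "?E = {b \<in> ?D. T b \<le> p}" using iff sub by (auto simp: less_Suc_eq_le)
  have S: "b \<in> ?S \<longleftrightarrow> b \<in> ?D \<and> p < T b" for b
    using iff[of b] sub by (cases "b \<in> ?D") (auto simp: not_less less_Suc_eq_le)
  have rng: "1 \<le> T b \<and> T b \<le> n" if "b \<in> ?D" for b
    using bij that by (auto simp: bij_betw_def)
  have bijE: "bij_betw T ?E {1..p}"
  proof (rule bij_betw_subset[OF bij])
    show "?E \<subseteq> ?D" using sub by auto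
    show "T ` ?E = {1..p}"
    proof
      show "T ` ?E \<subseteq> {1..p}" using rng unfolding E by auto
      show "{1..p} \<subseteq> T ` ?E"
      proof
        fix k assume k: "k \<in> {1..p}"
        then have "k \<in> T ` ?D" using bij p by (auto simp: bij_betw_def)
        then show "k \<in> T ` ?E" using k unfolding E by auto
      qed
    qed
  qed
  have cardE: "card ?E = p" using bij_betw_same_card[OF bijE] by simp
  have "?E \<subseteq> ?D" using sub by auto
  then show "restrict T ?E \<in> standard h g"
    using rows_strictly_subset[OF rows] columns_strictly_subset[OF cols] bijE cardE
    by (simp add: standard_def)
  have run_step: "fst c \<le> fst b"
    if b: "b \<in> ?S" and k: "T b \<le> k" "k \<le> n" and c: "c \<in> ?D" "T c = k" for b c k
    using k c
  proof (induction k arbitrary: c rule: dec_induct)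
    case base
    then have "c = b" using bij b S[of b] by (auto simp: bij_betw_def inj_on_def)
    then show ?case by simp
  next
    case (step k)
    have kn: "p < k" "k < n" using step.hyps step.prems b S[of b] by auto
    then have "k \<in> T ` ?D" using bij by (auto simp: bij_betw_def)
    then obtain a where a: "a \<in> ?D" "T a = k" by auto
    have "fst a \<le> fst b" using step.IH[OF _ a] kn by simp
    moreover have "k \<notin> tableau_descents ?D T" using run kn by auto
    then have "\<not> fst a < fst c"
      using a kn step.prems n unfolding tableau_descents_def by auto
    ultimately show ?case by simp
  qed
  have run_rows: "fst b' \<le> fst b" if "b \<in> ?S" "b' \<in> ?S" "T b \<le> T b'" for b b'
    using run_step[OF that(1,3)] that(2) S[of b'] rng[of b'] by blast
  show hs: "h \<in> horizontal_strips N (n - p) f"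
  proof (rule horizontal_stripI[OF f h hf])
    show "card ?S = n - p" using card_boxes_split[OF f h gh hf] cardE n by simp
    fix i j assume ij: "(i, j) \<in> ?S" "(Suc i, j) \<in> ?S"
    then have "T (i, j) < T (Suc i, j)"
      using cols S unfolding columns_strictly_increasing_def by blast
    then show False using run_rows[OF ij] by simp
  qed
  have mono: "snd b < snd b'" if b: "b \<in> ?S" "b' \<in> ?S" "T b < T b'" for b b'
  proof (cases "fst b' = fst b")
    case True
    show ?thesis
    proof (rule ccontr)
      assume "\<not> snd b < snd b'"
      then consider "snd b = snd b'" | "snd b' < snd b" by linarith
      then show False
      proof cases
        case 1
        then have "b = b'" using True by (simp add: prod_eq_iff)
        then show False using b by simp
      next
        case 2
        then have "T b' < T b"
          using rows b True S unfolding rows_strictly_increasing_def by (metis prod.collapse)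
        then show False using b by simp
      qed
    qed
  next
    case False
    then have "fst b' < fst b" using run_rows[of b b'] b by simp
    then show ?thesis
      using horizontal_strip_columns[OF f hs, of "fst b'" "snd b'" "fst b" "snd b"] b by simp
  qed
  fix b assume b: "b \<in> ?S"
  have "T b' \<le> T b \<longleftrightarrow> snd b' \<le> snd b" if b': "b' \<in> ?S" for b'
  proof -
    consider "T b' < T b" | "T b' = T b" | "T b < T b'" by linarith
    then show ?thesis
    proof cases
      case 2
      then have "b' = b" using bij S[of b] S[of b'] b b' unfolding bij_betw_def inj_on_def by blast
      then show ?thesis by simp
    next
      case 1
      then show ?thesis using mono[OF b' b 1] by simp
    next
      case 3
      then show ?thesis using mono[OF b b' 3] by simp
    qed
  qed
  then have eq: "{b' \<in> ?S. snd b' \<le> snd b} = {b' \<in> ?S. T b' \<le> T b}" by blast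
  have Sb: "{b' \<in> ?S. T b' \<le> T b} = {b' \<in> ?D. p < T b' \<and> T b' \<le> T b}" using S by blast
  have im: "T ` {b' \<in> ?S. T b' \<le> T b} = {p<..T b}"
  proof
    show "T ` {b' \<in> ?S. T b' \<le> T b} \<subseteq> {p<..T b}" unfolding Sb by auto
    show "{p<..T b} \<subseteq> T ` {b' \<in> ?S. T b' \<le> T b}"
    proof
      fix k assume k: "k \<in> {p<..T b}"
      then have "k \<in> {1..n}" using rng[of b] b S[of b] by auto
      then have "k \<in> T ` ?D" using bij by (simp add: bij_betw_def)
      then obtain c where "c \<in> ?D" "T c = k" by blast
      then show "k \<in> T ` {b' \<in> ?S. T b' \<le> T b}" unfolding Sb using k by auto
    qed
  qed
  have "inj_on T {b' \<in> ?S. T b' \<le> T b}"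
    unfolding Sb using bij unfolding bij_betw_def by (auto intro: inj_on_subset)
  then have "card {b' \<in> ?S. T b' \<le> T b} = T b - p"
    using card_image[of T "{b' \<in> ?S. T b' \<le> T b}"] unfolding im by simp
  then have "column_rank ?S b = T b - p" unfolding column_rank_def eq .
  moreover have "p < T b" using b S by blast
  ultimately show "T b = p + column_rank ?S b" by simp
qed

lemma standard_paste:
  assumes f: "shape N f" and gh: "g \<le> h" and hs: "h \<in> horizontal_strips N (n - p) f"
    and T: "T \<in> standard h g" and n: "n = card (boxes f - boxes g)" and p: "p < n"
  defines "u \<equiv> \<lambda>b. p + column_rank (boxes f - boxes h) b"
  defines "G \<equiv> glue f h T u"
  shows "G \<in> standard f g" "\<And>b. b \<in> boxes h - boxes g \<Longrightarrow> T b < Suc p"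
    "\<And>b. b \<in> boxes f - boxes h \<Longrightarrow> Suc p \<le> u b"
    "tableau_descents (boxes f - boxes g) G \<inter> {p<..<n} = {}"
    "tableau_descents (boxes f - boxes g) G \<inter> {..<p} = tableau_descents (boxes h - boxes g) T"
proof -
  let ?D = "boxes f - boxes g" and ?E = "boxes h - boxes g" and ?S = "boxes f - boxes h"
  note h = horizontal_strip_shape[OF f hs]
  have sub: "boxes g \<subseteq> boxes h" "boxes h \<subseteq> boxes f" using gh h by (simp_all add: boxes_subset_iff)
  have D: "?D = ?E \<union> ?S" using sub by auto
  have cardE: "card ?E = p" using card_boxes_split[OF f h(1) gh h(2)] h(3) n p by simp
  have bijT: "bij_betw T ?E {1..p}" and rows: "rows_strictly_increasing ?E T"
    and cols: "columns_strictly_increasing ?E T" using T cardE by (auto simp: standard_def)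
  have finS: "finite ?S" by (rule finite_boxes_diff[OF f])
  have rngT: "1 \<le> T b \<and> T b \<le> p" if "b \<in> ?E" for b using bijT that by (auto simp: bij_betw_def)
  then show lt: "\<And>b. b \<in> ?E \<Longrightarrow> T b < Suc p" by (simp add: less_Suc_eq_le)
  have u_mono: "u b < u b'" if "b' \<in> ?S" "snd b < snd b'" for b b'
  proof -
    have "{c \<in> ?S. snd c \<le> snd b} \<subset> {c \<in> ?S. snd c \<le> snd b'}" using that by force
    then have "card {c \<in> ?S. snd c \<le> snd b} < card {c \<in> ?S. snd c \<le> snd b'}"
      by (rule psubset_card_mono[rotated]) (rule finite_subset[OF _ finS], blast)
    then show ?thesis unfolding u_def column_rank_def by linarith
  qed
  have u_rng: "Suc p \<le> u b \<and> u b \<le> n" if "b \<in> ?S" for b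
  proof -
    have sub: "{b' \<in> ?S. snd b' \<le> snd b} \<subseteq> ?S" by blast
    have "card {b' \<in> ?S. snd b' \<le> snd b} \<le> card ?S" by (rule card_mono[OF finS sub])
    moreover have "b \<in> {b' \<in> ?S. snd b' \<le> snd b}" using that by blast
    then have "card {b' \<in> ?S. snd b' \<le> snd b} > 0"
      using finite_subset[OF sub finS] card_gt_0_iff by blast
    ultimately show ?thesis using h(3) p by (simp add: u_def column_rank_def)
  qed
  then show "\<And>b. b \<in> ?S \<Longrightarrow> Suc p \<le> u b" by blast
  have S_col: "snd b' < snd b" if "b \<in> ?S" "b' \<in> ?S" "fst b < fst b'" for b b'
    using horizontal_strip_columns[OF f hs, of "fst b" "snd b" "fst b'" "snd b'"] that by simp
  have "inj_on u ?S"
  proof (rule inj_onI, rule ccontr)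
    fix b b' assume b: "b \<in> ?S" "b' \<in> ?S" "u b = u b'" "b \<noteq> b'"
    then have "snd b = snd b'" using u_mono[of b b'] u_mono[of b' b] by (metis less_irrefl linorder_neqE_nat)
    then have "fst b \<noteq> fst b'" using b(4) by (simp add: prod_eq_iff)
    then show False using S_col[of b b'] S_col[of b' b] b \<open>snd b = snd b'\<close> by (metis less_irrefl linorder_neqE_nat)
  qed
  moreover have "u ` ?S \<subseteq> {Suc p..n}" using u_rng by auto
  ultimately have biju: "bij_betw u ?S {Suc p..n}"
    unfolding bij_betw_def using h(3) p by (metis card_image card_subset_eq finite_atLeastAtMost card_atLeastAtMost diff_Suc_Suc)
  have GE: "G b = T b" if "b \<in> ?E" for b using that by (simp add: G_def glue_def)
  have GS: "G b = u b" if "b \<in> ?S" for b using that by (simp add: G_def glue_def)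
  have "bij_betw G ?E {1..p}" using bijT bij_betw_cong[of ?E G T "{1..p}"] GE by blast
  moreover have "bij_betw G ?S {Suc p..n}" using biju bij_betw_cong[of ?S G u "{Suc p..n}"] GS by blast
  ultimately have "bij_betw G (?E \<union> ?S) ({1..p} \<union> {Suc p..n})"
    by (rule bij_betw_combine) auto
  moreover have "{1..p} \<union> {Suc p..n} = {1..n}" using p by auto
  ultimately have bij: "bij_betw G ?D {1..n}" by (simp add: D)
  have ext: "G \<in> extensional ?D"
    unfolding G_def by (rule glue_extensional[OF _ gh h(2)]) (use T in \<open>simp add: standard_def\<close>)
  have lt': "\<forall>b\<in>?E. T b < Suc p" "\<forall>b\<in>?S. Suc p \<le> u b" using lt u_rng by auto
  note cases = glue_cases[OF h(1) gh h(2) lt', folded G_def]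
  have "rows_strictly_increasing ?D G"
    unfolding rows_strictly_increasing_def
  proof (intro allI impI)
    fix i j j' assume ij: "(i, j) \<in> ?D" "(i, j') \<in> ?D" "j < j'"
    from cases[of i j i j'] ij consider
        "(i, j) \<in> ?E" "(i, j') \<in> ?E" "G (i, j) = T (i, j)" "G (i, j') = T (i, j')"
      | "(i, j') \<in> ?S" "G (i, j) = u (i, j)" "G (i, j') = u (i, j')" | "G (i, j) < G (i, j')" by auto
    then show "G (i, j) < G (i, j')"
      by cases (use rows ij u_mono[of "(i, j')" "(i, j)"] in \<open>auto simp: rows_strictly_increasing_def\<close>)
  qed
  moreover have "columns_strictly_increasing ?D G"
    unfolding columns_strictly_increasing_def
  proof (intro allI impI)
    fix i i' j assume ij: "(i, j) \<in> ?D" "(i', j) \<in> ?D" "i < i'"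
    from cases[of i j i' j] ij consider
        "(i, j) \<in> ?E" "(i', j) \<in> ?E" "G (i, j) = T (i, j)" "G (i', j) = T (i', j)"
      | "(i, j) \<in> ?S" "(i', j) \<in> ?S" | "G (i, j) < G (i', j)" by auto
    then show "G (i, j) < G (i', j)"
      by cases (use cols ij S_col[of "(i, j)" "(i', j)"] in \<open>auto simp: columns_strictly_increasing_def\<close>)
  qed
  ultimately show "G \<in> standard f g" using ext bij n by (simp add: standard_def)
  have inS: "b \<in> ?S" if "b \<in> ?D" "p < G b" for b
    using that GE[of b] rngT[of b] unfolding D by auto
  have inE: "b \<in> ?E" if "b \<in> ?D" "G b \<le> p" for b
    using that GS[of b] u_rng[of b] unfolding D by auto
  show "tableau_descents ?D G \<inter> {p<..<n} = {}"
  proof (rule ccontr)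
    assume "\<not> ?thesis"
    then obtain k where kd: "p < k" "k \<in> tableau_descents ?D G" by auto
    then obtain a b where k: "a \<in> ?D" "b \<in> ?D" "G a = k" "G b = k + 1" "fst a < fst b"
      unfolding tableau_descents_def by blast
    then have "a \<in> ?S" "b \<in> ?S" using inS[of a] inS[of b] kd(1) by auto
    then have "u b < u a" using S_col[of a b] u_mono[of a b] k by blast
    then show False using GS \<open>a \<in> ?S\<close> \<open>b \<in> ?S\<close> k by simp
  qed
  show "tableau_descents ?D G \<inter> {..<p} = tableau_descents ?E T"
  proof (intro set_eqI iffI)
    fix k assume k: "k \<in> tableau_descents ?D G \<inter> {..<p}"
    then obtain a b where ab: "a \<in> ?D" "b \<in> ?D" "G a = k" "G b = k + 1" "fst a < fst b"
      unfolding tableau_descents_def by blast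
    then have "a \<in> ?E" "b \<in> ?E" using inE k by auto
    with ab k GE show "k \<in> tableau_descents ?E T"
      unfolding tableau_descents_def cardE by auto
  next
    fix k assume k: "k \<in> tableau_descents ?E T"
    then obtain a b where ab: "a \<in> ?E" "b \<in> ?E" "T a = k" "T b = k + 1" "fst a < fst b"
      unfolding tableau_descents_def by blast
    then have "a \<in> ?D" "b \<in> ?D" "G a = k" "G b = k + 1" using GE D by auto
    moreover have "1 \<le> k" "k < p" using k unfolding tableau_descents_def cardE by auto
    ultimately show "k \<in> tableau_descents ?D G \<inter> {..<p}"
      using ab p n unfolding tableau_descents_def by auto
  qed
qed

text \<open>The recursion of \<open>maj_operator\<close> sums over the size \<open>p\<close> of what remains when a horizontal strip is
  removed. This strip together with its filling by increasing columns is a final run without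
  descents, so each tableau occurs once for each admissible \<open>p\<close>, with total weight
  \<open>q\<close> to the major index.\<close>

theorem maj_operator_standard:
  assumes g: "shape N g" and f: "shape N f"
  shows "maj_operator N q (alternating_delta N g) n (beads f) =
    (if g \<le> f \<and> card (boxes f - boxes g) = n
     then \<Sum>T\<in>standard f g. q ^ \<Sum>(tableau_descents (boxes f - boxes g) T) else 0)"
  using f
proof (induction n arbitrary: f rule: less_induct)
  case (less n)
  let ?D = "boxes f - boxes g"
  let ?maj = "\<lambda>f T. \<Sum>(tableau_descents (boxes f - boxes g) T)"
  have finD: "finite ?D" by (rule finite_boxes_diff[OF less.prems])
  show ?case
  proof (cases "n = 0")
    case True
    have "g \<le> f \<and> card ?D = 0 \<longleftrightarrow> f = g"
    proof
      assume "g \<le> f \<and> card ?D = 0"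
      then have "boxes f \<subseteq> boxes g" using finD by simp
      then show "f = g" using \<open>g \<le> f \<and> card ?D = 0\<close> by (simp add: boxes_subset_iff)
    qed simp
    moreover have "standard g g = {\<lambda>_. undefined}"
      by (auto simp: standard_def rows_strictly_increasing_def columns_strictly_increasing_def bij_betw_def)
    ultimately show ?thesis using True
      by (auto simp: maj_operator.simps alternating_delta_beads[OF less.prems g] tableau_descents_def)
  next
    case False
    let ?F = "maj_operator N q (alternating_delta N g)"
    let ?H = "\<lambda>p. horizontal_strips N (n - p) f"
    have finH: "finite (?H p)" for p
      by (rule finite_subset[OF _ finite_shapes_below[OF less.prems]])
        (use horizontal_strip_shape[OF less.prems] in blast)
    have "?F n (beads f) = (\<Sum>p<n. maj_weight q n p * h_op N (n - p) (?F p) (beads f))"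
      using False by (subst maj_operator.simps) simp
    also have "\<dots> = (\<Sum>p<n. maj_weight q n p * (\<Sum>h\<in>?H p. ?F p (beads h)))"
      by (simp add: Pieri[OF alternating_maj_operator[OF alternating_delta_alternating]
          supported_maj_operator[OF alternating_delta_supported[OF g]] less.prems])
    also have "\<dots> = (\<Sum>p<n. maj_weight q n p * (\<Sum>h\<in>?H p. if g \<le> h \<and> card (boxes h - boxes g) = p
        then \<Sum>T\<in>standard h g. q ^ ?maj h T else 0))"
    proof (intro sum.cong refl arg_cong2[where f = "(*)"])
      fix p h assume p: "p \<in> {..<n}" and h: "h \<in> ?H p"
      have "shape N h" by (rule horizontal_strip_shape(1)[OF less.prems h])
      then show "?F p (beads h) = (if g \<le> h \<and> card (boxes h - boxes g) = p
          then \<Sum>T\<in>standard h g. q ^ ?maj h T else 0)" using less.IH p by simp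
    qed
    finally have expand: "?F n (beads f) = \<dots>" .
    have split: "card ?D = n - p + card (boxes h - boxes g) \<and> g \<le> f"
      if "h \<in> ?H p" "g \<le> h" for p h
      using card_boxes_split[OF less.prems horizontal_strip_shape(1)[OF less.prems that(1)] that(2)
          horizontal_strip_shape(2)[OF less.prems that(1)]]
        horizontal_strip_shape(2,3)[OF less.prems that(1)] that(2) order_trans[of g h f] by simp
    show ?thesis
    proof (cases "g \<le> f \<and> card ?D = n")
      case False
      then have "\<not> (g \<le> h \<and> card (boxes h - boxes g) = p)" if "p < n" "h \<in> ?H p" for p h
        using split[OF that(2)] that(1) by auto
      then have "(\<Sum>h\<in>?H p. if g \<le> h \<and> card (boxes h - boxes g) = p
          then \<Sum>T\<in>standard h g. q ^ ?maj h T else 0) = 0" if "p < n" for p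
        using that by (intro sum.neutral) auto
      then have "?F n (beads f) = 0" unfolding expand by (intro sum.neutral ballI) simp
      then show ?thesis by (simp only: False if_False)
    next
      case True
      then have gf: "g \<le> f" and n: "n = card ?D" by auto
      have part: "(\<Sum>T | T \<in> standard f g \<and> tableau_descents ?D T \<inter> {p<..<n} = {}.
            q ^ \<Sum>(tableau_descents ?D T \<inter> {..<p}))
          = (\<Sum>h\<in>?H p. if g \<le> h \<and> card (boxes h - boxes g) = p
              then \<Sum>T\<in>standard h g. q ^ ?maj h T else 0)" if p: "p < n" for p
      proof -
        let ?u = "\<lambda>h b. p + column_rank (boxes f - boxes h) b"
        have "(\<Sum>T | T \<in> standard f g \<and> tableau_descents ?D T \<inter> {p<..<n} = {}.
            q ^ \<Sum>(tableau_descents ?D T \<inter> {..<p}))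
          = (\<Sum>h\<in>{h \<in> ?H p. g \<le> h}. \<Sum>T\<in>standard h g.
              q ^ \<Sum>(tableau_descents ?D (glue f h T (?u h)) \<inter> {..<p}))"
        proof (rule sum_over_tableaux[OF less.prems g gf, where x = "Suc p" and u = ?u
              and B = "\<lambda>h. standard h g"
              and w = "\<lambda>T. q ^ \<Sum>(tableau_descents ?D T \<inter> {..<p})"])
          fix T assume "T \<in> {T \<in> standard f g. tableau_descents ?D T \<inter> {p<..<n} = {}}"
          then show "T \<in> extensional ?D \<and> rows_weakly_increasing ?D T \<and> columns_weakly_increasing ?D T"
            by (simp add: standard_def rows_strictly_imp_weakly columns_strictly_imp_weakly)
        next
          fix h assume h: "h \<in> {h \<in> ?H p. g \<le> h}"
          then have hp: "h \<in> ?H p" by simp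
          note hs = horizontal_strip_shape[OF less.prems hp]
          show "shape N h \<and> g \<le> h \<and> h \<le> f" using h hs by simp
          show "finite (standard h g) \<and> standard h g \<subseteq> extensional (boxes h - boxes g)"
            using finite_standard[OF hs(1)] by (simp add: standard_def Collect_mono_iff)
        next
          fix T h assume T: "T \<in> {T \<in> standard f g. tableau_descents ?D T \<inter> {p<..<n} = {}}"
            and h: "shape N h" "g \<le> h" "h \<le> f" "\<And>b. b \<in> ?D \<Longrightarrow> b \<in> boxes h \<longleftrightarrow> T b < Suc p"
          have T': "T \<in> standard f g" "tableau_descents ?D T \<inter> {p<..<n} = {}" using T by auto
          show "h \<in> {h \<in> ?H p. g \<le> h} \<and> restrict T (boxes h - boxes g) \<in> standard h g \<and>
              (\<forall>b\<in>boxes f - boxes h. T b = ?u h b)"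
            using standard_cut[OF less.prems h(2,3,1) T'(1) n p T'(2) h(4)] h(2) by blast
        next
          fix T h assume h: "h \<in> {h \<in> ?H p. g \<le> h}" and T: "T \<in> standard h g"
          then have h': "g \<le> h" "h \<in> ?H p" by auto
          show "glue f h T (?u h) \<in> {T \<in> standard f g. tableau_descents ?D T \<inter> {p<..<n} = {}} \<and>
              (\<forall>b\<in>boxes h - boxes g. T b < Suc p) \<and> (\<forall>b\<in>boxes f - boxes h. Suc p \<le> ?u h b)"
            using standard_paste[OF less.prems h' T n p] by blast
        qed
        also have "\<dots> = (\<Sum>h\<in>{h \<in> ?H p. g \<le> h}. \<Sum>T\<in>standard h g. q ^ ?maj h T)"
        proof (intro sum.cong refl)
          fix T h assume h: "h \<in> {h \<in> ?H p. g \<le> h}" and T: "T \<in> standard h g"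
          then have h': "g \<le> h" "h \<in> ?H p" by auto
          show "q ^ \<Sum>(tableau_descents ?D (glue f h T (?u h)) \<inter> {..<p}) = q ^ ?maj h T"
            using standard_paste(5)[OF less.prems h' T n p] by simp
        qed
        also have "\<dots> = (\<Sum>h\<in>?H p. if g \<le> h then \<Sum>T\<in>standard h g. q ^ ?maj h T else 0)"
          by (rule sum.inter_filter[OF finH])
        also have "\<dots> = (\<Sum>h\<in>?H p. if g \<le> h \<and> card (boxes h - boxes g) = p
            then \<Sum>T\<in>standard h g. q ^ ?maj h T else 0)"
        proof (rule sum.cong[OF refl])
          fix h assume "h \<in> ?H p"
          then have "card (boxes h - boxes g) = p" if "g \<le> h"
            using split[of h p] that n p by linarith
          then show "(if g \<le> h then \<Sum>T\<in>standard h g. q ^ ?maj h T else 0)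
            = (if g \<le> h \<and> card (boxes h - boxes g) = p then \<Sum>T\<in>standard h g. q ^ ?maj h T else 0)"
            by simp
        qed
        finally show ?thesis .
      qed
      have finT: "finite (standard f g)" by (rule finite_standard[OF less.prems])
      have "?F n (beads f) = (\<Sum>p<n. maj_weight q n p *
          (\<Sum>T | T \<in> standard f g \<and> tableau_descents ?D T \<inter> {p<..<n} = {}.
            q ^ \<Sum>(tableau_descents ?D T \<inter> {..<p})))"
        unfolding expand by (intro sum.cong refl) (simp add: part)
      also have "\<dots> = (\<Sum>p<n. \<Sum>T\<in>standard f g. if tableau_descents ?D T \<inter> {p<..<n} = {}
          then maj_weight q n p * q ^ \<Sum>(tableau_descents ?D T \<inter> {..<p}) else 0)"
        unfolding sum_distrib_left by (rule sum.cong[OF refl], rule sum.inter_filter[OF finT])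
      also have "\<dots> = (\<Sum>T\<in>standard f g. \<Sum>p<n. if tableau_descents ?D T \<inter> {p<..<n} = {}
          then maj_weight q n p * q ^ \<Sum>(tableau_descents ?D T \<inter> {..<p}) else 0)"
        by (rule sum.swap)
      also have "\<dots> = (\<Sum>T\<in>standard f g. \<Sum>p | p < n \<and> tableau_descents ?D T \<inter> {p<..<n} = {}.
          maj_weight q n p * q ^ \<Sum>(tableau_descents ?D T \<inter> {..<p}))"
        by (rule sum.cong[OF refl], subst sum.inter_filter[OF finite_lessThan, symmetric])
          (simp only: lessThan_iff)
      also have "\<dots> = (\<Sum>T\<in>standard f g. q ^ ?maj f T)"
        by (intro sum.cong refl maj_weight_sum) (use n \<open>n \<noteq> 0\<close> in \<open>auto simp: tableau_descents_def\<close>)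
      finally show ?thesis using True by simp
    qed
  qed
qed

section \<open>Evaluation at a root of unity\<close>

text \<open>With \<open>e\<^sub>p\<close> the value \<open>G p\<close> divided by \<open>(1 - q) \<dots> (1 - q\<^sup>p)\<close>, the recursion states that the generating
  functions satisfy \<open>e(t) = H(t) e(q t)\<close>. Its logarithmic derivative is
  \<open>n e\<^sub>n = \<Sum>\<^sub>k p\<^sub>k e\<^bsub>n-k\<^esub> / (1 - q\<^sup>k)\<close>. Multiplied by \<open>1 - q\<^sup>n\<close> this still makes sense for
  \<open>n = m\<close>, where all terms but that for \<open>k = m\<close> vanish.\<close>

lemma maj_recursion_at_root_of_unity:
  fixes q :: "'a::field_char_0" and G :: "nat \<Rightarrow> (nat \<Rightarrow> int) \<Rightarrow> 'a"
  assumes q: "q ^ m = 1" "\<And>k. 0 < k \<Longrightarrow> k < m \<Longrightarrow> q ^ k \<noteq> 1" and m: "m > 0"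
    and G: "\<And>n l. 0 < n \<Longrightarrow> n \<le> m \<Longrightarrow> G n l = (\<Sum>p<n. maj_weight q n p * h_op N (n - p) (G p) l)"
  shows "of_nat m * G m l = (\<Prod>s\<in>{0<..<m}. 1 - q ^ s) * p_op N m (G 0) l"
proof -
  define qf where "qf n = (\<Prod>s\<in>{0<..<n}. 1 - q ^ s)" for n
  define e where "e p l = inverse (qf (Suc p)) * G p l" for p l
  \<comment> \<open>For \<open>n < m\<close> this is \<open>(1 - q\<^sup>n) e\<^sub>n\<close>, but unlike \<open>e\<^sub>n\<close> it is also defined for \<open>n = m\<close>.\<close>
  define X where "X n l = (\<Sum>p<n. q ^ p * h_op N (n - p) (e p) l)" for n l
  have qf: "qf n \<noteq> 0" if "n \<le> m" for n unfolding qf_def using q(2) that by auto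
  have qfS: "qf (Suc n) = (1 - q ^ n) * qf n" if "n > 0" for n
  proof -
    have "{0<..<Suc n} = insert n {0<..<n}" using that by auto
    then show ?thesis by (simp add: qf_def)
  qed
  have GX: "G n l = qf n * X n l" if n: "0 < n" "n \<le> m" for n l
  proof -
    have "maj_weight q n p * h_op N (n - p) (G p) l = qf n * (q ^ p * h_op N (n - p) (e p) l)"
      if p: "p < n" for p
    proof -
      have split: "{0<..<n} = {0<..<Suc p} \<union> {p<..<n}" using p by auto
      have "qf n = qf (Suc p) * (\<Prod>s\<in>{p<..<n}. 1 - q ^ s)"
        unfolding qf_def split by (rule prod.union_disjoint) auto
      moreover have "G p = (\<lambda>l. qf (Suc p) * e p l)" using qf[of "Suc p"] p n by (auto simp: e_def)
      then have "h_op N (n - p) (G p) l = qf (Suc p) * h_op N (n - p) (e p) l"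
        by (simp add: h_op_scale)
      ultimately show ?thesis by (simp add: maj_weight_def)
    qed
    then show ?thesis by (simp add: G[OF n] X_def sum_distrib_left)
  qed
  have Xe: "X n l = (1 - q ^ n) * e n l" if n: "n < m" for n l
  proof (cases "n = 0")
    case False
    then have "e n l = inverse (qf (Suc n)) * (qf n * X n l)" using GX[of n l] n by (simp add: e_def)
    moreover have "1 - q ^ n \<noteq> 0" "qf n \<noteq> 0" using q(2)[of n] qf[of n] False n by auto
    ultimately show ?thesis using qfS[of n] False by simp
  qed (simp add: X_def)
  have main: "of_nat n * X n l = p_op N n (e 0) l +
      (\<Sum>p\<in>{0<..<n}. (1 - q ^ n) / (1 - q ^ (n - p)) * p_op N (n - p) (e p) l)"
    if "0 < n" "n \<le> m" for n l
    using that
  proof (induction n arbitrary: l rule: less_induct)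
    case (less n)
    have IH: "of_nat j * e j l = (\<Sum>p<j. 1 / (1 - q ^ (j - p)) * p_op N (j - p) (e p) l)"
      if j: "0 < j" "j < n" for j l
    proof -
      let ?Y = "1 / (1 - q ^ j) * p_op N j (e 0) l +
          (\<Sum>p\<in>{0<..<j}. 1 / (1 - q ^ (j - p)) * p_op N (j - p) (e p) l)"
      have ne: "1 - q ^ j \<noteq> 0" using q(2)[of j] j less.prems by auto
      have "(1 - q ^ j) * (of_nat j * e j l) = of_nat j * X j l"
        using Xe[of j l] j less.prems by (simp add: mult_ac)
      also have "\<dots> = p_op N j (e 0) l +
          (\<Sum>p\<in>{0<..<j}. (1 - q ^ j) / (1 - q ^ (j - p)) * p_op N (j - p) (e p) l)"
        using less.IH[of j l] j less.prems by simp
      also have "\<dots> = (1 - q ^ j) * ?Y"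
        using ne by (simp add: distrib_left sum_distrib_left)
      finally have "of_nat j * e j l = ?Y" using ne mult_left_cancel by blast
      moreover have "{..<j} = insert 0 {0<..<j}" using j by auto
      ultimately show ?thesis by simp
    qed
    let ?A = "\<lambda>k b j. p_op N k (h_op N b (e j)) l"
    \<comment> \<open>The two sums are the derivatives of the factors \<open>H(t)\<close> and \<open>e(q t)\<close>.\<close>
    have "of_nat n * X n l = (\<Sum>j<n. q ^ j * (of_nat (n - j) * h_op N (n - j) (e j) l))
        + (\<Sum>j<n. q ^ j * (of_nat j * h_op N (n - j) (e j) l))"
      unfolding X_def sum_distrib_left sum.distrib[symmetric]
      by (rule sum.cong) (auto simp: of_nat_diff algebra_simps)
    also have "(\<Sum>j<n. q ^ j * (of_nat (n - j) * h_op N (n - j) (e j) l)) = (\<Sum>p<n. p_op N (n - p) (e p) l)"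
    proof -
      have "(\<Sum>j<n. q ^ j * (of_nat (n - j) * h_op N (n - j) (e j) l))
          = (\<Sum>j<n. \<Sum>k=1..n - j. q ^ j * ?A k (n - j - k) j)"
        by (simp only: Newton sum_distrib_left)
      also have "\<dots> = (\<Sum>(j, k)\<in>Sigma {..<n} (\<lambda>j. {1..n - j}). q ^ j * ?A k (n - j - k) j)"
        by (rule sum.Sigma) auto
      also have "\<dots> = (\<Sum>(p, j)\<in>Sigma {..<n} (\<lambda>p. {..p}). q ^ j * ?A (n - p) (p - j) j)"
        by (rule sum.reindex_bij_witness[where i = "\<lambda>(p, j). (j, n - p)" and j = "\<lambda>(j, k). (n - k, j)"])
          (auto simp: add.commute)
      also have "\<dots> = (\<Sum>p<n. \<Sum>j\<le>p. q ^ j * ?A (n - p) (p - j) j)"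
        by (rule sum.Sigma[symmetric]) auto
      also have "\<dots> = (\<Sum>p<n. p_op N (n - p) (e p) l)"
      proof (rule sum.cong[OF refl])
        fix p assume p: "p \<in> {..<n}"
        have "(\<Sum>j\<le>p. q ^ j * h_op N (p - j) (e j) l) = e p l" for l
          using Xe[of p l] p less.prems by (simp add: X_def algebra_simps flip: lessThan_Suc_atMost)
        then have "(\<lambda>l. \<Sum>j\<le>p. q ^ j * h_op N (p - j) (e j) l) = e p" by auto
        then show "(\<Sum>j\<le>p. q ^ j * ?A (n - p) (p - j) j) = p_op N (n - p) (e p) l"
          using p_op_weighted_sum[of N "n - p" "\<lambda>j. q ^ j" "\<lambda>j. h_op N (p - j) (e j)" "{..p}" l] by simp
      qed
      finally show ?thesis .
    qed
    also have "(\<Sum>j<n. q ^ j * (of_nat j * h_op N (n - j) (e j) l))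
        = (\<Sum>r\<in>{0<..<n}. q ^ (n - r) / (1 - q ^ (n - r)) * ((1 - q ^ r) * p_op N (n - r) (e r) l))"
    proof -
      have "(\<Sum>j<n. q ^ j * (of_nat j * h_op N (n - j) (e j) l))
          = (\<Sum>j<n. \<Sum>p<j. q ^ j * (1 / (1 - q ^ (j - p)) * ?A (j - p) (n - j) p))"
      proof (rule sum.cong[OF refl])
        fix j assume j: "j \<in> {..<n}"
        show "q ^ j * (of_nat j * h_op N (n - j) (e j) l)
            = (\<Sum>p<j. q ^ j * (1 / (1 - q ^ (j - p)) * ?A (j - p) (n - j) p))"
        proof (cases "j = 0")
          case False
          have "of_nat j * h_op N (n - j) (e j) l = h_op N (n - j) (\<lambda>l. of_nat j * e j l) l"
            by (rule h_op_scale[symmetric])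
          also have "\<dots> = h_op N (n - j) (\<lambda>l. \<Sum>p<j. 1 / (1 - q ^ (j - p)) * p_op N (j - p) (e p) l) l"
            using IH[of j] False j by simp
          also have "\<dots> = (\<Sum>p<j. 1 / (1 - q ^ (j - p)) * h_op N (n - j) (p_op N (j - p) (e p)) l)"
            by (rule h_op_weighted_sum)
          finally show ?thesis by (simp add: sum_distrib_left h_op_p_op_commute)
        qed simp
      qed
      also have "\<dots> = (\<Sum>(j, p)\<in>Sigma {..<n} (\<lambda>j. {..<j}).
          q ^ j * (1 / (1 - q ^ (j - p)) * ?A (j - p) (n - j) p))"
        by (rule sum.Sigma) auto
      also have "\<dots> = (\<Sum>(r, p)\<in>Sigma {0<..<n} (\<lambda>r. {..<r}).
          q ^ (n - r) / (1 - q ^ (n - r)) * (q ^ p * ?A (n - r) (r - p) p))"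
      proof (rule sum.reindex_bij_witness[where i = "\<lambda>(r, p). (p + (n - r), p)" and j = "\<lambda>(j, p). (n - (j - p), p)"])
        fix x assume x: "x \<in> Sigma {..<n} (\<lambda>j. {..<j})"
        obtain j p where [simp]: "x = (j, p)" by force
        have jp: "p < j" "j < n" using x by auto
        then have "n - (n - (j - p)) = j - p" "n - (j - p) - p = n - j" "q ^ (j - p) * q ^ p = q ^ j"
          by (simp_all flip: power_add)
        then show "(case case x of (j, p) \<Rightarrow> (n - (j - p), p) of (r, p) \<Rightarrow>
            q ^ (n - r) / (1 - q ^ (n - r)) * (q ^ p * ?A (n - r) (r - p) p))
          = (case x of (j, p) \<Rightarrow> q ^ j * (1 / (1 - q ^ (j - p)) * ?A (j - p) (n - j) p))"
          by (simp add: mult_ac flip: \<open>q ^ (j - p) * q ^ p = q ^ j\<close>)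
      qed auto
      also have "\<dots> = (\<Sum>r\<in>{0<..<n}. \<Sum>p<r.
          q ^ (n - r) / (1 - q ^ (n - r)) * (q ^ p * ?A (n - r) (r - p) p))"
        by (rule sum.Sigma[symmetric]) auto
      also have "\<dots> = (\<Sum>r\<in>{0<..<n}. q ^ (n - r) / (1 - q ^ (n - r)) * ((1 - q ^ r) * p_op N (n - r) (e r) l))"
      proof (rule sum.cong[OF refl])
        fix r assume r: "r \<in> {0<..<n}"
        have "(\<lambda>l. \<Sum>p<r. q ^ p * h_op N (r - p) (e p) l) = (\<lambda>l. (1 - q ^ r) * e r l)"
          using Xe[of r] r less.prems by (auto simp: X_def)
        then have "(\<Sum>p<r. q ^ p * ?A (n - r) (r - p) p) = (1 - q ^ r) * p_op N (n - r) (e r) l"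
          using p_op_weighted_sum[of N "n - r" "\<lambda>p. q ^ p" "\<lambda>p. h_op N (r - p) (e p)" "{..<r}" l]
          by (simp add: p_op_scale)
        then show "(\<Sum>p<r. q ^ (n - r) / (1 - q ^ (n - r)) * (q ^ p * ?A (n - r) (r - p) p))
            = q ^ (n - r) / (1 - q ^ (n - r)) * ((1 - q ^ r) * p_op N (n - r) (e r) l)"
          by (simp only: sum_distrib_left[symmetric])
      qed
      finally show ?thesis .
    qed
    also have "(\<Sum>p<n. p_op N (n - p) (e p) l) = p_op N n (e 0) l + (\<Sum>p\<in>{0<..<n}. p_op N (n - p) (e p) l)"
    proof -
      have "{..<n} = insert 0 {0<..<n}" using less.prems by auto
      then show ?thesis by simp
    qed
    also have "p_op N n (e 0) l + (\<Sum>p\<in>{0<..<n}. p_op N (n - p) (e p) l)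
        + (\<Sum>p\<in>{0<..<n}. q ^ (n - p) / (1 - q ^ (n - p)) * ((1 - q ^ p) * p_op N (n - p) (e p) l))
      = p_op N n (e 0) l + (\<Sum>p\<in>{0<..<n}. (1 - q ^ n) / (1 - q ^ (n - p)) * p_op N (n - p) (e p) l)"
    proof -
      have "p_op N (n - p) (e p) l + q ^ (n - p) / (1 - q ^ (n - p)) * ((1 - q ^ p) * p_op N (n - p) (e p) l)
          = (1 - q ^ n) / (1 - q ^ (n - p)) * p_op N (n - p) (e p) l" if p: "p \<in> {0<..<n}" for p
      proof -
        have "0 < n - p" "n - p < m" using p less.prems by auto
        then have ne: "1 - q ^ (n - p) \<noteq> 0" using q(2) by simp
        have "q ^ n = q ^ (n - p) * q ^ p" using p by (simp flip: power_add)
        then have num: "1 - q ^ n = (1 - q ^ (n - p)) + q ^ (n - p) * (1 - q ^ p)" by (simp add: algebra_simps)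
        have "(1 - q ^ n) / (1 - q ^ (n - p)) = 1 + q ^ (n - p) * (1 - q ^ p) / (1 - q ^ (n - p))"
          unfolding num add_divide_distrib using ne by simp
        then show ?thesis by (simp add: distrib_right)
      qed
      then show ?thesis by (simp add: add.assoc flip: sum.distrib)
    qed
    finally show ?case .
  qed
  have "e 0 = G 0" by (auto simp: e_def qf_def)
  then have "of_nat m * X m l = p_op N m (G 0) l" using main[of m l] m q(1) by simp
  then show ?thesis using GX[of m l] m by (simp add: qf_def)
qed

lemma compositions_1: "compositions (Suc 0) a = {\<lambda>i. if i = 0 then a else 0}"
  by (auto simp: compositions_def fun_eq_iff)

text \<open>The product is the constant in the relation between \<open>G m\<close> and \<open>G 0\<close>. It can be read off from the
  case of one variable, in which all operators fix the constant function 1.\<close>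

lemma prod_one_minus_root_powers:
  fixes q :: "'a::field_char_0"
  assumes "q ^ m = 1" "\<And>k. 0 < k \<Longrightarrow> k < m \<Longrightarrow> q ^ k \<noteq> 1" "m > 0"
  shows "(\<Prod>s\<in>{0<..<m}. 1 - q ^ s) = of_nat m"
proof -
  have "of_nat m * (1 :: 'a) = (\<Prod>s\<in>{0<..<m}. 1 - q ^ s) * p_op 1 m (\<lambda>_. 1) (\<lambda>_. 0)"
    using maj_recursion_at_root_of_unity[OF assms, of "\<lambda>_ _. 1" 1 "\<lambda>_. 0"]
    by (simp add: h_op_def compositions_1 maj_weight_sum_1)
  then show ?thesis by (simp add: p_op_def)
qed

text \<open>For index \<open>d m + n\<close> all terms below \<open>d m\<close> contain the factor \<open>1 - q\<^bsup>d m\<^esup> = 0\<close>. So the recursion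
  restarts at every multiple of \<open>m\<close>, and each round multiplies by \<open>p\<^sub>m\<close>.\<close>

theorem maj_operator_root_of_unity:
  fixes q :: "'a::field_char_0"
  assumes q: "q ^ m = 1" "\<And>k. 0 < k \<Longrightarrow> k < m \<Longrightarrow> q ^ k \<noteq> 1" and m: "m > 0"
  shows "maj_operator N q F (d * m) = (p_op N m ^^ d) F"
proof (induction d)
  case 0
  show ?case by (subst maj_operator.simps) simp
next
  case (Suc d)
  let ?G = "\<lambda>n. maj_operator N q F (d * m + n)"
  have qdm: "q ^ (d * m) = 1" using q(1) by (metis mult.commute power_mult power_one)
  have rec: "?G n l = (\<Sum>p<n. maj_weight q n p * h_op N (n - p) (?G p) l)" if n: "0 < n" for n l
  proof -
    have period: "q ^ (s - d * m) = q ^ s" if "d * m \<le> s" for s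
    proof -
      have "q ^ s = q ^ (d * m + (s - d * m))" using that by simp
      also have "\<dots> = q ^ (s - d * m)" by (simp only: power_add qdm mult_1)
      finally show ?thesis ..
    qed
    have low: "maj_weight q (d * m + n) p = 0" if "p < d * m" for p
      unfolding maj_weight_def using that n qdm by (auto intro!: bexI[of _ "d * m"])
    have shift: "maj_weight q (d * m + n) (d * m + p) = maj_weight q n p" for p
    proof -
      have "(\<Prod>s\<in>{d * m + p<..<d * m + n}. 1 - q ^ s) = (\<Prod>s\<in>{p<..<n}. 1 - q ^ s)"
        by (rule prod.reindex_bij_witness[where i = "\<lambda>s. d * m + s" and j = "\<lambda>s. s - d * m"])
          (auto simp: power_add qdm period)
      then show ?thesis by (simp add: maj_weight_def power_add qdm)
    qed
    have "?G n l = (\<Sum>p<d * m + n. maj_weight q (d * m + n) p * h_op N (d * m + n - p) (maj_operator N q F p) l)"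
      using n by (subst maj_operator.simps) simp
    also have "\<dots> = (\<Sum>p\<in>{d * m..<d * m + n}. maj_weight q (d * m + n) p *
        h_op N (d * m + n - p) (maj_operator N q F p) l)"
      by (rule sum.mono_neutral_right) (auto simp: low)
    also have "\<dots> = (\<Sum>p<n. maj_weight q n p * h_op N (n - p) (?G p) l)"
      by (rule sum.reindex_bij_witness[where i = "\<lambda>p. d * m + p" and j = "\<lambda>p. p - d * m"])
        (auto simp: add.commute simp flip: shift)
    finally show ?thesis .
  qed
  have "of_nat m * ?G m l = of_nat m * p_op N m (?G 0) l" for l
    using maj_recursion_at_root_of_unity[OF q m, of ?G N l] rec prod_one_minus_root_powers[OF q m] by simp
  then have "?G m = p_op N m (?G 0)" using m by auto
  then show ?case using Suc.IH by (simp add: add.commute)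
qed

section \<open>The skew character, the major index and the border-strip tableaux\<close>

definition row_lengths :: "nat list \<Rightarrow> nat \<Rightarrow> nat" where
  "row_lengths nu i = (if i < length nu then nu ! i else 0)"

lemma diagram_row_lengths: "diagram nu = boxes (row_lengths nu)"
  by (auto simp: diagram_def boxes_def row_lengths_def split: if_splits)

lemma shape_row_lengths:
  assumes "is_partition nu" shows "shape (length nu) (row_lengths nu)"
proof -
  have "nu ! j \<le> nu ! i" if "i \<le> j" "j < length nu" for i j
    using assms that sorted_wrt_nth_less[of "(\<ge>)" nu i j] by (cases "i = j") (auto simp: is_partition_def)
  then show ?thesis by (auto simp: shape_def antimono_def row_lengths_def)
qed

locale skew_shape =
  fixes lam mu :: "nat list" and n :: nat
  assumes skew: "is_skew_shape lam mu" and boxes_count: "card (skew_diagram lam mu) = n"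
begin

abbreviation "N \<equiv> length lam"
abbreviation "f \<equiv> row_lengths lam"
abbreviation "g \<equiv> row_lengths mu"

lemma inner_le_outer: "g \<le> f"
  using skew by (simp add: is_skew_shape_def diagram_row_lengths boxes_subset_iff)

lemma outer_shape: "shape N f"
  using skew by (simp add: is_skew_shape_def shape_row_lengths)

lemma inner_shape: "shape N g"
proof -
  have "antimono g" using skew shape_row_lengths by (auto simp: is_skew_shape_def shape_def)
  moreover have "g i = 0" if "i \<ge> N" for i
  proof -
    have "g i \<le> f i" using inner_le_outer by (simp add: le_fun_def)
    also have "f i = 0" using that by (simp add: row_lengths_def)
    finally show ?thesis by simp
  qed
  ultimately show ?thesis by (simp add: shape_def)
qed

lemma skew_diagram_boxes: "skew_diagram lam mu = boxes f - boxes g"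
  by (simp add: skew_diagram_def diagram_row_lengths)

lemma finite_skew_diagram: "finite (skew_diagram lam mu)"
  unfolding skew_diagram_boxes by (rule finite_boxes_diff[OF outer_shape])

lemma SSYT_content:
  assumes "set_mset M \<subseteq> {..<L}"
  shows "{T \<in> SSYT lam mu. image_mset T (mset_set (skew_diagram lam mu)) = M}
    = semistandard f g L (count M)"
proof -
  let ?D = "skew_diagram lam mu"
  have "image_mset T (mset_set ?D) = M \<longleftrightarrow>
      T ` ?D \<subseteq> {..<L} \<and> (\<forall>x<L. card {b \<in> ?D. T b = x} = count M x)" for T :: "nat \<times> nat \<Rightarrow> nat"
  proof -
    have cnt: "count (image_mset T (mset_set ?D)) x = card {b \<in> ?D. T b = x}" for x
    proof -
      have "count (image_mset T (mset_set ?D)) x = (\<Sum>b\<in>T -` {x} \<inter> ?D. 1)"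
        unfolding count_image_mset using finite_skew_diagram by (intro sum.cong) auto
      also have "T -` {x} \<inter> ?D = {b \<in> ?D. T b = x}" by auto
      finally show ?thesis by simp
    qed
    show ?thesis
    proof
      assume eq: "image_mset T (mset_set ?D) = M"
      then have "T ` ?D = set_mset M" using finite_skew_diagram by auto
      then show "T ` ?D \<subseteq> {..<L} \<and> (\<forall>x<L. card {b \<in> ?D. T b = x} = count M x)"
        using assms cnt eq by simp
    next
      assume r: "T ` ?D \<subseteq> {..<L} \<and> (\<forall>x<L. card {b \<in> ?D. T b = x} = count M x)"
      show "image_mset T (mset_set ?D) = M"
      proof (rule multiset_eqI)
        fix x
        show "count (image_mset T (mset_set ?D)) x = count M x"
        proof (cases "x < L")
          case True
          then show ?thesis using r cnt by simp
        next
          case False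
          then have none: "{b \<in> ?D. T b = x} = {}" "x \<notin># M" using r assms by auto
          show ?thesis unfolding cnt none(1) using none(2) by (simp add: not_in_iff)
        qed
      qed
    qed
  qed
  then show ?thesis by (auto simp: SSYT_def semistandard_def skew_diagram_boxes)
qed

definition expansion_coefficient :: "nat list \<Rightarrow> rat" where
  "expansion_coefficient nu =
     (if nu \<in> partitions_of n then foldr (p_op N) nu (alternating_delta N g) (beads f) else 0)"

lemma skew_schur_expansion:
  "skew_schur lam mu M
    = (\<Sum>nu\<in>partitions_of n. expansion_coefficient nu * power_sum_partition nu M / of_nat (z_partition nu))"
proof (cases "size M = n")
  case True
  obtain L where L: "set_mset M \<subseteq> {..<L}" using finite_nat_set_iff_bounded[of "set_mset M"] by auto
  have "skew_schur lam mu M = h_product N (alternating_delta N g) L (count M) (beads f)"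
    by (simp add: skew_schur_def SSYT_content[OF L]
        h_product_semistandard[OF inner_shape outer_shape] inner_le_outer)
  also have "\<dots> = power_sum_expansion N (alternating_delta N g) M (beads f)"
    by (rule h_product_power_sums[OF L])
  also have "\<dots> = (\<Sum>nu\<in>partitions_of n.
      expansion_coefficient nu * power_sum_partition nu M / of_nat (z_partition nu))"
    unfolding power_sum_expansion_def True by (rule sum.cong) (auto simp: expansion_coefficient_def)
  finally show ?thesis .
next
  case False
  then have none: "{T \<in> SSYT lam mu. image_mset T (mset_set (skew_diagram lam mu)) = M} = {}"
    using boxes_count by auto
  have "power_sum_partition nu M = 0" if "nu \<in> partitions_of n" for nu
    using power_sum_partition_support[of nu M] that False
    by (auto simp: partitions_of_def is_partition_def)
  then show ?thesis unfolding skew_schur_def none by simp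
qed

theorem skew_character_eq: "skew_character lam mu = expansion_coefficient"
  unfolding skew_character_def boxes_count
proof (rule the_equality)
  show "(\<forall>nu. nu \<notin> partitions_of n \<longrightarrow> expansion_coefficient nu = 0) \<and>
      (\<forall>M. skew_schur lam mu M = (\<Sum>nu\<in>partitions_of n.
        expansion_coefficient nu * power_sum_partition nu M / of_nat (z_partition nu)))"
    using skew_schur_expansion by (simp add: expansion_coefficient_def)
next
  fix chi :: "nat list \<Rightarrow> rat"
  assume chi: "(\<forall>nu. nu \<notin> partitions_of n \<longrightarrow> chi nu = 0) \<and>
      (\<forall>M. skew_schur lam mu M = (\<Sum>nu\<in>partitions_of n.
        chi nu * power_sum_partition nu M / of_nat (z_partition nu)))"
  have "chi nu = expansion_coefficient nu" if nu: "nu \<in> partitions_of n" for nu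
  proof -
    define e where "e nu = (chi nu - expansion_coefficient nu) / of_nat (z_partition nu)" for nu
    have "(\<Sum>nu\<in>partitions_of n. e nu * power_sum_partition nu M) = 0" for M
    proof -
      have "(\<Sum>nu\<in>partitions_of n. e nu * power_sum_partition nu M)
          = (\<Sum>nu\<in>partitions_of n. chi nu * power_sum_partition nu M / of_nat (z_partition nu))
          - (\<Sum>nu\<in>partitions_of n. expansion_coefficient nu * power_sum_partition nu M / of_nat (z_partition nu))"
        unfolding sum_subtractf[symmetric]
        by (rule sum.cong) (auto simp: e_def left_diff_distrib diff_divide_distrib)
      then show ?thesis using chi skew_schur_expansion[of M] by simp
    qed
    then have "e nu = 0" using power_sums_independent nu by blast
    moreover have "z_partition nu \<noteq> 0"
      using z_partition_pos[of nu] nu by (auto simp: partitions_of_def is_partition_def)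
    ultimately show ?thesis by (simp add: e_def)
  qed
  then show "chi = expansion_coefficient"
    using chi by (auto simp: fun_eq_iff expansion_coefficient_def)
qed

lemma maj_polynomial_eq: "maj_polynomial lam mu q = maj_operator N q (alternating_delta N g) n (beads f)"
proof -
  have "descents lam mu T = tableau_descents (boxes f - boxes g) T" for T
    by (simp add: descents_def tableau_descents_def skew_diagram_boxes)
  moreover have "SYT lam mu = standard f g" by (simp add: SYT_def standard_def skew_diagram_boxes)
  ultimately show ?thesis
    using boxes_count
    by (simp add: maj_polynomial_def maj_def skew_diagram_boxes inner_le_outer
        maj_operator_standard[OF inner_shape outer_shape])
qed

lemma BST_eq:
  assumes n: "n = d * m" and m: "m > 0"
  shows "BST lam mu m = border_strip_tableaux f g m d"
proof -
  let ?D = "skew_diagram lam mu"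
  have d: "d' = d" if im: "B ` ?D = {1..d'}" and c: "\<forall>j\<in>{1..d'}. card {b \<in> ?D. B b = j} = m" for B d'
  proof -
    have "?D = (\<Union>j\<in>{1..d'}. {b \<in> ?D. B b = j})" using im by auto
    then have "card ?D = card (\<Union>j\<in>{1..d'}. {b \<in> ?D. B b = j})" by simp
    also have "\<dots> = (\<Sum>j\<in>{1..d'}. card {b \<in> ?D. B b = j})"
      by (rule card_UN_disjoint) (use finite_skew_diagram in auto)
    also have "\<dots> = d' * m" using c by simp
    finally show ?thesis using boxes_count n m by simp
  qed
  have strip: "strip lam mu B j = {b \<in> ?D. B b = j}" for B j by (simp add: strip_def)
  show ?thesis
    unfolding BST_def border_strip_tableaux_def strip skew_diagram_boxes[symmetric]
    using d by (intro Collect_cong) blast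
qed

lemma height_eq: "height lam mu B = tableau_height f g B"
  by (simp add: height_def tableau_height_def strip_def skew_diagram_boxes)

lemma p_op_power_BST:
  assumes "n = d * m" "m > 0"
  shows "(p_op N m ^^ d) (alternating_delta N g) (beads f) = (\<Sum>B\<in>BST lam mu m. (-1) ^ height lam mu B)"
  by (simp add: BST_eq[OF assms] height_eq inner_le_outer
      p_op_power_border_strip_tableaux[OF inner_shape assms(2) outer_shape])

lemma height_parity:
  assumes "n = d * m" "m > 0" and B: "B \<in> BST lam mu m" "B' \<in> BST lam mu m"
  shows "even (height lam mu B) \<longleftrightarrow> even (height lam mu B')"
proof -
  let ?R = "\<lambda>h. pair_product N (runner_order m) (beads h)"
  have "?R g = (-1) ^ height lam mu B * ?R f" "?R g = (-1) ^ height lam mu B' * ?R f"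
    unfolding height_eq
    by (rule runner_order_tableau[OF inner_shape assms(2) outer_shape inner_le_outer],
        rule B[unfolded BST_eq[OF assms(1,2)]])+
  then have "(-1 :: rat) ^ height lam mu B = (-1) ^ height lam mu B'"
    using runner_order_nonzero[OF outer_shape, of m] mult_right_cancel by metis
  then show ?thesis by (simp add: minus_one_power_iff split: if_splits)
qed

end

theorem corollary27:
  fixes lam mu :: "nat list" and d m n :: nat and \<xi> :: complex
  assumes "is_skew_shape lam mu"
    and "d > 0" and "m > 0"
    and "n = d * m" and "card (skew_diagram lam mu) = n"
    and "primitive_root_of_unity n \<xi>"
  shows "skew_character lam mu (replicate d m) = (\<Sum>B\<in>BST lam mu m. (-1) ^ height lam mu B)
    \<and> (\<forall>B\<in>BST lam mu m. \<forall>B'\<in>BST lam mu m.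
          (-1 :: int) ^ height lam mu B = (-1) ^ height lam mu B')
    \<and> maj_polynomial lam mu (\<xi> ^ d) = of_rat (skew_character lam mu (replicate d m))
    \<and> (\<forall>B\<in>BST lam mu m. skew_character lam mu (replicate d m)
          = (-1) ^ height lam mu B * of_nat (card (BST lam mu m)))
    \<and> (BST lam mu m = {} \<longrightarrow> maj_polynomial lam mu (\<xi> ^ d) = 0
          \<and> skew_character lam mu (replicate d m) = 0)"
proof -
  interpret skew_shape lam mu n by unfold_locales (use assms in auto)
  let ?S = "BST lam mu m" and ?chi = "skew_character lam mu (replicate d m)"
  have "replicate d m \<in> partitions_of n"
    using assms(3,4) by (auto simp: partitions_of_def is_partition_def sum_list_replicate sorted_wrt_iff_nth_less)
  then have chi: "?chi = (\<Sum>B\<in>?S. (-1) ^ height lam mu B)"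
    by (simp add: skew_character_eq expansion_coefficient_def p_op_power_BST[OF assms(4,3)])
  have root: "(\<xi> ^ d) ^ m = 1" "\<And>k. 0 < k \<Longrightarrow> k < m \<Longrightarrow> (\<xi> ^ d) ^ k \<noteq> 1"
    using assms(2,4,6) by (auto simp: primitive_root_of_unity_def simp flip: power_mult)
  have "maj_operator N (\<xi> ^ d) (alternating_delta N g) (d * m) = (p_op N m ^^ d) (alternating_delta N g)"
    by (rule maj_operator_root_of_unity) (use root assms(3) in auto)
  then have "maj_polynomial lam mu (\<xi> ^ d) = (\<Sum>B\<in>?S. (-1) ^ height lam mu B)"
    by (simp add: maj_polynomial_eq assms(4) p_op_power_BST[OF assms(4,3)])
  also have "\<dots> = of_rat ?chi" unfolding chi by (simp add: of_rat_sum of_rat_power)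
  finally have maj: "maj_polynomial lam mu (\<xi> ^ d) = of_rat ?chi" .
  have parity: "even (height lam mu B) \<longleftrightarrow> even (height lam mu B')" if "B \<in> ?S" "B' \<in> ?S" for B B'
    by (rule height_parity[OF assms(4,3) that])
  have "?chi = (-1) ^ height lam mu B * of_nat (card ?S)" if B: "B \<in> ?S" for B
  proof -
    have "?chi = (\<Sum>B'\<in>?S. (-1) ^ height lam mu B)"
      unfolding chi by (rule sum.cong) (use parity[OF B] in \<open>auto simp: minus_one_power_iff\<close>)
    then show ?thesis by (simp add: mult.commute)
  qed
  moreover have "(-1 :: int) ^ height lam mu B = (-1) ^ height lam mu B'" if "B \<in> ?S" "B' \<in> ?S" for B B'
    using parity[OF that] by (simp add: minus_one_power_iff)
  moreover have "maj_polynomial lam mu (\<xi> ^ d) = 0 \<and> ?chi = 0" if "?S = {}"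
    using chi maj that by simp
  ultimately show ?thesis using chi maj by blast
qed

end
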